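(* Let $$P_{Z(\check B)}=\{\mu\in P^+(\pi)\mid\Theta(\mu)=\mu+w_0\mu-w_0'\mu\}$$ and let $\mathrm{rank}(P_{Z(\check B)})=m$, where $\nu_1,\dots,\nu_m\in P^+(\pi)$ are the elements, uniquely determined up to ordering, such that $P_{Z(\check B)}=\bigoplus_{i=1}^m\mathbb N\nu_i$. Then $\mathrm{rank}(P_{Z(\check B)})=\mathrm{rank}(\mathfrak g^\theta)$.
   Context: $\mathbb N$ contains $0$. $\mathfrak g$ is a finite-dimensional complex semisimple Lie algebra with Cartan subalgebra $\mathfrak h$, simple roots $\pi=\{\alpha_1,\dots,\alpha_n\}$, dominant integral weights $P^+(\pi)$, Weyl group $W$ with longest element $w_0$, Chevalley generators $e_i,f_i$. $\theta$ is an involutive automorphism of $\mathfrak g$, maximally split: $\theta(\mathfrak h)=\mathfrak h$, and, with $\Theta$ the induced involution of $\mathfrak h^*$, if $\Theta(\alpha_i)=\alpha_i$ then $\theta(e_i)=e_i$, $\theta(f_i)=f_i$, while if $\Theta(\alpha_i)\ne\alpha_i$ then $\theta(e_i)$ (resp. $\theta(f_i)$) is a root vector for a negative (resp. positive) root. $\pi_\Theta=\{\alpha_i\in\pi:\Theta(\alpha_i)=\alpha_i\}$ and $w_0'$ is the longest element of the subgroup of $W$ generated by the simple reflections for $\pi_\Theta$. $\mathfrak g^\theta$ is the (reductive) Lie subalgebra of elements fixed by $\theta$; its rank is the dimension of a Cartan subalgebra. For every such pair, the monoid $P_{Z(\check B)}$ has free generators $\nu_1,\dots,\nu_m$ as in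 the claim, unique up to ordering. *)

theory Defs
  imports Complex_Main "HOL-Library.Function_Algebras" "HOL-Library.FuncSet"
begin

locale lie_algebra = vector_space scale
  for scale :: "complex \<Rightarrow> 'g::ab_group_add \<Rightarrow> 'g" (infixr "*s" 75) +
  fixes br :: "'g \<Rightarrow> 'g \<Rightarrow> 'g"
  assumes br_add_left: "br (x + y) z = br x z + br y z"
    and br_add_right: "br x (y + z) = br x y + br x z"
    and br_scale_left: "br (c *s x) y = c *s br x y"
    and br_scale_right: "br x (c *s y) = c *s br x y"
    and br_self: "br x x = 0"
    and jacobi: "br x (br y z) + br y (br z x) + br z (br x y) = 0"
begin

definition br_span :: "'g set \<Rightarrow> 'g set \<Rightarrow> 'g set" where
  "br_span A B = span {br x y | x y. x \<in> A \<and> y \<in> B}"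

definition lie_subalgebra :: "'g set \<Rightarrow> bool" where
  "lie_subalgebra L \<longleftrightarrow> subspace L \<and> (\<forall>x\<in>L. \<forall>y\<in>L. br x y \<in> L)"

definition lie_ideal :: "'g set \<Rightarrow> bool" where
  "lie_ideal I \<longleftrightarrow> subspace I \<and> (\<forall>x. \<forall>y\<in>I. br x y \<in> I)"

definition lie_solvable :: "'g set \<Rightarrow> bool" where
  "lie_solvable L \<longleftrightarrow> (\<exists>k. ((\<lambda>X. br_span X X) ^^ k) L = {0})"

definition lie_nilpotent :: "'g set \<Rightarrow> bool" where
  "lie_nilpotent L \<longleftrightarrow> (\<exists>k. ((\<lambda>X. br_span L X) ^^ k) L = {0})"

definition cartan_subalgebra :: "'g set \<Rightarrow> 'g set \<Rightarrow> bool" where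
  "cartan_subalgebra L C \<longleftrightarrow> lie_subalgebra C \<and> C \<subseteq> L \<and> lie_nilpotent C \<and>
     {x \<in> L. \<forall>y\<in>C. br x y \<in> C} = C"

text \<open>The choice of the Cartan subalgebra is irrelevant: over the complex numbers, all Cartan
  subalgebras of a finite-dimensional Lie algebra have the same dimension.\<close>

definition lie_rank :: "'g set \<Rightarrow> nat" where
  "lie_rank L = dim (SOME C. cartan_subalgebra L C)"

text \<open>A linear functional on the subspace \<open>H\<close> is represented by the function on the whole
  space that vanishes outside \<open>H\<close>, so that the vector space operations of the dual
  of \<open>H\<close> are the pointwise ones.\<close>

definition dual_space :: "'g set \<Rightarrow> ('g \<Rightarrow> complex) set" where
  "dual_space H = {\<mu>. (\<forall>x\<in>H. \<forall>y\<in>H. \<mu> (x + y) = \<mu> x + \<mu> y) \<and>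
     (\<forall>c. \<forall>x\<in>H. \<mu> (c *s x) = c * \<mu> x) \<and> (\<forall>x. x \<notin> H \<longrightarrow> \<mu> x = 0)}"

definition root_space :: "'g set \<Rightarrow> ('g \<Rightarrow> complex) \<Rightarrow> 'g set" where
  "root_space H \<beta> = {x. \<forall>h\<in>H. br h x = \<beta> h *s x}"

definition roots :: "'g set \<Rightarrow> ('g \<Rightarrow> complex) set" where
  "roots H = {\<beta> \<in> dual_space H. \<beta> \<noteq> 0 \<and> root_space H \<beta> \<noteq> {0}}"

definition lie_automorphism :: "('g \<Rightarrow> 'g) \<Rightarrow> bool" where
  "lie_automorphism \<phi> \<longleftrightarrow> Vector_Spaces.linear scale scale \<phi> \<and> bij \<phi> \<and>
     (\<forall>x y. \<phi> (br x y) = br (\<phi> x) (\<phi> y))"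

end

definition fixed_points :: "('g \<Rightarrow> 'g) \<Rightarrow> 'g set" where
  "fixed_points \<theta> = {x. \<theta> x = x}"

locale semisimple_lie_algebra = lie_algebra +
  assumes finite_dim: "\<exists>B. finite B \<and> span B = UNIV"
    and semisimple: "lie_ideal I \<Longrightarrow> lie_solvable I \<Longrightarrow> I = {0}"

locale semisimple_with_chevalley_generators = semisimple_lie_algebra scale br
  for scale :: "complex \<Rightarrow> 'g::ab_group_add \<Rightarrow> 'g" (infixr "*s" 75)
    and br :: "'g \<Rightarrow> 'g \<Rightarrow> 'g" +
  fixes H :: "'g set"
    and n :: nat
    and \<alpha> :: "nat \<Rightarrow> 'g \<Rightarrow> complex"
    and e f :: "nat \<Rightarrow> 'g"
  assumes cartan: "cartan_subalgebra UNIV H"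
    and simple_roots: "\<alpha> ` {1..n} \<subseteq> roots H"
    and simple_roots_inj: "inj_on \<alpha> {1..n}"
    and simple_roots_independent:
      "\<not> module.dependent (\<lambda>c \<mu> x. c * \<mu> x) (\<alpha> ` {1..n})"
    and simple_roots_base: "\<beta> \<in> roots H \<Longrightarrow>
      \<exists>c :: nat \<Rightarrow> nat. \<beta> = (\<lambda>x. \<Sum>i=1..n. of_nat (c i) * \<alpha> i x) \<or>
                      \<beta> = - (\<lambda>x. \<Sum>i=1..n. of_nat (c i) * \<alpha> i x)"
    and e_root_vector: "i \<in> {1..n} \<Longrightarrow> e i \<in> root_space H (\<alpha> i)"
    and f_root_vector: "i \<in> {1..n} \<Longrightarrow> f i \<in> root_space H (- \<alpha> i)"
    \<comment> \<open>This makes \<open>br (e i) (f i)\<close> the simple coroot; the other Chevalley relations follow.\<close>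
    and e_f_normalized: "i \<in> {1..n} \<Longrightarrow> \<alpha> i (br (e i) (f i)) = 2"
begin

definition coroot :: "nat \<Rightarrow> 'g" where
  "coroot i = br (e i) (f i)"

definition positive_roots :: "('g \<Rightarrow> complex) set" where
  "positive_roots = {\<beta> \<in> roots H.
     \<exists>c :: nat \<Rightarrow> nat. \<beta> = (\<lambda>x. \<Sum>i=1..n. of_nat (c i) * \<alpha> i x)}"

definition negative_roots :: "('g \<Rightarrow> complex) set" where
  "negative_roots = uminus ` positive_roots"

definition dominant_weights :: "('g \<Rightarrow> complex) set" where
  "dominant_weights = {\<mu> \<in> dual_space H. \<forall>i\<in>{1..n}. \<mu> (coroot i) \<in> \<nat>}"

definition simple_reflection :: "nat \<Rightarrow> ('g \<Rightarrow> complex) \<Rightarrow> 'g \<Rightarrow> complex" where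
  "simple_reflection i \<mu> = (\<lambda>x. \<mu> x - \<mu> (coroot i) * \<alpha> i x)"

definition reflection_product :: "nat list \<Rightarrow> ('g \<Rightarrow> complex) \<Rightarrow> 'g \<Rightarrow> complex" where
  "reflection_product is = foldr (\<lambda>i w. simple_reflection i \<circ> w) is id"

text \<open>The subgroup of the Weyl group generated by the simple reflections with index in \<open>J\<close>;
  as these are involutions, inverses need not be added. It acts on all functions, but each of its
  elements is determined by its restriction to the dual of \<open>H\<close>.\<close>

definition weyl_group :: "nat set \<Rightarrow> (('g \<Rightarrow> complex) \<Rightarrow> 'g \<Rightarrow> complex) set" where
  "weyl_group J = reflection_product ` lists J"

definition weyl_length :: "nat set \<Rightarrow> (('g \<Rightarrow> complex) \<Rightarrow> 'g \<Rightarrow> complex) \<Rightarrow> nat" where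
  "weyl_length J w = (LEAST k. \<exists>is\<in>lists J. length is = k \<and> reflection_product is = w)"

definition longest_element :: "nat set \<Rightarrow> ('g \<Rightarrow> complex) \<Rightarrow> 'g \<Rightarrow> complex" where
  "longest_element J = arg_max_on (weyl_length J) (weyl_group J)"

end

text \<open>The map on the dual of \<open>H\<close> induced by an involution \<open>\<theta>\<close> with \<open>\<theta> ` H = H\<close>. It respects
  the convention on functionals, because \<open>\<theta>\<close> then also preserves the complement of \<open>H\<close>. The root
  space of \<open>\<beta>\<close> is mapped by \<open>\<theta>\<close> onto that of \<open>dual_involution \<theta> \<beta>\<close>.\<close>

definition dual_involution :: "('g \<Rightarrow> 'g) \<Rightarrow> ('g \<Rightarrow> complex) \<Rightarrow> 'g \<Rightarrow> complex" where
  "dual_involution \<theta> \<mu> = \<mu> \<circ> \<theta>"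

locale maximally_split_pair = semisimple_with_chevalley_generators scale br H n \<alpha> e f
  for scale :: "complex \<Rightarrow> 'g::ab_group_add \<Rightarrow> 'g" (infixr "*s" 75)
    and br :: "'g \<Rightarrow> 'g \<Rightarrow> 'g"
    and H :: "'g set"
    and n :: nat
    and \<alpha> :: "nat \<Rightarrow> 'g \<Rightarrow> complex"
    and e f :: "nat \<Rightarrow> 'g" +
  fixes \<theta> :: "'g \<Rightarrow> 'g"
  assumes automorphism: "lie_automorphism \<theta>"
    and involutive: "\<theta> \<circ> \<theta> = id"
    and preserves_cartan: "\<theta> ` H = H"
    and fixed_simple_root: "\<lbrakk>i \<in> {1..n}; dual_involution \<theta> (\<alpha> i) = \<alpha> i\<rbrakk> \<Longrightarrow>
      \<theta> (e i) = e i \<and> \<theta> (f i) = f i"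
    and moved_simple_root_e: "\<lbrakk>i \<in> {1..n}; dual_involution \<theta> (\<alpha> i) \<noteq> \<alpha> i\<rbrakk> \<Longrightarrow>
      \<exists>\<beta>\<in>negative_roots. \<theta> (e i) \<in> root_space H \<beta> - {0}"
    and moved_simple_root_f: "\<lbrakk>i \<in> {1..n}; dual_involution \<theta> (\<alpha> i) \<noteq> \<alpha> i\<rbrakk> \<Longrightarrow>
      \<exists>\<beta>\<in>positive_roots. \<theta> (f i) \<in> root_space H \<beta> - {0}"
begin

definition w0 :: "('g \<Rightarrow> complex) \<Rightarrow> 'g \<Rightarrow> complex" where
  "w0 = longest_element {1..n}"

definition w0' :: "('g \<Rightarrow> complex) \<Rightarrow> 'g \<Rightarrow> complex" where
  "w0' = longest_element {i \<in> {1..n}. dual_involution \<theta> (\<alpha> i) = \<alpha> i}"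

definition P_Z :: "('g \<Rightarrow> complex) set" where
  "P_Z = {\<mu> \<in> dominant_weights. dual_involution \<theta> \<mu> = \<mu> + w0 \<mu> - w0' \<mu>}"

end

text \<open>\<open>P\<close> is the direct sum of the \<open>\<nat> \<nu>\<^sub>i\<close>, \<open>1 \<le> i \<le> m\<close>: each element of \<open>P\<close> is a
  combination of the \<open>\<nu>\<^sub>i\<close> with unique natural coefficients, and all these combinations lie in \<open>P\<close>.\<close>

definition freely_generates :: "nat \<Rightarrow> (nat \<Rightarrow> 'g \<Rightarrow> complex) \<Rightarrow> ('g \<Rightarrow> complex) set \<Rightarrow> bool" where
  "freely_generates m \<nu> P \<longleftrightarrow>
     bij_betw (\<lambda>c :: nat \<Rightarrow> nat. \<lambda>x. \<Sum>i=1..m. of_nat (c i) * \<nu> i x) ({1..m} \<rightarrow>\<^sub>E UNIV) P"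

end

(*
  For an automorphism phi, the functionals y |-> tr (phi^k ad y) are phi-invariant, so the number of
  independent ones is a lower bound for dim ker (phi - 1). In an entire family of automorphisms this
  number can only drop, and the fixed space can only grow, on a countable set. The dominant weights
  in question are those invariant under psi = theta o w, where w is a product of exponentials of
  e_i, f_i and psi permutes the simple roots. Scaling the exponents gives an entire path from theta
  to psi. Twisting its ends by generic semisimple elements of a Cartan subalgebra C of the fixed
  points of theta and of H^psi makes lower and upper bound meet at both ends, at dim C and at
  dim H^psi, so these are equal. Finally dim H^psi is the number of orbits of the permutation, and
  the orbit sums of the fundamental weights freely generate the invariant dominant weights.
*)
theory Submission
  imports Defs "HOL-Complex_Analysis.Conformal_Mappings"
    "HOL-Computational_Algebra.Fundamental_Theorem_Algebra"
begin

text \<open>Fixed-space dimensions alone cannot link the two ends: they only jump upwards at special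
  parameters, and at \<theta> itself one meets the dimension of the whole fixed subalgebra, not its
  rank. Hence the second count, by functionals, which bounds the kernel of phi - 1 because each
  functional kills the range of phi - 1. What the generic twist achieves is that an eigenvalue of
  the twisted map reveals the weight of its vector under the chosen subalgebra T. Fixed vectors then
  have weight 0 and lie in T. If tr (phi^k ad y) = 0 for all k, these traces are exponential sums
  whose coefficients vanish one by one, so every weight is 0 at y; then y is orthogonal to
  everything under the Killing form, and y = 0. A Cartan subalgebra of the fixed points is given
  only as a nilpotent algebra. Its elements are not assumed to commute or to be semisimple, so the
  argument uses generalized weight spaces, the twist uses semisimple parts only, and Engel's theorem
  supplies the vanishing of tr (ad y ad v). Maximal splitness enters once: it makes w0' \<Theta>
  send simple roots to negative ones, so that the factor w0^(-1) turns them into positive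
  roots.\<close>

no_notation vector_scalar_mult (infixl \<open>*s\<close> 70)

section \<open>Linear maps and generalized eigenspaces in finite dimension\<close>

locale fd_space = vector_space scale
  for scale :: "complex \<Rightarrow> 'g::ab_group_add \<Rightarrow> 'g" (infixr "*s" 75) +
  assumes finite_span: "\<exists>B. finite B \<and> span B = UNIV"
begin

definition Bas :: "'g set" where
  "Bas = (SOME B. finite B \<and> independent B \<and> span B = UNIV)"

lemma Bas_props: "finite Bas \<and> independent Bas \<and> span Bas = UNIV"
proof -
  obtain B where B: "finite B" "span B = UNIV" using finite_span by blast
  obtain B' where "B' \<subseteq> B" "independent B'" "B \<subseteq> span B'"
    using maximal_independent_subset by blast
  moreover have "span B' = UNIV"
    using B(2) \<open>B \<subseteq> span B'\<close> by (metis span_minimal subspace_span top.extremum_uniqueI)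
  ultimately have "finite B' \<and> independent B' \<and> span B' = UNIV"
    using B(1) finite_subset by blast
  then show ?thesis unfolding Bas_def by (rule someI)
qed

sublocale finite_dimensional_vector_space scale Bas
  by unfold_locales (use Bas_props in auto)

sublocale vector_space_pair scale scale
  by unfold_locales

sublocale self_pair: finite_dimensional_vector_space_pair scale Bas scale Bas
  by unfold_locales

definition lin :: "('g \<Rightarrow> 'g) \<Rightarrow> bool" where
  "lin F \<longleftrightarrow> (\<forall>x y. F (x + y) = F x + F y) \<and> (\<forall>c x. F (c *s x) = c *s F x)"

lemma lin_iff_linear: "lin F \<longleftrightarrow> Vector_Spaces.linear scale scale F"
  unfolding lin_def Vector_Spaces.linear_iff using vector_space_axioms by auto

lemma linI: "(\<And>x y. F (x + y) = F x + F y) \<Longrightarrow> (\<And>c x. F (c *s x) = c *s F x) \<Longrightarrow> lin F"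
  by (simp add: lin_def)

lemma lin_add: "lin F \<Longrightarrow> F (x + y) = F x + F y"
  and lin_scale: "lin F \<Longrightarrow> F (c *s x) = c *s F x"
  by (simp_all add: lin_def)

lemma lin_0: "lin F \<Longrightarrow> F 0 = 0"
  using lin_scale[of F 0 0] by simp

lemma lin_minus: "lin F \<Longrightarrow> F (- x) = - F x"
  using lin_scale[of F "-1" x] by simp

lemma lin_diff: "lin F \<Longrightarrow> F (x - y) = F x - F y"
  using lin_add[of F x "-y"] lin_minus[of F y] by simp

lemma lin_sum: "lin F \<Longrightarrow> F (\<Sum>i\<in>I. v i) = (\<Sum>i\<in>I. F (v i))"
  by (induction I rule: infinite_finite_induct) (auto simp: lin_0 lin_add)

lemma lin_comp: "lin F \<Longrightarrow> lin G \<Longrightarrow> lin (\<lambda>v. F (G v))"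
  by (simp add: lin_def)

lemma lin_o: "lin F \<Longrightarrow> lin G \<Longrightarrow> lin (F \<circ> G)"
  by (simp add: lin_def)

lemma lin_id: "lin (\<lambda>v. v)" "lin id"
  by (simp_all add: lin_def)

lemma lin_zero: "lin (\<lambda>v. 0)"
  by (simp_all add: lin_def)

lemma lin_plus: "lin F \<Longrightarrow> lin G \<Longrightarrow> lin (\<lambda>v. F v + G v)"
  by (simp add: lin_def algebra_simps)

lemma lin_scaled: "lin F \<Longrightarrow> lin (\<lambda>v. c *s F v)"
  by (simp add: lin_def algebra_simps)

lemma lin_minus_fun: "lin F \<Longrightarrow> lin G \<Longrightarrow> lin (\<lambda>v. F v - G v)"
  by (simp add: lin_def algebra_simps)

lemma lin_Sum: "(\<And>i. i \<in> I \<Longrightarrow> lin (F i)) \<Longrightarrow> lin (\<lambda>v. \<Sum>i\<in>I. F i v)"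
  by (induction I rule: infinite_finite_induct) (auto simp: lin_zero lin_plus)

lemma lin_funpow: "lin F \<Longrightarrow> lin (F ^^ k)"
  by (induction k) (auto simp: lin_id lin_o)

lemma subspace_image_lin: "lin F \<Longrightarrow> subspace V \<Longrightarrow> subspace (F ` V)"
  by (simp add: lin_iff_linear linear_subspace_image)

lemma subspace_kernel_lin: "lin F \<Longrightarrow> subspace {v. F v = 0}"
  by (auto simp: subspace_def lin_0 lin_add lin_scale)

definition shift :: "('g \<Rightarrow> 'g) \<Rightarrow> complex \<Rightarrow> 'g \<Rightarrow> 'g" where
  "shift F c = (\<lambda>v. F v - c *s v)"

text \<open>Generalized eigenspace of \<open>F\<close> for \<open>c\<close>. The exponent may depend
  on the vector; for linear \<open>F\<close> the space is \<open>{0}\<close> exactly when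
  \<open>c\<close> is not an eigenvalue.\<close>

definition gen :: "('g \<Rightarrow> 'g) \<Rightarrow> complex \<Rightarrow> 'g set" where
  "gen F c = {v. \<exists>k. (shift F c ^^ k) v = 0}"

lemma lin_shift: "lin F \<Longrightarrow> lin (shift F c)"
  unfolding shift_def by (intro lin_minus_fun lin_scaled lin_id)

lemma shift_zero: "shift F 0 = F"
  by (auto simp: shift_def)

lemma funpow_zero_mono:
  assumes "lin F" "(F ^^ k) v = 0" "k \<le> l" shows "(F ^^ l) v = 0"
proof -
  have "(F ^^ l) v = (F ^^ (l - k)) ((F ^^ k) v)"
    using assms(3) by (simp add: funpow_add[symmetric, THEN fun_cong, simplified])
  then show ?thesis using assms lin_funpow lin_0 by metis
qed

lemma subspace_gen: assumes "lin F" shows "subspace (gen F c)"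
proof -
  let ?S = "shift F c"
  have l: "lin (?S ^^ k)" for k using lin_funpow lin_shift assms by blast
  show ?thesis
  proof (rule subspaceI)
    show "0 \<in> gen F c" by (auto simp: gen_def intro!: exI[of _ 0])
    fix x y assume "x \<in> gen F c" "y \<in> gen F c"
    then obtain k m where "(?S ^^ k) x = 0" "(?S ^^ m) y = 0" by (auto simp: gen_def)
    then have "(?S ^^ max k m) x = 0" "(?S ^^ max k m) y = 0"
      using funpow_zero_mono lin_shift assms by (metis max.cobounded1, metis max.cobounded2)
    then show "x + y \<in> gen F c" unfolding gen_def mem_Collect_eq by (intro exI[of _ "max k m"]) (simp add: lin_add[OF l])
  next
    fix a x assume "x \<in> gen F c"
    then show "a *s x \<in> gen F c" by (auto simp: gen_def lin_scale[OF l])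
  qed
qed

lemma funpow_comm:
  assumes "\<And>v. F (G v) = G (F v)" shows "(F ^^ k) (G v) = G ((F ^^ k) v)"
  by (induction k) (auto simp: assms)

lemma gen_stable_comm:
  assumes "lin F" "lin G" "\<And>v. F (G v) = G (F v)" "v \<in> gen F c" shows "G v \<in> gen F c"
proof -
  obtain k where k: "(shift F c ^^ k) v = 0" using assms(4) by (auto simp: gen_def)
  have "shift F c (G v) = G (shift F c v)" for v
    by (simp add: shift_def assms lin_diff lin_scale)
  then have "(shift F c ^^ k) (G v) = G ((shift F c ^^ k) v)" by (rule funpow_comm)
  then have "(shift F c ^^ k) (G v) = 0" by (simp add: k lin_0[OF assms(2)])
  then show ?thesis by (auto simp: gen_def)
qed

lemma gen_self: "lin F \<Longrightarrow> v \<in> gen F c \<Longrightarrow> F v \<in> gen F c"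
  by (rule gen_stable_comm) auto

lemma gen_shift: "lin F \<Longrightarrow> v \<in> gen F c \<Longrightarrow> shift F d v \<in> gen F c"
  by (rule gen_stable_comm[of F "shift F d"]) (auto simp: lin_shift, auto simp: shift_def lin_diff lin_scale)

text \<open>On \<open>gen F c\<close> the map F - d is a nilpotent map plus the nonzero scalar c -
  d, hence invertible. Induction on the exponent that kills \<open>v\<close> builds the preimage
  inside \<open>V\<close>.\<close>

lemma gen_solve:
  assumes "lin F" "subspace V" "F ` V \<subseteq> V" "c \<noteq> d" "v \<in> gen F c" "v \<in> V"
  shows "\<exists>w\<in>gen F c \<inter> V. shift F d w = v"
proof -
  obtain k where "(shift F c ^^ k) v = 0" using assms(5) by (auto simp: gen_def)
  then show ?thesis using assms(5,6)
  proof (induction k arbitrary: v)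
    case 0
    then show ?case
      using assms subspace_0 subspace_gen lin_0[OF lin_shift] by (intro bexI[of _ 0]) auto
  next
    case (Suc k)
    let ?g = "shift F c v"
    have gV: "?g \<in> V" using Suc.prems assms by (auto simp: shift_def intro!: subspace_diff subspace_scale)
    have gg: "?g \<in> gen F c" using Suc.prems assms gen_shift by blast
    have "(shift F c ^^ k) ?g = 0" using Suc.prems by (simp add: funpow_swap1)
    then obtain w where w: "w \<in> gen F c \<inter> V" "shift F d w = ?g" using Suc.IH gg gV by blast
    let ?u = "(1 / (c - d)) *s (v - w)"
    have "shift F d v = ?g + (c - d) *s v" by (simp add: shift_def algebra_simps)
    then have "shift F d (v - w) = (c - d) *s v" using w(2) lin_diff[OF lin_shift[OF assms(1)]] by simp
    then have "shift F d ?u = v" using assms(4) by (simp add: lin_scale[OF lin_shift[OF assms(1)]])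
    moreover have "?u \<in> gen F c \<inter> V"
      using w(1) Suc.prems assms subspace_gen by (auto intro!: subspace_diff subspace_scale)
    ultimately show ?case by blast
  qed
qed

text \<open>A true eigenvector for \<open>d\<close> is multiplied by d - c under F - c, so no power
  of F - c kills it; the general case follows by induction on \<open>k\<close>.\<close>

lemma gen_inj:
  assumes "lin F" "c \<noteq> d" "v \<in> gen F c" "(shift F d ^^ k) v = 0" shows "v = 0"
proof -
  have *: "v = 0" if v: "v \<in> gen F c" "shift F d v = 0" for v
  proof -
    obtain k where k: "(shift F c ^^ k) v = 0" using v(1) unfolding gen_def by blast
    have sv: "shift F c v = (d - c) *s v" using v(2) by (simp add: shift_def algebra_simps)
    have "(shift F c ^^ k) v = (d - c) ^ k *s v"
      by (induction k) (auto simp: sv lin_scale[OF lin_shift[OF assms(1)]])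
    then show ?thesis using k assms(2) by simp
  qed
  show ?thesis using assms(3,4)
  proof (induction k arbitrary: v)
    case (Suc k)
    have "(shift F d ^^ k) (shift F d v) = 0" using Suc.prems by (simp add: funpow_swap1)
    then have "shift F d v = 0" using Suc.IH gen_shift Suc.prems assms(1) by blast
    then show ?case using * Suc.prems by blast
  qed auto
qed

lemma gen_shift_back: assumes "lin F" "shift F c v \<in> gen F c" shows "v \<in> gen F c"
proof -
  obtain k where "(shift F c ^^ k) (shift F c v) = 0" using assms(2) unfolding gen_def by blast
  then have "(shift F c ^^ Suc k) v = 0" by (simp only: funpow_Suc_right o_apply)
  then show ?thesis unfolding gen_def by blast
qed

subsection \<open>Decomposition into generalized eigenspaces\<close>

text \<open>This is p(F) v, computed by Horner's scheme.\<close>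

definition pev :: "complex poly \<Rightarrow> ('g \<Rightarrow> 'g) \<Rightarrow> 'g \<Rightarrow> 'g" where
  "pev p F v = fold_coeffs (\<lambda>a w. a *s v + F w) p 0"

lemma pev_0 [simp]: "pev 0 F v = 0"
  by (simp add: pev_def)

lemma pev_pCons: "lin F \<Longrightarrow> pev (pCons a p) F v = a *s v + F (pev p F v)"
  unfolding pev_def by (cases "p = 0 \<and> a = 0") (auto simp: lin_0)

lemma pev_smult: "lin F \<Longrightarrow> pev (smult c p) F v = c *s pev p F v"
  by (induction p) (auto simp: pev_pCons lin_scale scale_right_distrib)

lemma pev_add: "lin F \<Longrightarrow> pev (p + q) F v = pev p F v + pev q F v"
  by (induction p q rule: poly_induct2)
    (auto simp: pev_pCons lin_add scale_left_distrib algebra_simps)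

lemma pev_linear_factor:
  assumes "lin F" shows "pev ([:- c, 1:] * q) F v = shift F c (pev q F v)"
proof -
  have "[:- c, 1:] * q = smult (- c) q + pCons 0 q" by simp
  then show ?thesis
    by (simp only: pev_add[OF assms] pev_smult[OF assms] pev_pCons[OF assms]) (simp add: shift_def)
qed

lemma pev_in: "lin F \<Longrightarrow> subspace V \<Longrightarrow> F ` V \<subseteq> V \<Longrightarrow> v \<in> V \<Longrightarrow> pev p F v \<in> V"
  by (induction p) (auto simp: pev_pCons subspace_0 intro!: subspace_add subspace_scale)

text \<open>The iterates of \<open>v\<close> cannot be infinitely many independent vectors. If two
  coincide, a difference of two monomials annihilates \<open>v\<close>; otherwise a linear relation
  among finitely many iterates is read as a polynomial.\<close>

lemma exists_annihilating_poly:
  assumes F: "lin F" shows "\<exists>p. p \<noteq> 0 \<and> pev p F v = 0"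
proof (rule ccontr)
  assume neg: "\<not> ?thesis"
  let ?x = "\<lambda>i. (F ^^ i) v"
  have pm: "pev (\<Sum>i\<in>I. monom (u i) i) F v = (\<Sum>i\<in>I. u i *s ?x i)" if "finite I" for u :: "nat \<Rightarrow> complex" and I
  proof -
    have m: "pev (monom a i) F v = a *s ?x i" for a i
      by (induction i) (auto simp: monom_0 monom_Suc pev_pCons F lin_0 lin_scale)
    show ?thesis using that by induction (auto simp: pev_add F m)
  qed
  have inj: "inj ?x"
  proof (rule injI, rule ccontr)
    fix i j assume "?x i = ?x j" "i \<noteq> j"
    then have "pev (\<Sum>l\<in>{i,j}. monom ((if l = i then 1 else -1)) l) F v = 0" 
      using pm[of "{i,j}" "\<lambda>l. if l = i then 1 else -1"] \<open>i \<noteq> j\<close> \<open>?x i = ?x j\<close> by simp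
    moreover have "coeff (\<Sum>l\<in>{i,j}. monom ((if l = i then 1 else -1 :: complex)) l) i = 1"
      using \<open>i \<noteq> j\<close> by simp
    ultimately show False using neg by (metis coeff_0 zero_neq_one)
  qed
  have "independent (range ?x)"
    unfolding independent_explicit_finite_subsets
  proof (intro allI impI ballI)
    fix A u w assume A: "A \<subseteq> range ?x" "finite A" and s: "(\<Sum>w\<in>A. u w *s w) = 0" and w: "w \<in> A"
    obtain I where I: "A = ?x ` I" "finite I" using A finite_subset_image by (metis (no_types, lifting) subset_UNIV)
    have s': "(\<Sum>i\<in>I. u (?x i) *s ?x i) = 0"
      using s unfolding I(1) by (subst (asm) sum.reindex) (auto intro: inj_on_subset[OF inj])
    obtain i where i: "i \<in> I" "w = ?x i" using w I by auto
    let ?p = "\<Sum>i\<in>I. monom (u (?x i)) i"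
    have "pev ?p F v = 0" using pm[OF I(2), of "\<lambda>i. u (?x i)"] s' by simp
    then have "?p = 0" using neg by blast
    then have "coeff ?p i = 0" by simp
    then have "(\<Sum>j\<in>I. if j = i then u (?x j) else 0) = 0" by (simp add: coeff_sum)
    then show "u w = 0" using i I(2) by simp
  qed
  then have "finite (range ?x)" by (rule finiteI_independent)
  then show False using inj finite_imageD infinite_UNIV_nat by blast
qed

text \<open>The linear factors of a polynomial annihilating \<open>v\<close> are peeled off one at a
  time: by the inner fact \<open>step\<close>, a vector lies in the sum of the generalized
  eigenspaces as soon as its image under F - d does.\<close>

lemma gen_decomposition:
  assumes F: "lin F" and V: "subspace V" "F ` V \<subseteq> V"
  shows "V \<subseteq> span (\<Union>c. gen F c \<inter> V)"
proof
  let ?G = "span (\<Union>c. gen F c \<inter> V)"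
  have step: "v \<in> ?G" if v: "v \<in> V" "shift F d v \<in> ?G" for v d
  proof -
    \<comment> \<open>F - d maps the sum onto itself up to an error in \<open>gen F d\<close>, since
      \<open>gen_solve\<close> inverts it on every other generalized eigenspace.\<close>
    have key: "\<exists>w\<in>?G. w \<in> V \<and> y - shift F d w \<in> gen F d \<inter> V" if "y \<in> ?G" for y
      using that
    proof (induction rule: span_induct_alt)
      case base
      show ?case using F V subspace_gen[OF F] lin_0[OF lin_shift[OF F]]
        by (intro bexI[of _ 0]) (auto simp: subspace_0 span_zero)
    next
      case (step c x y)
      then obtain a w where x: "x \<in> gen F a" "x \<in> V" and
        w: "w \<in> ?G" "w \<in> V" "y - shift F d w \<in> gen F d \<inter> V" by auto
      have lin': "lin (shift F d)" using lin_shift F by blast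
      show ?case
      proof (cases "a = d")
        case True
        have "c *s x + (y - shift F d w) \<in> gen F d \<inter> V"
          using x w True V subspace_gen[OF F] by (auto intro!: subspace_add subspace_scale)
        then show ?thesis using w by (intro bexI[of _ w]) (auto simp: algebra_simps)
      next
        case False
        obtain u where u: "u \<in> gen F a \<inter> V" "shift F d u = x"
          using gen_solve[OF F V False x] by blast
        have "u \<in> ?G" using u by (auto intro!: span_base)
        moreover have "c *s x + y - shift F d (c *s u + w) = y - shift F d w"
          by (simp add: lin_add[OF lin'] lin_scale[OF lin'] u(2))
        moreover have "c *s u + w \<in> ?G" "c *s u + w \<in> V"
          using \<open>u \<in> ?G\<close> u w V by (auto intro!: span_add span_scale subspace_add subspace_scale)
        ultimately show ?thesis using w(3) by metis
      qed
    qed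
    obtain w where w: "w \<in> ?G" "w \<in> V" "shift F d v - shift F d w \<in> gen F d \<inter> V"
      using key[OF v(2)] by blast
    then have "shift F d (v - w) \<in> gen F d" using lin_diff[OF lin_shift[OF F]] by simp
    then obtain k where "(shift F d ^^ k) (shift F d (v - w)) = 0" by (auto simp: gen_def)
    then have "(shift F d ^^ Suc k) (v - w) = 0" by (simp add: funpow_swap1)
    then have "v - w \<in> gen F d \<inter> V" using v(1) w(2) V by (auto simp: gen_def intro: subspace_diff simp del: funpow.simps)
    then have "v - w \<in> ?G" by (auto intro: span_base)
    then show ?thesis using w(1) span_add[of "v - w" _ w] by simp
  qed
  fix v assume v: "v \<in> V"
  obtain p where p: "p \<noteq> 0" "pev p F v = 0" using exists_annihilating_poly[OF F] by blast
  have "v \<in> V \<Longrightarrow> pev p F v \<in> ?G \<Longrightarrow> v \<in> ?G" using p(1)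
  proof (induction "degree p" arbitrary: p v)
    case 0
    then obtain a where a: "p = [:a:]" "a \<noteq> 0" using degree_eq_zeroE by (metis pCons_eq_0_iff)
    then have "a *s v \<in> ?G" using 0 by (simp add: pev_pCons F lin_0)
    then have "(1 / a) *s (a *s v) \<in> ?G" by (rule span_scale)
    then show ?case using a by simp
  next
    case (Suc n)
    obtain c where "poly p c = 0" using alg_closed_imp_poly_has_root[of p] Suc.hyps(2) by auto
    then obtain q where q: "p = [:- c, 1:] * q" using poly_eq_0_iff_dvd dvd_def by metis
    then have "q \<noteq> 0" using Suc.prems by auto
    then have "n = degree q" using Suc.hyps(2) q by (simp add: degree_mult_eq del: mult_pCons_left)
    moreover have "pev q F v \<in> ?G"
    proof (rule step[of _ c])
      show "pev q F v \<in> V" using pev_in F V Suc.prems by blast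
      show "shift F c (pev q F v) \<in> ?G" using Suc.prems(2) pev_linear_factor[OF F] q by simp
    qed
    ultimately show ?case using Suc.hyps(1) Suc.prems \<open>q \<noteq> 0\<close> by blast
  qed
  then show "v \<in> ?G" using v p by (simp add: span_zero)
qed

subsection \<open>Joint generalized eigenspaces\<close>

definition jgen :: "'i set \<Rightarrow> ('i \<Rightarrow> 'g \<Rightarrow> 'g) \<Rightarrow> ('i \<Rightarrow> complex) \<Rightarrow> 'g set" where
  "jgen I X \<kappa> = {v. \<forall>i\<in>I. v \<in> gen (X i) (\<kappa> i)}"

text \<open>Weaker than commuting: each map has to preserve the generalized eigenspaces of the
  others. This is what holds for the maps \<open>br x\<close> with \<open>x\<close> in a nilpotent
  subalgebra.\<close>

definition compatible :: "'i set \<Rightarrow> ('i \<Rightarrow> 'g \<Rightarrow> 'g) \<Rightarrow> bool" where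
  "compatible I X \<longleftrightarrow> (\<forall>i\<in>I. lin (X i)) \<and> (\<forall>i\<in>I. \<forall>j\<in>I. \<forall>c. X j ` gen (X i) c \<subseteq> gen (X i) c)"

text \<open>Values outside \<open>I\<close> are pinned to 0, so that a weight is determined by its
  values on \<open>I\<close>; this matches the convention of \<open>dual_space\<close>.\<close>

definition supported :: "'i set \<Rightarrow> ('i \<Rightarrow> complex) set" where
  "supported I = {\<kappa>. \<forall>i. i \<notin> I \<longrightarrow> \<kappa> i = 0}"

lemma subspace_jgen: "compatible I X \<Longrightarrow> subspace (jgen I X \<kappa>)"
  using subspace_gen unfolding jgen_def compatible_def
  by (intro subspaceI) (auto simp: subspace_0 subspace_add subspace_scale)

text \<open>Induction on the dimension: if some map has no single generalized eigenvalue on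
  \<open>V\<close>, then \<open>V\<close> splits into smaller invariant pieces; otherwise the
  eigenvalues define one \<kappa> whose joint space contains \<open>V\<close>.\<close>

lemma joint_decomposition:
  assumes X: "compatible I X"
  shows "subspace V \<Longrightarrow> (\<And>i. i \<in> I \<Longrightarrow> X i ` V \<subseteq> V) \<Longrightarrow>
    V \<subseteq> span (\<Union>\<kappa>\<in>supported I. jgen I X \<kappa> \<inter> V)"
proof (induction "dim V" arbitrary: V rule: less_induct)
  case less
  have linX: "lin (X i)" if "i \<in> I" for i using X that by (auto simp: compatible_def)
  show ?case
  proof (cases "\<exists>i\<in>I. \<forall>c. \<not> V \<subseteq> gen (X i) c")
    case True
    then obtain i where i: "i \<in> I" "\<And>c. \<not> V \<subseteq> gen (X i) c" by blast
    have "gen (X i) c \<inter> V \<subseteq> span (\<Union>\<kappa>\<in>supported I. jgen I X \<kappa> \<inter> V)" for c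
    proof -
      let ?U = "gen (X i) c \<inter> V"
      have U: "subspace ?U" using subspace_gen linX i less.prems by (blast intro: subspace_inter)
      have "?U \<noteq> V" using i(2) by blast
      then have "dim ?U \<noteq> dim V" using subspace_dim_equal[OF U less.prems(1)] by auto
      then have "dim ?U < dim V" using dim_subset[of ?U V] by auto
      moreover have "X j ` ?U \<subseteq> ?U" if "j \<in> I" for j
        using X less.prems(2)[OF that] i that unfolding compatible_def by blast
      ultimately have "?U \<subseteq> span (\<Union>\<kappa>\<in>supported I. jgen I X \<kappa> \<inter> ?U)" using less.hyps U by blast
      also have "\<dots> \<subseteq> span (\<Union>\<kappa>\<in>supported I. jgen I X \<kappa> \<inter> V)" by (rule span_mono) blast
      finally show ?thesis .
    qed
    then have "span (\<Union>c. gen (X i) c \<inter> V) \<subseteq> span (\<Union>\<kappa>\<in>supported I. jgen I X \<kappa> \<inter> V)"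
      by (intro span_minimal) auto
    then show ?thesis using gen_decomposition[OF linX[OF i(1)] less.prems(1) less.prems(2)[OF i(1)]] by blast
  next
    case False
    define \<kappa> where "\<kappa> i = (if i \<in> I then SOME c. V \<subseteq> gen (X i) c else 0)" for i
    have "V \<subseteq> gen (X i) (\<kappa> i)" if "i \<in> I" for i
      using False that by (auto simp: \<kappa>_def intro!: someI_ex[of "\<lambda>c. V \<subseteq> gen (X i) c", THEN subsetD])
    then have "V \<subseteq> jgen I X \<kappa> \<inter> V" by (auto simp: jgen_def)
    moreover have "\<kappa> \<in> supported I" by (simp add: supported_def \<kappa>_def)
    ultimately have "V \<subseteq> (\<Union>\<kappa>\<in>supported I. jgen I X \<kappa> \<inter> V)" by auto
    then show ?thesis using span_superset by (rule subset_trans)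
  qed
qed

lemma jgen_shift:
  assumes "compatible I X" "j \<in> I" "v \<in> jgen I X \<kappa>" shows "(shift (X j) d ^^ k) v \<in> jgen I X \<kappa>"
proof (induction k)
  case (Suc k)
  let ?w = "(shift (X j) d ^^ k) v"
  have "X j ?w \<in> jgen I X \<kappa>" using Suc assms unfolding jgen_def compatible_def by blast
  then have "X j ?w - d *s ?w \<in> jgen I X \<kappa>"
    using Suc subspace_jgen[OF assms(1)] by (blast intro: subspace_diff subspace_scale)
  then show ?case by (simp add: shift_def)
qed (use assms in simp)

text \<open>Where two weights differ at \<open>i\<close>, a power of X i - \<kappa>0 i kills the
  term of \<kappa>0, and by \<open>gen_inj\<close> it annihilates no nonzero vector of the other
  joint space.\<close>

lemma jgen_independent:
  assumes X: "compatible I X" and "finite K"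
  shows "K \<subseteq> supported I \<Longrightarrow> (\<And>\<kappa>. \<kappa> \<in> K \<Longrightarrow> g \<kappa> \<in> jgen I X \<kappa>) \<Longrightarrow> (\<Sum>\<kappa>\<in>K. g \<kappa>) = 0 \<Longrightarrow>
    \<forall>\<kappa>\<in>K. g \<kappa> = 0"
  using assms(2)
proof (induction K arbitrary: g rule: finite_induct)
  case (insert \<kappa>0 K)
  have "g \<kappa>1 = 0" if \<kappa>1: "\<kappa>1 \<in> K" for \<kappa>1
  proof -
    have "\<kappa>1 \<noteq> \<kappa>0" using insert.hyps \<kappa>1 by auto
    then obtain i where i: "\<kappa>1 i \<noteq> \<kappa>0 i" by (auto simp: fun_eq_iff)
    have "\<kappa>1 \<in> supported I" "\<kappa>0 \<in> supported I" using insert.prems(1) \<kappa>1 by auto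
    then have "i \<in> I" using i by (cases "i \<in> I") (auto simp: supported_def)
    note i = i this
    have lX: "lin (X i)" using X i by (auto simp: compatible_def)
    have "g \<kappa>0 \<in> gen (X i) (\<kappa>0 i)" using insert.prems(2)[of \<kappa>0] i by (auto simp: jgen_def)
    then obtain k where k: "(shift (X i) (\<kappa>0 i) ^^ k) (g \<kappa>0) = 0" unfolding gen_def by blast
    let ?S = "shift (X i) (\<kappa>0 i) ^^ k"
    have lS: "lin ?S" using lX lin_shift lin_funpow by blast
    have "?S (\<Sum>\<kappa>\<in>insert \<kappa>0 K. g \<kappa>) = 0" using insert.prems(3) lin_0[OF lS] by simp
    then have "(\<Sum>\<kappa>\<in>K. ?S (g \<kappa>)) = 0"
      using insert.hyps k by (simp add: lin_add[OF lS] lin_sum[OF lS])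
    moreover have "?S (g \<kappa>) \<in> jgen I X \<kappa>" if "\<kappa> \<in> K" for \<kappa>
      using jgen_shift[OF X i(2)] insert.prems(2) that by blast
    ultimately have "?S (g \<kappa>1) = 0" using insert.IH[of "\<lambda>\<kappa>. ?S (g \<kappa>)"] insert.prems(1) \<kappa>1 by blast
    moreover have "g \<kappa>1 \<in> gen (X i) (\<kappa>1 i)" using insert.prems(2)[of \<kappa>1] i \<kappa>1 by (auto simp: jgen_def)
    ultimately show ?thesis using gen_inj[OF lX i(1)] by blast
  qed
  then show ?case using insert by simp
qed auto

definition weights :: "'i set \<Rightarrow> ('i \<Rightarrow> 'g \<Rightarrow> 'g) \<Rightarrow> ('i \<Rightarrow> complex) set" where
  "weights I X = {\<kappa> \<in> supported I. jgen I X \<kappa> \<noteq> {0}}"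

lemma finite_weights: assumes X: "compatible I X" shows "finite (weights I X)"
proof -
  have "\<forall>\<kappa>\<in>weights I X. \<exists>v. v \<in> jgen I X \<kappa> \<and> v \<noteq> 0"
    unfolding weights_def using subspace_0[OF subspace_jgen[OF X]] by fastforce
  then obtain v where v: "\<And>\<kappa>. \<kappa> \<in> weights I X \<Longrightarrow> v \<kappa> \<in> jgen I X \<kappa> \<and> v \<kappa> \<noteq> 0" by metis
  have ind: "\<forall>\<kappa>\<in>K. u \<kappa> = 0" if K: "finite K" "K \<subseteq> weights I X" "(\<Sum>\<kappa>\<in>K. u \<kappa> *s v \<kappa>) = 0" for K u
  proof -
    have "K \<subseteq> supported I" using K(2) by (auto simp: weights_def)
    moreover have "u \<kappa> *s v \<kappa> \<in> jgen I X \<kappa>" if "\<kappa> \<in> K" for \<kappa>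
      using v[of \<kappa>] that K(2) subspace_scale[OF subspace_jgen[OF X]] by blast
    ultimately have "\<forall>\<kappa>\<in>K. u \<kappa> *s v \<kappa> = 0"
      using jgen_independent[OF X K(1), of "\<lambda>\<kappa>. u \<kappa> *s v \<kappa>"] K(3) by blast
    then show ?thesis using v K(2) by auto
  qed
  have inj: "inj_on v (weights I X)"
  proof (rule inj_onI, rule ccontr)
    fix a b assume ab: "a \<in> weights I X" "b \<in> weights I X" "v a = v b" "a \<noteq> b"
    have "(\<Sum>\<kappa>\<in>{a,b}. (if \<kappa> = a then 1 else -1) *s v \<kappa>) = 0" using ab by simp
    then have "\<forall>\<kappa>\<in>{a,b}. (if \<kappa> = a then 1 else -1 :: complex) = 0"
      using ab(1,2) by (intro ind) auto
    then show False by simp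
  qed
  have "independent (v ` weights I X)"
    unfolding independent_explicit_finite_subsets
  proof (intro allI impI ballI)
    fix A u w assume A: "A \<subseteq> v ` weights I X" "finite A" "(\<Sum>w\<in>A. u w *s w) = 0" "w \<in> A"
    obtain K where K: "K \<subseteq> weights I X" "finite K" "A = v ` K"
      using finite_subset_image[OF A(2,1)] by blast
    have "(\<Sum>\<kappa>\<in>K. u (v \<kappa>) *s v \<kappa>) = 0"
      using A(3) unfolding K(3) by (subst (asm) sum.reindex) (use inj_on_subset[OF inj K(1)] in auto)
    then show "u w = 0" using ind[OF K(2,1), of "\<lambda>\<kappa>. u (v \<kappa>)"] A(4) K by auto
  qed
  then show ?thesis using finiteI_independent finite_imageD inj by blast
qed

subsection \<open>Direct sums and projections\<close>

definition dsum :: "'k set \<Rightarrow> ('k \<Rightarrow> 'g set) \<Rightarrow> bool" where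
  "dsum \<Lambda> W \<longleftrightarrow> finite \<Lambda> \<and> (\<forall>k\<in>\<Lambda>. subspace (W k)) \<and>
     (\<forall>v. \<exists>g. (\<forall>k\<in>\<Lambda>. g k \<in> W k) \<and> v = (\<Sum>k\<in>\<Lambda>. g k)) \<and>
     (\<forall>g. (\<forall>k\<in>\<Lambda>. g k \<in> W k) \<longrightarrow> (\<Sum>k\<in>\<Lambda>. g k) = 0 \<longrightarrow> (\<forall>k\<in>\<Lambda>. g k = 0))"

definition pr :: "'k set \<Rightarrow> ('k \<Rightarrow> 'g set) \<Rightarrow> 'k \<Rightarrow> 'g \<Rightarrow> 'g" where
  "pr \<Lambda> W k v = (SOME g. (\<forall>k\<in>\<Lambda>. g k \<in> W k) \<and> v = (\<Sum>k\<in>\<Lambda>. g k)) k"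

lemma span_Union_subspaces:
  assumes "finite \<Lambda>" "\<And>k. k \<in> \<Lambda> \<Longrightarrow> subspace (W k)" "v \<in> span (\<Union>k\<in>\<Lambda>. W k)"
  shows "\<exists>g. (\<forall>k\<in>\<Lambda>. g k \<in> W k) \<and> v = (\<Sum>k\<in>\<Lambda>. g k)"
  using assms(3)
proof (induction rule: span_induct_alt)
  case base
  show ?case using assms(2) by (intro exI[of _ "\<lambda>k. 0"]) (auto simp: subspace_0)
next
  case (step c x y)
  then obtain k g where k: "k \<in> \<Lambda>" "x \<in> W k" and g: "\<forall>k\<in>\<Lambda>. g k \<in> W k" "y = (\<Sum>k\<in>\<Lambda>. g k)" by blast
  have "(\<Sum>l\<in>\<Lambda>. (if l = k then c *s x else 0) + g l) = c *s x + y"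
    using k assms(1) g by (simp add: sum.distrib)
  moreover have "(if l = k then c *s x else 0) + g l \<in> W l" if "l \<in> \<Lambda>" for l
    using k g that assms(2) by (auto intro!: subspace_add subspace_scale simp: subspace_0)
  ultimately show ?case by (intro exI[of _ "\<lambda>l. (if l = k then c *s x else 0) + g l"]) auto
qed

lemma dsum_weights: assumes X: "compatible I X" shows "dsum (weights I X) (jgen I X)"
  unfolding dsum_def
proof (intro conjI allI impI)
  fix v :: 'g
  have "UNIV \<subseteq> span (\<Union>\<kappa>\<in>supported I. jgen I X \<kappa> \<inter> UNIV)"
    by (rule joint_decomposition[OF X]) auto
  also have "\<dots> \<subseteq> span (\<Union>\<kappa>\<in>weights I X. jgen I X \<kappa>)"
  proof (rule span_minimal)
    have "jgen I X \<kappa> \<subseteq> span (\<Union>\<kappa>\<in>weights I X. jgen I X \<kappa>)" if "\<kappa> \<in> supported I" for \<kappa>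
    proof (cases "jgen I X \<kappa> = {0}")
      case False
      then have "\<kappa> \<in> weights I X" using that by (simp add: weights_def)
      then show ?thesis using span_superset by blast
    qed (simp add: span_zero)
    then show "(\<Union>\<kappa>\<in>supported I. jgen I X \<kappa> \<inter> UNIV) \<subseteq> span (\<Union>\<kappa>\<in>weights I X. jgen I X \<kappa>)" by auto
  qed auto
  finally show "\<exists>g. (\<forall>k\<in>weights I X. g k \<in> jgen I X k) \<and> v = (\<Sum>k\<in>weights I X. g k)"
    using span_Union_subspaces[OF finite_weights[OF X], of "jgen I X" v] subspace_jgen[OF X] by blast
next
  fix g assume "\<forall>k\<in>weights I X. g k \<in> jgen I X k" "(\<Sum>k\<in>weights I X. g k) = 0"
  then show "\<forall>k\<in>weights I X. g k = 0"
    using jgen_independent[OF X finite_weights[OF X]] by (auto simp: weights_def)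
qed (use finite_weights subspace_jgen X in auto)

lemma jgen_notin_weights: "compatible I X \<Longrightarrow> \<kappa> \<in> supported I \<Longrightarrow> \<kappa> \<notin> weights I X \<Longrightarrow> jgen I X \<kappa> = {0}"
  by (simp add: weights_def)

context
  fixes \<Lambda> :: "'k set" and W
  assumes ds: "dsum \<Lambda> W"
begin

lemma pr_props: "(\<forall>k\<in>\<Lambda>. pr \<Lambda> W k v \<in> W k) \<and> v = (\<Sum>k\<in>\<Lambda>. pr \<Lambda> W k v)"
proof -
  have "\<exists>g. (\<forall>k\<in>\<Lambda>. g k \<in> W k) \<and> v = (\<Sum>k\<in>\<Lambda>. g k)" using ds unfolding dsum_def by blast
  from someI_ex[OF this] show ?thesis unfolding pr_def .
qed

lemma pr_in: "k \<in> \<Lambda> \<Longrightarrow> pr \<Lambda> W k v \<in> W k"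
  using pr_props by blast

lemma pr_sum: "(\<Sum>k\<in>\<Lambda>. pr \<Lambda> W k v) = v"
  using pr_props by metis

lemma pr_unique:
  assumes "\<And>k. k \<in> \<Lambda> \<Longrightarrow> g k \<in> W k" "v = (\<Sum>k\<in>\<Lambda>. g k)" "k \<in> \<Lambda>" shows "pr \<Lambda> W k v = g k"
proof -
  have a: "(\<Sum>k\<in>\<Lambda>. pr \<Lambda> W k v - g k) = 0" by (simp add: sum_subtractf pr_sum flip: assms(2))
  have b: "\<forall>k\<in>\<Lambda>. pr \<Lambda> W k v - g k \<in> W k"
    using pr_in assms(1) ds unfolding dsum_def by (meson subspace_diff)
  have all: "\<forall>g. (\<forall>k\<in>\<Lambda>. g k \<in> W k) \<longrightarrow> (\<Sum>k\<in>\<Lambda>. g k) = 0 \<longrightarrow> (\<forall>k\<in>\<Lambda>. g k = 0)"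
    using ds unfolding dsum_def by (elim conjE)
  have "\<forall>k\<in>\<Lambda>. pr \<Lambda> W k v - g k = 0"
    by (rule all[THEN spec, THEN mp, THEN mp, OF b a])
  then show ?thesis using assms(3) by simp
qed

lemma lin_pr: assumes "k \<in> \<Lambda>" shows "lin (pr \<Lambda> W k)"
proof (rule linI)
  have sub: "subspace (W l)" if "l \<in> \<Lambda>" for l using ds that by (simp add: dsum_def)
  fix x y
  show "pr \<Lambda> W k (x + y) = pr \<Lambda> W k x + pr \<Lambda> W k y"
    by (rule pr_unique[OF _ _ assms, of "\<lambda>k. pr \<Lambda> W k x + pr \<Lambda> W k y"])
      (auto simp: sum.distrib pr_sum intro!: subspace_add sub pr_in)
  fix c
  show "pr \<Lambda> W k (c *s x) = c *s pr \<Lambda> W k x"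
    by (rule pr_unique[OF _ _ assms, of "\<lambda>k. c *s pr \<Lambda> W k x"])
      (auto simp: pr_sum intro!: subspace_scale sub pr_in simp flip: scale_sum_right)
qed

lemma pr_mem: assumes "v \<in> W l" "l \<in> \<Lambda>" "k \<in> \<Lambda>" shows "pr \<Lambda> W k v = (if k = l then v else 0)"
proof (rule pr_unique[OF _ _ assms(3), of "\<lambda>k. if k = l then v else 0"])
  show "v = (\<Sum>k\<in>\<Lambda>. if k = l then v else 0)" using assms ds by (simp add: dsum_def)
qed (use assms ds in \<open>auto simp: dsum_def subspace_0\<close>)

lemma pr_idem: "k \<in> \<Lambda> \<Longrightarrow> pr \<Lambda> W k (pr \<Lambda> W k v) = pr \<Lambda> W k v"
  using pr_mem[OF pr_in] by simp

lemma pr_commute: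
  assumes F: "lin F" "\<And>l. l \<in> \<Lambda> \<Longrightarrow> F ` W l \<subseteq> W l" and k: "k \<in> \<Lambda>"
  shows "pr \<Lambda> W k (F v) = F (pr \<Lambda> W k v)"
proof (rule pr_unique[OF _ _ k, of "\<lambda>k. F (pr \<Lambda> W k v)"])
  show "F v = (\<Sum>k\<in>\<Lambda>. F (pr \<Lambda> W k v))" by (simp add: pr_sum flip: lin_sum[OF F(1)])
qed (use F pr_in in blast)

lemma dsum_induct:
  assumes "lin F" "lin G" "\<And>k v. k \<in> \<Lambda> \<Longrightarrow> v \<in> W k \<Longrightarrow> F v = G v" shows "F v = G v"
proof -
  have "F v = (\<Sum>k\<in>\<Lambda>. F (pr \<Lambda> W k v))" by (simp add: pr_sum flip: lin_sum[OF assms(1)])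
  also have "\<dots> = (\<Sum>k\<in>\<Lambda>. G (pr \<Lambda> W k v))" using assms(3) pr_in by (intro sum.cong) auto
  also have "\<dots> = G v" by (simp add: pr_sum flip: lin_sum[OF assms(2)])
  finally show ?thesis .
qed

end

subsection \<open>The trace\<close>

definition co :: "'g \<Rightarrow> 'g \<Rightarrow> complex" where
  "co b v = representation Bas v b"

definition tr :: "('g \<Rightarrow> 'g) \<Rightarrow> complex" where
  "tr F = (\<Sum>b\<in>Bas. co b (F b))"

lemma co_add: "co b (v + w) = co b v + co b w"
  unfolding co_def using representation_add[of Bas w v] independent_Basis span_Basis by simp

lemma co_scale: "co b (c *s v) = c * co b v"
  unfolding co_def using representation_scale[of Bas v c] independent_Basis span_Basis by simp

lemma co_0: "co b 0 = 0"
  using co_scale[of b 0 0] by simp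

lemma co_minus: "co b (- v) = - co b v"
  using co_scale[of b "-1" v] by simp

lemma co_diff: "co b (v - w) = co b v - co b w"
  using co_add[of b v "-w"] co_minus by simp

lemma co_sum: "co b (\<Sum>i\<in>I. v i) = (\<Sum>i\<in>I. co b (v i))"
  by (induction I rule: infinite_finite_induct) (auto simp: co_0 co_add)

lemma co_expand: "(\<Sum>b\<in>Bas. co b v *s b) = v"
  unfolding co_def using sum_representation_eq[of Bas v Bas] independent_Basis span_Basis finite_Basis by simp

lemma co_eq_0: "(\<And>b. b \<in> Bas \<Longrightarrow> co b v = 0) \<Longrightarrow> v = 0"
  using co_expand[of v] by (metis (no_types, lifting) scale_zero_left sum.neutral)

lemma lin_expand: "lin F \<Longrightarrow> F v = (\<Sum>b\<in>Bas. co b v *s F b)"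
  by (subst co_expand[of v, symmetric]) (simp add: lin_sum lin_scale)

lemma tr_add: "tr (\<lambda>v. F v + G v) = tr F + tr G"
  by (simp add: tr_def co_add sum.distrib)

lemma tr_scale: "tr (\<lambda>v. c *s F v) = c * tr F"
  by (simp add: tr_def co_scale sum_distrib_left)

lemma tr_diff: "tr (\<lambda>v. F v - G v) = tr F - tr G"
  by (simp add: tr_def co_diff sum_subtractf)

lemma tr_zero: "tr (\<lambda>v. 0) = 0"
  by (simp add: tr_def co_0)

lemma tr_Sum: "tr (\<lambda>v. \<Sum>i\<in>I. F i v) = (\<Sum>i\<in>I. tr (F i))"
  unfolding tr_def co_sum by (rule sum.swap)

lemma tr_cyc: assumes "lin F" "lin G" shows "tr (\<lambda>v. F (G v)) = tr (\<lambda>v. G (F v))"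
proof -
  have *: "tr (\<lambda>v. F (G v)) = (\<Sum>b\<in>Bas. \<Sum>b'\<in>Bas. co b' (G b) * co b (F b'))" if "lin F" for F G
    unfolding tr_def by (subst lin_expand[OF that]) (simp add: co_sum co_scale)
  show ?thesis unfolding *[OF assms(1)] *[OF assms(2)] by (subst sum.swap) (simp add: mult.commute)
qed

lemma tr_rank1:
  assumes "\<And>x y. f (x + y) = f x + f y" "\<And>c x. f (c *s x) = c * f x"
  shows "tr (\<lambda>v. f v *s w) = f w"
proof -
  have f0: "f 0 = 0" using assms(2)[of 0 0] by simp
  have fs: "f (\<Sum>i\<in>I. v i) = (\<Sum>i\<in>I. f (v i))" for I and v :: "'g \<Rightarrow> 'g"
    by (induction I rule: infinite_finite_induct) (auto simp: f0 assms)
  have "tr (\<lambda>v. f v *s w) = (\<Sum>b\<in>Bas. f (co b w *s b))"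
    by (simp add: tr_def co_scale assms(2) mult.commute)
  also have "\<dots> = f w" by (simp add: co_expand flip: fs)
  finally show ?thesis .
qed

lemma tr_projection:
  assumes "lin P" "\<And>v. P v \<in> W" "\<And>v. v \<in> W \<Longrightarrow> P v = v" "subspace W"
  shows "tr P = of_nat (dim W)"
proof -
  obtain B where B: "B \<subseteq> W" "independent B" "W \<subseteq> span B" "card B = dim W" using basis_exists by blast
  have fB: "finite B" by (rule finiteI_independent[OF B(2)])
  have sB: "span B = W" using B assms(4) by (simp add: span_minimal subset_antisym)
  define f where "f b v = representation B (P v) b" for b v
  have in_span: "P v \<in> span B" for v using assms(2) sB by simp
  have f_add: "f b (x + y) = f b x + f b y" for b x y
    unfolding f_def lin_add[OF assms(1)] using representation_add[OF B(2) in_span in_span] by simp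
  have f_scale: "f b (c *s x) = c * f b x" for b c x
    unfolding f_def lin_scale[OF assms(1)] using representation_scale[OF B(2) in_span] by simp
  have "P = (\<lambda>v. \<Sum>b\<in>B. f b v *s b)"
    unfolding f_def using sum_representation_eq[OF B(2) in_span fB order_refl] by simp
  then have "tr P = tr (\<lambda>v. \<Sum>b\<in>B. f b v *s b)" by (rule arg_cong)
  also have "\<dots> = (\<Sum>b\<in>B. tr (\<lambda>v. f b v *s b))" by (rule tr_Sum)
  also have "\<dots> = (\<Sum>b\<in>B. f b b)" using tr_rank1 f_add f_scale by simp
  also have "\<dots> = (\<Sum>b\<in>B. 1)"
  proof (rule sum.cong)
    fix b assume "b \<in> B"
    then have "P b = b" using B assms(3) by blast
    then show "f b b = 1" unfolding f_def using representation_basis[OF B(2) \<open>b \<in> B\<close>] by simp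
  qed simp
  finally show ?thesis using B by simp
qed

lemma exists_projection:
  assumes "subspace W" shows "\<exists>P. lin P \<and> (\<forall>v. P v \<in> W) \<and> (\<forall>v\<in>W. P v = v)"
proof -
  have "Vector_Spaces.linear scale scale id" using lin_id lin_iff_linear by blast
  from linear_exists_left_inverse_on[OF this assms] show ?thesis
    unfolding lin_iff_linear by auto
qed

text \<open>Cyclicity of the trace, applied with projections onto the ranges, shows that
  \<open>F\<close> has the same trace as its restriction to the range of any of its powers. For a
  power that is 0 this range is trivial.\<close>

lemma tr_nilpotent:
  assumes F: "lin F" and N: "\<And>v. (F ^^ N) v = 0" shows "tr F = 0"
proof -
  have "\<exists>P. lin P \<and> (\<forall>v. P v \<in> range (F ^^ k)) \<and> (\<forall>v\<in>range (F ^^ k). P v = v) \<and> tr F = tr (\<lambda>v. F (P v))" for k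
  proof (induction k)
    case 0
    then show ?case using lin_id by (intro exI[of _ id]) auto
  next
    case (Suc k)
    then obtain P where P: "lin P" "\<And>v. P v \<in> range (F ^^ k)" "\<And>v. v \<in> range (F ^^ k) \<Longrightarrow> P v = v"
      "tr F = tr (\<lambda>v. F (P v))" by blast
    have "subspace (range (F ^^ Suc k))" by (rule subspace_image_lin[OF lin_funpow[OF F] subspace_UNIV])
    then obtain Q where Q: "lin Q" "\<And>v. Q v \<in> range (F ^^ Suc k)" "\<And>v. v \<in> range (F ^^ Suc k) \<Longrightarrow> Q v = v"
      using exists_projection by blast
    have sub: "range (F ^^ Suc k) \<subseteq> range (F ^^ k)"
    proof
      fix v assume "v \<in> range (F ^^ Suc k)"
      then obtain u where "v = (F ^^ k) (F u)" by (auto simp: funpow_swap1)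
      then show "v \<in> range (F ^^ k)" by blast
    qed
    have "F (P v) \<in> range (F ^^ Suc k)" for v using P(2)[of v] by auto
    then have "tr F = tr (\<lambda>v. Q (F (P v)))" using P(4) Q(3) by simp
    also have "\<dots> = tr (\<lambda>v. F (P (Q v)))" using tr_cyc[OF Q(1) lin_comp[OF F P(1)]] by simp
    also have "\<dots> = tr (\<lambda>v. F (Q v))"
    proof -
      have "P (Q v) = Q v" for v using P(3) Q(2) sub by blast
      then show ?thesis by simp
    qed
    finally have "tr F = tr (\<lambda>v. F (Q v))" .
    then show ?case using Q by blast
  qed
  from this[of N] obtain P where P: "\<And>v. P v \<in> range (F ^^ N)" "tr F = tr (\<lambda>v. F (P v))" by blast
  have "P v = 0" for v using P(1)[of v] N by auto
  then show ?thesis using P(2) lin_0[OF F] tr_zero by simp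
qed

lemma funpow_stable: "F ` U \<subseteq> U \<Longrightarrow> v \<in> U \<Longrightarrow> (F ^^ k) v \<in> U"
  by (induction k) auto

lemma funpow_mod_mono:
  assumes "F ` U \<subseteq> U" "(F ^^ k) v \<in> U" "k \<le> l" shows "(F ^^ l) v \<in> U"
proof -
  have "(F ^^ l) v = (F ^^ (l - k)) ((F ^^ k) v)"
    using assms(3) by (simp add: funpow_add[symmetric, THEN fun_cong, simplified])
  then show ?thesis using funpow_stable[OF assms(1,2)] by simp
qed

lemma subspace_preimage: "lin F \<Longrightarrow> subspace U \<Longrightarrow> subspace {v. F v \<in> U}"
  unfolding subspace_def by (auto simp: lin_0 lin_add lin_scale)

lemma uniform_nilpotent_mod:
  assumes "lin Y" "subspace V" "subspace U" "Y ` U \<subseteq> U" "\<And>v. v \<in> V \<Longrightarrow> \<exists>k. (Y ^^ k) v \<in> U"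
  shows "\<exists>N. \<forall>v\<in>V. (Y ^^ N) v \<in> U"
proof -
  obtain B where B: "B \<subseteq> V" "independent B" "V \<subseteq> span B" by (rule basis_exists[of V])
  have fB: "finite B" by (rule finiteI_independent[OF B(2)])
  obtain k where k: "\<And>v. v \<in> V \<Longrightarrow> (Y ^^ k v) v \<in> U" using assms(5) by metis
  let ?N = "Max (k ` B)"
  have "(Y ^^ ?N) v \<in> U" if "v \<in> B" for v
  proof (rule funpow_mod_mono[OF assms(4)])
    show "(Y ^^ k v) v \<in> U" using k B(1) that by blast
    show "k v \<le> ?N" using fB that by simp
  qed
  then have "B \<subseteq> {v. (Y ^^ ?N) v \<in> U}" by blast
  then have "span B \<subseteq> {v. (Y ^^ ?N) v \<in> U}"
    by (rule span_minimal[OF _ subspace_preimage[OF lin_funpow[OF assms(1)] assms(3)]])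
  then show ?thesis using B by blast
qed

lemma uniform_nilpotent:
  assumes "lin Y" "subspace W" "\<And>v. v \<in> W \<Longrightarrow> \<exists>k. (Y ^^ k) v = 0"
  shows "\<exists>N. \<forall>v\<in>W. (Y ^^ N) v = 0"
  using uniform_nilpotent_mod[of Y W "{0}"] assms subspace_single_0 lin_0 by auto

text \<open>If \<open>Y\<close> is nilpotent on the range of a projection that commutes with the commuting maps
  \<open>X\<close>, \<open>Y\<close>, then \<open>X Y\<close> is nilpotent there as well.\<close>

lemma tr_commuting_nilpotent:
  assumes "lin X" "lin Y" "lin P" "\<And>v. X (Y v) = Y (X v)"
    "\<And>v. P (X v) = X (P v)" "\<And>v. P (Y v) = Y (P v)" "\<And>v. P (P v) = P v"
    "\<And>v. \<exists>k. (Y ^^ k) (P v) = 0"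
  shows "tr (\<lambda>v. X (Y (P v))) = 0"
proof -
  have "subspace (range P)" by (rule subspace_image_lin[OF assms(3) subspace_UNIV])
  then have "\<exists>N. \<forall>v\<in>range P. (Y ^^ N) v = 0"
    using assms(8) by (intro uniform_nilpotent[OF assms(2)]) auto
  then obtain N where N: "\<And>v. (Y ^^ N) (P v) = 0" by auto
  have "((\<lambda>v. X (Y (P v))) ^^ k) (P v) = (X ^^ k) ((Y ^^ k) (P v))" for k v
  proof (induction k)
    case (Suc k)
    have c1: "Y ((X ^^ k) u) = (X ^^ k) (Y u)" for u
      by (rule funpow_comm[of X Y, OF assms(4), symmetric])
    have c2: "P ((X ^^ k) u) = (X ^^ k) (P u)" for u
      by (rule funpow_comm[of X P, OF assms(5)[symmetric], symmetric])
    have c3: "P ((Y ^^ k) u) = (Y ^^ k) (P u)" for u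
      by (rule funpow_comm[of Y P, OF assms(6)[symmetric], symmetric])
    show ?case by (simp add: Suc c1 c2 c3 assms(7))
  qed simp
  then have "((\<lambda>v. X (Y (P v))) ^^ N) (P v) = 0" for v
    using N lin_0[OF lin_funpow[OF assms(1)]] by simp
  from this[of "X (Y (P v))" for v] have "((\<lambda>v. X (Y (P v))) ^^ N) (X (Y (P v))) = 0" for v
    by (simp add: assms(5,6,7))
  then have "((\<lambda>v. X (Y (P v))) ^^ Suc N) v = 0" for v
    by (simp only: funpow_Suc_right o_apply)
  then show ?thesis
    by (rule tr_nilpotent[OF lin_comp[OF assms(1) lin_comp[OF assms(2,3)]]])
qed

lemma tr_single_eigenvalue:
  assumes "lin X" "lin P" "\<And>v. P (X v) = X (P v)" "\<And>v. P (P v) = P v" "\<And>v. P v \<in> gen X c"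
  shows "tr (\<lambda>v. X (P v)) = c * tr P"
proof -
  have "tr (\<lambda>v. id (shift X c (P v))) = 0"
  proof (rule tr_commuting_nilpotent[of id "shift X c" P])
    show "P (shift X c v) = shift X c (P v)" for v
      by (simp add: shift_def assms lin_diff[OF assms(2)] lin_scale[OF assms(2)])
    show "\<exists>k. (shift X c ^^ k) (P v) = 0" for v using assms(5)[of v] unfolding gen_def by blast
  qed (use assms lin_id lin_shift in auto)
  moreover have "tr (\<lambda>v. X (P v)) = tr (\<lambda>v. shift X c (P v)) + tr (\<lambda>v. c *s P v)"
    by (simp add: tr_add[symmetric] shift_def)
  ultimately show ?thesis by (simp add: tr_scale)
qed

lemma tr_dsum:
  assumes "dsum \<Lambda> W" "lin F" shows "tr F = (\<Sum>k\<in>\<Lambda>. tr (\<lambda>v. F (pr \<Lambda> W k v)))"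
proof -
  have "F = (\<lambda>v. \<Sum>k\<in>\<Lambda>. F (pr \<Lambda> W k v))" by (simp add: pr_sum[OF assms(1)] flip: lin_sum[OF assms(2)])
  then show ?thesis using tr_Sum[of "\<lambda>k v. F (pr \<Lambda> W k v)" \<Lambda>] by simp
qed

lemma tr_off_diagonal:
  assumes ds: "dsum \<Lambda> W" and F: "lin F" and "\<And>k v. k \<in> \<Lambda> \<Longrightarrow> v \<in> W k \<Longrightarrow> pr \<Lambda> W k (F v) = 0"
  shows "tr F = 0"
proof -
  have "tr (\<lambda>v. F (pr \<Lambda> W k v)) = 0" if k: "k \<in> \<Lambda>" for k
  proof -
    let ?P = "pr \<Lambda> W k"
    have "tr (\<lambda>v. F (?P v)) = tr (\<lambda>v. F (?P (?P v)))" using pr_idem[OF ds k] by simp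
    also have "\<dots> = tr (\<lambda>v. ?P (F (?P v)))"
      by (rule tr_cyc[of "\<lambda>v. F (?P v)" ?P, OF lin_comp[OF F lin_pr[OF ds k]] lin_pr[OF ds k]])
    also have "\<dots> = 0" using assms(3)[OF k] pr_in[OF ds k] tr_zero by simp
    finally show ?thesis .
  qed
  then show ?thesis using tr_dsum[OF ds F] by simp
qed

lemma tr_pr: "dsum \<Lambda> W \<Longrightarrow> k \<in> \<Lambda> \<Longrightarrow> tr (pr \<Lambda> W k) = of_nat (dim (W k))"
  by (rule tr_projection) (auto simp: lin_pr pr_in pr_mem dsum_def)

lemma dim_pos: "subspace W \<Longrightarrow> W \<noteq> {0} \<Longrightarrow> dim W > 0"
  using subspace_0[of W] by (cases "dim W") auto

text \<open>Take the iterate just before the first one that falls into \<open>U\<close>.\<close>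

lemma nilpotent_kernel_mod:
  assumes "W \<noteq> U" "U \<subseteq> W" "Y ` W \<subseteq> W" "\<And>v. v \<in> W \<Longrightarrow> \<exists>k. (Y ^^ k) v \<in> U"
  shows "\<exists>v\<in>W. v \<notin> U \<and> Y v \<in> U"
proof -
  obtain w where w: "w \<in> W" "w \<notin> U" using assms(1,2) by blast
  define k where "k = (LEAST k. (Y ^^ k) w \<in> U)"
  have k: "(Y ^^ k) w \<in> U" unfolding k_def using assms(4)[OF w(1)] by (rule LeastI_ex)
  then have "k \<noteq> 0" using w by (metis funpow_0)
  then obtain l where l: "k = Suc l" using not0_implies_Suc by blast
  then have "(Y ^^ l) w \<notin> U" unfolding k_def using not_less_Least[of l] by (metis lessI)
  moreover have "Y ((Y ^^ l) w) \<in> U" using k l by simp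
  moreover have "(Y ^^ l) w \<in> W" by (rule funpow_stable[OF assms(3) w(1)])
  ultimately show ?thesis by blast
qed

end

section \<open>Brackets and derivations\<close>

locale fd_lie = lie_algebra scale br + fd_space scale
  for scale :: "complex \<Rightarrow> 'g::ab_group_add \<Rightarrow> 'g" (infixr "*s" 75)
    and br :: "'g \<Rightarrow> 'g \<Rightarrow> 'g"
begin

lemma lin_br: "lin (br x)"
  by (rule linI) (simp_all add: br_add_right br_scale_right)

lemma lin_br_left: "lin (\<lambda>x. br x y)"
  by (rule linI) (simp_all add: br_add_left br_scale_left)

lemma br_zero [simp]: "br x 0 = 0" "br 0 x = 0"
  using lin_0[OF lin_br] lin_0[OF lin_br_left] by auto

lemma br_anti: "br x y = - br y x"
proof -
  have "br (x + y) (x + y) = 0" by (rule br_self)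
  then have "br x y + br y x = 0" 
    unfolding br_add_left br_add_right by (simp add: br_self[of x] br_self[of y] add.commute)
  then show ?thesis by (simp add: eq_neg_iff_add_eq_0)
qed

lemma br_leibniz: "br x (br y z) = br (br x y) z + br y (br x z)"
  using jacobi[of x y z] br_anti[of z "br x y"] br_anti[of z x] lin_minus[OF lin_br, of y "br x z"]
  by (simp add: algebra_simps)

lemma br_br: "br (br x y) z = br x (br y z) - br y (br x z)"
  using br_leibniz[of x y z] by simp

lemma br_minus_right: "br x (- y) = - br x y"
  by (rule lin_minus[OF lin_br])

lemma br_diff_left: "br (x - y) z = br x z - br y z"
  by (rule lin_diff[OF lin_br_left])

lemma br_diff_right: "br x (y - z) = br x y - br x z"
  by (rule lin_diff[OF lin_br])

text \<open>The identity (D - a - b) [x, y] = [(D - a) x, y] + [x, (D - b) y] lowers the sum of the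
  two nilpotency exponents.\<close>

lemma gen_br:
  assumes D: "lin D" "\<And>x y. D (br x y) = br (D x) y + br x (D y)"
    and x: "x \<in> gen D a" and y: "y \<in> gen D b"
  shows "br x y \<in> gen D (a + b)"
proof -
  have "br x y \<in> gen D (a + b)" if "(shift D a ^^ k) x = 0" "(shift D b ^^ l) y = 0" for k l x y
    using that
  proof (induction "k + l" arbitrary: k l x y)
    case 0
    then show ?case using subspace_0[OF subspace_gen[OF D(1)]] by simp
  next
    case (Suc m)
    show ?case
    proof (cases "k = 0 \<or> l = 0")
      case True
      then have "br x y = 0" using Suc.prems by auto
      then show ?thesis using subspace_0[OF subspace_gen[OF D(1)]] by simp
    next
      case False
      then obtain k' l' where kl: "k = Suc k'" "l = Suc l'" using not0_implies_Suc by blast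
      have 1: "br (shift D a x) y \<in> gen D (a + b)"
        by (rule Suc.hyps(1)[of k' l]) (use Suc kl in \<open>simp_all add: funpow_swap1\<close>)
      have 2: "br x (shift D b y) \<in> gen D (a + b)"
        by (rule Suc.hyps(1)[of k l']) (use Suc kl in \<open>simp_all add: funpow_swap1\<close>)
      have "shift D (a + b) (br x y) = br (shift D a x) y + br x (shift D b y)"
        by (simp add: shift_def D(2) br_diff_left br_diff_right br_scale_left br_scale_right algebra_simps)
      then have "shift D (a + b) (br x y) \<in> gen D (a + b)"
        using subspace_add[OF subspace_gen[OF D(1)] 1 2] by simp
      then show ?thesis by (rule gen_shift_back[OF D(1)])
    qed
  qed
  then show ?thesis using x y unfolding gen_def by blast
qed

lemma gen_ad_br:
  "x \<in> gen (br t) a \<Longrightarrow> y \<in> gen (br t) b \<Longrightarrow> br x y \<in> gen (br t) (a + b)"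
  by (rule gen_br[OF lin_br]) (rule br_leibniz)

subsection \<open>Engel's theorem\<close>

definition closed_set :: "'g set \<Rightarrow> bool" where
  "closed_set X \<longleftrightarrow> 0 \<in> X \<and> (\<forall>x\<in>X. \<forall>y\<in>X. br x y \<in> X)"

text \<open>A representation on V/U by nilpotent maps, written on \<open>V\<close> without forming
  the quotient. Linearity of \<rho> is asked on the span because the acting set \<open>X\<close> is
  only closed under brackets.\<close>

definition nil_rep :: "'g set \<Rightarrow> ('g \<Rightarrow> 'g \<Rightarrow> 'g) \<Rightarrow> 'g set \<Rightarrow> 'g set \<Rightarrow> bool" where
  "nil_rep X \<rho> V U \<longleftrightarrow> subspace V \<and> subspace U \<and> U \<subseteq> V \<and>
     (\<forall>x\<in>X. lin (\<rho> x) \<and> \<rho> x ` V \<subseteq> V \<and> \<rho> x ` U \<subseteq> U \<and> (\<forall>v\<in>V. \<exists>k. (\<rho> x ^^ k) v \<in> U)) \<and>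
     (\<forall>x\<in>span X. \<forall>y\<in>span X. \<forall>v. \<rho> (x + y) v = \<rho> x v + \<rho> y v) \<and>
     (\<forall>x\<in>span X. \<forall>c v. \<rho> (c *s x) v = c *s \<rho> x v) \<and>
     (\<forall>x\<in>X. \<forall>y\<in>X. \<forall>v. \<rho> (br x y) v = \<rho> x (\<rho> y v) - \<rho> y (\<rho> x v))"

lemma nil_repD:
  assumes "nil_rep X \<rho> V U"
  shows "subspace V" "subspace U" "U \<subseteq> V" "x \<in> X \<Longrightarrow> lin (\<rho> x)"
    "x \<in> X \<Longrightarrow> \<rho> x ` V \<subseteq> V" "x \<in> X \<Longrightarrow> \<rho> x ` U \<subseteq> U"
    "x \<in> X \<Longrightarrow> v \<in> V \<Longrightarrow> \<exists>k. (\<rho> x ^^ k) v \<in> U"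
    "x \<in> span X \<Longrightarrow> y \<in> span X \<Longrightarrow> \<rho> (x + y) v = \<rho> x v + \<rho> y v"
    "x \<in> span X \<Longrightarrow> \<rho> (c *s x) v = c *s \<rho> x v"
    "x \<in> X \<Longrightarrow> y \<in> X \<Longrightarrow> \<rho> (br x y) v = \<rho> x (\<rho> y v) - \<rho> y (\<rho> x v)"
  using assms unfolding nil_rep_def by blast+

lemma nil_repI:
  assumes "subspace V" "subspace U" "U \<subseteq> V" "\<And>x. x \<in> X \<Longrightarrow> lin (\<rho> x)"
    "\<And>x. x \<in> X \<Longrightarrow> \<rho> x ` V \<subseteq> V" "\<And>x. x \<in> X \<Longrightarrow> \<rho> x ` U \<subseteq> U"
    "\<And>x v. x \<in> X \<Longrightarrow> v \<in> V \<Longrightarrow> \<exists>k. (\<rho> x ^^ k) v \<in> U"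
    "\<And>x y v. x \<in> span X \<Longrightarrow> y \<in> span X \<Longrightarrow> \<rho> (x + y) v = \<rho> x v + \<rho> y v"
    "\<And>x c v. x \<in> span X \<Longrightarrow> \<rho> (c *s x) v = c *s \<rho> x v"
    "\<And>x y v. x \<in> X \<Longrightarrow> y \<in> X \<Longrightarrow> \<rho> (br x y) v = \<rho> x (\<rho> y v) - \<rho> y (\<rho> x v)"
  shows "nil_rep X \<rho> V U"
  unfolding nil_rep_def by (intro conjI ballI allI) (rule assms; assumption)+

lemma nil_rep_subset:
  assumes "nil_rep X \<rho> V U" "Y \<subseteq> X" shows "nil_rep Y \<rho> V U"
proof (rule nil_repI)
  have sp: "x \<in> span X" if "x \<in> span Y" for x using span_mono[OF assms(2)] that by (rule subsetD)
  fix x y c v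
  show "x \<in> span Y \<Longrightarrow> y \<in> span Y \<Longrightarrow> \<rho> (x + y) v = \<rho> x v + \<rho> y v"
    by (rule nil_repD(8)[OF assms(1)]) (rule sp; assumption)+
  show "x \<in> span Y \<Longrightarrow> \<rho> (c *s x) v = c *s \<rho> x v"
    by (rule nil_repD(9)[OF assms(1)]) (rule sp; assumption)+
  note yx = subsetD[OF assms(2)]
  show "x \<in> Y \<Longrightarrow> lin (\<rho> x)" by (rule nil_repD(4)[OF assms(1) yx])
  show "x \<in> Y \<Longrightarrow> \<rho> x ` V \<subseteq> V" by (rule nil_repD(5)[OF assms(1) yx])
  show "x \<in> Y \<Longrightarrow> \<rho> x ` U \<subseteq> U" by (rule nil_repD(6)[OF assms(1) yx])
  show "x \<in> Y \<Longrightarrow> v \<in> V \<Longrightarrow> \<exists>k. (\<rho> x ^^ k) v \<in> U" by (rule nil_repD(7)[OF assms(1) yx])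
  show "x \<in> Y \<Longrightarrow> y \<in> Y \<Longrightarrow> \<rho> (br x y) v = \<rho> x (\<rho> y v) - \<rho> y (\<rho> x v)"
    by (rule nil_repD(10)[OF assms(1) yx yx])
qed (rule nil_repD(1-3)[OF assms(1)])+

lemma nil_rep_span:
  assumes "nil_rep X \<rho> V U" "Y \<subseteq> X" "\<And>y. y \<in> Y \<Longrightarrow> \<rho> y v \<in> U" "x \<in> span Y"
  shows "\<rho> x v \<in> U"
proof -
  note U = nil_repD(2)[OF assms(1)]
  note add = nil_repD(8)[OF assms(1)] and scale = nil_repD(9)[OF assms(1)]
  have sub: "span Y \<subseteq> span X" using assms(2) by (rule span_mono)
  have "x \<in> span Y \<and> \<rho> x v \<in> U" using assms(4)
  proof (induction rule: span_induct_alt)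
    case base
    have "\<rho> 0 v = 0" using scale[OF span_zero, of 0] by simp
    then show ?case using subspace_0[OF U] by (simp add: span_zero)
  next
    case (step c x y)
    have x: "x \<in> span Y" using step span_base by blast
    then have *: "c *s x \<in> span Y" by (rule span_scale)
    have "\<rho> (c *s x + y) v = c *s \<rho> x v + \<rho> y v" 
      using add[of "c *s x" y] scale[of x] subsetD[OF sub x] subsetD[OF sub *] subsetD[OF sub] step by auto
    then show ?case using step x * assms(3) U by (auto intro: subspace_add subspace_scale span_add)
  qed
  then show ?thesis ..
qed

text \<open>Expanded, (ad y)^m x acts as a combination of products \<rho>(y)^a \<rho>(x) \<rho>(y)^b
  with a + b = m. For m = 2N one exponent is at least \<open>N\<close>, and then the product maps
  \<open>V\<close> into \<open>U\<close>.\<close>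

lemma ad_nilpotent_of_rep:
  assumes X: "closed_set X" and \<rho>: "nil_rep X \<rho> V U" and x: "x \<in> X" and y: "y \<in> X"
  shows "\<exists>k. (br y ^^ k) x \<in> {z\<in>X. \<forall>v\<in>V. \<rho> z v \<in> U}"
proof -
  note st = nil_repD(2,4,5,6,10)[OF \<rho>]
  have "\<exists>N. \<forall>v\<in>V. (\<rho> y ^^ N) v \<in> U"
    by (rule uniform_nilpotent_mod[OF st(2)[OF y] nil_repD(1)[OF \<rho>] st(1) st(4)[OF y] nil_repD(7)[OF \<rho> y]])
  then obtain N where N: "\<And>v. v \<in> V \<Longrightarrow> (\<rho> y ^^ N) v \<in> U" by blast
  have inX: "(br y ^^ m) x \<in> X" for m
    using X x y by (induction m) (auto simp: closed_set_def)
  \<comment> \<open>The exponents \<open>a\<close> and \<open>b\<close> are carried along so that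
    unfolding one bracket raises one of them and preserves the sum a + b + m.\<close>
  have "(\<rho> y ^^ a) (\<rho> ((br y ^^ m) x) ((\<rho> y ^^ b) v)) \<in> U" if "v \<in> V" "a + b + m \<ge> 2 * N" for a b m v
    using that
  proof (induction m arbitrary: a b)
    case 0
    have V: "(\<rho> y ^^ b) v \<in> V" using funpow_stable[OF st(3)[OF y]] 0 by blast
    show ?case
    proof (cases "b \<ge> N")
      case True
      then have "(\<rho> y ^^ b) v \<in> U" using funpow_mod_mono[OF st(4)[OF y] N] 0 by blast
      then have "\<rho> x ((\<rho> y ^^ b) v) \<in> U" using st(4)[OF x] by blast
      then show ?thesis using funpow_stable[OF st(4)[OF y]] by simp
    next
      case False
      then have "a \<ge> N" using 0 by simp
      moreover have "\<rho> x ((\<rho> y ^^ b) v) \<in> V" using st(3)[OF x] V by blast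
      ultimately show ?thesis using funpow_mod_mono[OF st(4)[OF y] N] by simp
    qed
  next
    case (Suc m)
    let ?z = "(br y ^^ m) x" and ?w = "(\<rho> y ^^ b) v"
    have "(\<rho> y ^^ a) (\<rho> ((br y ^^ Suc m) x) ?w) = (\<rho> y ^^ a) (\<rho> y (\<rho> ?z ?w)) - (\<rho> y ^^ a) (\<rho> ?z (\<rho> y ?w))"
      by (simp add: st(5)[OF y inX] lin_diff[OF lin_funpow[OF st(2)[OF y]]])
    also have "\<dots> = (\<rho> y ^^ Suc a) (\<rho> ?z ?w) - (\<rho> y ^^ a) (\<rho> ?z ((\<rho> y ^^ Suc b) v))"
      by (simp add: funpow_swap1)
    also have "\<dots> \<in> U"
      by (rule subspace_diff[OF st(1) Suc.IH Suc.IH]) (use Suc.prems in auto)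
    finally show ?case .
  qed
  from this[of _ 0 0 "2 * N"] have "\<forall>v\<in>V. \<rho> ((br y ^^ (2 * N)) x) v \<in> U" by simp
  then show ?thesis using inX by blast
qed

text \<open>A vector supplied by the weak form enlarges \<open>U\<close> inside \<open>V\<close>,
  and every acting element maps the enlarged space back into \<open>U\<close>. So one more operator
  suffices for \<open>U\<close> than for the enlarged space.\<close>

lemma engel_flag:
  assumes weak: "\<And>V U. nil_rep X \<rho> V U \<Longrightarrow> V \<noteq> U \<Longrightarrow> \<exists>v\<in>V. v \<notin> U \<and> (\<forall>x\<in>X. \<rho> x v \<in> U)"
    and rep: "nil_rep X \<rho> V U"
  shows "\<exists>d. \<forall>xs. set xs \<subseteq> X \<longrightarrow> length xs = d \<longrightarrow> (\<forall>v\<in>V. foldr \<rho> xs v \<in> U)"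
  using rep
proof (induction "dim V - dim U" arbitrary: U rule: less_induct)
  case less
  note st = nil_repD(1,2,3,4,6)[OF less.prems]
  show ?case
  proof (cases "V = U")
    case True
    then show ?thesis by (intro exI[of _ 0]) auto
  next
    case False
    obtain v where v: "v \<in> V" "v \<notin> U" "\<And>x. x \<in> X \<Longrightarrow> \<rho> x v \<in> U" using weak[OF less.prems False] by blast
    let ?U = "span (insert v U)"
    have U: "U \<subseteq> ?U" using span_superset by blast
    have sV: "?U \<subseteq> V" using v(1) st by (intro span_minimal) auto
    have maps: "\<rho> x ` ?U \<subseteq> U" if x: "x \<in> X" for x
    proof -
      have "?U \<subseteq> {w. \<rho> x w \<in> U}"
        using v(3) st(5) x by (intro span_minimal subspace_preimage st) auto
      then show ?thesis by blast
    qed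
    have "v \<in> ?U" by (rule span_base) simp
    then have "?U \<noteq> U" using v(2) by blast
    then have "dim ?U \<noteq> dim U" using subspace_dim_equal[OF st(2) subspace_span U] by auto
    moreover have "dim U \<le> dim ?U" "dim ?U \<le> dim V"
      by (rule dim_subset[OF U], rule dim_subset[OF sV])
    ultimately have lt: "dim V - dim ?U < dim V - dim U" by simp
    have "nil_rep X \<rho> V ?U"
    proof (rule nil_repI[OF st(1) subspace_span sV st(4) nil_repD(5)[OF less.prems] _ _
          nil_repD(8,9,10)[OF less.prems]])
      fix x v assume "x \<in> X"
      then show "\<rho> x ` ?U \<subseteq> ?U" using maps U by blast
      assume "v \<in> V"
      then show "\<exists>k. (\<rho> x ^^ k) v \<in> ?U" using nil_repD(7)[OF less.prems \<open>x \<in> X\<close>] U by blast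
    qed
    then obtain d where d: "\<And>xs v. set xs \<subseteq> X \<Longrightarrow> length xs = d \<Longrightarrow> v \<in> V \<Longrightarrow> foldr \<rho> xs v \<in> ?U"
      using less.hyps[OF lt] by blast
    have "foldr \<rho> xs w \<in> U" if xs: "set xs \<subseteq> X" "length xs = Suc d" "w \<in> V" for xs w
    proof -
      obtain x ys where "xs = x # ys" using xs(2) by (cases xs) auto
      then have "foldr \<rho> ys w \<in> ?U" "x \<in> X" "foldr \<rho> xs w = \<rho> x (foldr \<rho> ys w)" using d xs by auto
      then show ?thesis using maps by auto
    qed
    then show ?thesis by blast
  qed
qed

text \<open>The adjoint action of \<open>Y\<close> on span X / span Y; Engel's theorem for it yields
  the normalizing element in \<open>engel_weak\<close>.\<close>

lemma nil_rep_ad_mod: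
  assumes X: "closed_set X" and Y: "Y \<subseteq> X" "closed_set Y"
    and nil: "\<And>x y. x \<in> X \<Longrightarrow> y \<in> Y \<Longrightarrow> \<exists>k. (br y ^^ k) x \<in> span Y"
  shows "nil_rep Y br (span X) (span Y)"
proof -
  have st: "br y ` span A \<subseteq> span A" if "closed_set A" "y \<in> A" for y A
  proof -
    have "span A \<subseteq> {x. br y x \<in> span A}"
      using that by (intro span_minimal subspace_preimage lin_br) (auto simp: closed_set_def span_base)
    then show ?thesis by blast
  qed
  have nil': "\<exists>k. (br y ^^ k) v \<in> span Y" if y: "y \<in> Y" and v: "v \<in> span X" for y v
    using v
  proof (induction rule: span_induct_alt)
    case base
    show ?case by (intro exI[of _ 0]) (simp add: span_zero)
  next
    case (step c x w)
    then obtain k l where "(br y ^^ k) x \<in> span Y" "(br y ^^ l) w \<in> span Y" using nil[OF _ y] by blast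
    then have "(br y ^^ max k l) x \<in> span Y" "(br y ^^ max k l) w \<in> span Y"
      using funpow_mod_mono[OF st[OF Y(2) \<open>y \<in> Y\<close>]] by (meson max.cobounded1, meson max.cobounded2)
    then have "(br y ^^ max k l) (c *s x + w) \<in> span Y"
      by (simp add: lin_add[OF lin_funpow[OF lin_br]] lin_scale[OF lin_funpow[OF lin_br]] span_add span_scale)
    then show ?case by blast
  qed
  show ?thesis
    by (rule nil_repI)
      (use nil' st[OF Y(2)] st[OF X subsetD[OF Y(1)]] Y(1) span_mono[OF Y(1)] in
        \<open>auto simp: lin_br br_add_left br_scale_left br_br\<close>)
qed

text \<open>Jacobson's form of Engel's theorem: the acting set \<open>X\<close> need not be a subspace.\<close>

lemma engel_weak:
  assumes "closed_set X" "nil_rep X \<rho> V U" "V \<noteq> U"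
  shows "\<exists>v\<in>V. v \<notin> U \<and> (\<forall>x\<in>X. \<rho> x v \<in> U)"
  using assms
proof (induction "dim (span X)" arbitrary: X \<rho> V U rule: less_induct)
  case (less X \<rho> V U)
  note st = nil_repD(1-6,10,7)[OF less.prems(2)]
  have X0: "0 \<in> X" and Xbr: "\<And>x y. x \<in> X \<Longrightarrow> y \<in> X \<Longrightarrow> br x y \<in> X"
    using less.prems(1) by (auto simp: closed_set_def)
  \<comment> \<open>\<open>Z\<close> acts as 0 on V/U. If it spans everything, any vector outside
    \<open>U\<close> will do.\<close>
  define Z where "Z = {x\<in>X. \<forall>v\<in>V. \<rho> x v \<in> U}"
  have \<rho>0: "\<rho> 0 v = 0" for v
    using nil_repD(9)[OF less.prems(2) span_zero, of 0] by simp
  show ?case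
  proof (cases "span Z = span X")
    case True
    obtain v where v: "v \<in> V" "v \<notin> U" using less.prems(3) st(3) by blast
    have "\<rho> x v \<in> U" if "x \<in> X" for x
      by (rule nil_rep_span[OF less.prems(2), of Z]) (use True that v span_base in \<open>auto simp: Z_def\<close>)
    then show ?thesis using v by blast
  next
    case False
    \<comment> \<open>Candidates are bracket-closed subsets with proper span; one of largest
      dimension is chosen. Containing \<open>Z\<close> makes \<open>br y\<close> nilpotent modulo
      the span, by \<open>ad_nilpotent_of_rep\<close>.\<close>
    define \<Y> where "\<Y> = {Y. Y \<subseteq> X \<and> closed_set Y \<and> Z \<subseteq> Y \<and> span Y \<noteq> span X}"
    have "closed_set Z" unfolding closed_set_def
    proof (intro conjI ballI)
      show "0 \<in> Z" using X0 \<rho>0 subspace_0[OF st(2)] by (simp add: Z_def)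
      fix x y assume xy: "x \<in> Z" "y \<in> Z"
      then have "\<rho> (br x y) v \<in> U" if "v \<in> V" for v
        using st(2,5,7) that unfolding Z_def by (auto intro!: subspace_diff; blast)
      then show "br x y \<in> Z" using xy Xbr by (auto simp: Z_def)
    qed
    then have "Z \<in> \<Y>" using False by (auto simp: \<Y>_def Z_def)
    moreover have "\<forall>Y. Y \<in> \<Y> \<longrightarrow> dim (span Y) < Suc dimension" using dim_subset_UNIV le_imp_less_Suc by blast
    ultimately have "\<exists>Y0. Y0 \<in> \<Y> \<and> (\<forall>Y. Y \<in> \<Y> \<longrightarrow> dim (span Y) \<le> dim (span Y0))"
      by (rule ex_has_greatest_nat)
    then obtain Y0 where Y0: "Y0 \<in> \<Y>" "\<And>Y. Y \<in> \<Y> \<Longrightarrow> dim (span Y) \<le> dim (span Y0)" by blast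
    \<comment> \<open>Saturating \<open>Y0\<close> inside \<open>X\<close> keeps its span and lets a
      bracket of elements of \<open>X\<close> be placed in \<open>Y\<close> by looking at spans
      only.\<close>
    define Y where "Y = X \<inter> span Y0"
    have Y0X: "Y0 \<subseteq> X" "closed_set Y0" "Z \<subseteq> Y0" "span Y0 \<noteq> span X" using Y0 by (auto simp: \<Y>_def)
    have spanY: "span Y = span Y0"
    proof
      show "span Y \<subseteq> span Y0" unfolding Y_def by (intro span_minimal) auto
      show "span Y0 \<subseteq> span Y" using Y0X(1) span_superset[of Y0] by (intro span_mono) (auto simp: Y_def)
    qed
    have YX: "Y \<subseteq> X" and ZY: "Z \<subseteq> Y" using Y0X span_superset[of Y0] by (auto simp: Y_def)
    have "br a b \<in> span Y0" if "a \<in> span Y0" "b \<in> span Y0" for a b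
    proof -
      have *: "br a b \<in> span Y0" if "a \<in> Y0" "b \<in> span Y0" for a b
      proof -
        have "span Y0 \<subseteq> {b. br a b \<in> span Y0}"
          using Y0X(2) that by (intro span_minimal subspace_preimage lin_br) (auto simp: closed_set_def span_base)
        then show ?thesis using that by blast
      qed
      have "span Y0 \<subseteq> {a. br a b \<in> span Y0}"
        using * \<open>b \<in> span Y0\<close> by (intro span_minimal subspace_preimage lin_br_left) auto
      then show ?thesis using \<open>a \<in> span Y0\<close> by blast
    qed
    then have clY: "closed_set Y" using Xbr X0 by (auto simp: closed_set_def Y_def span_zero)
    have ne: "span Y \<noteq> span X" using spanY Y0X by simp
    have sub: "span Y \<subseteq> span X" using YX by (rule span_mono)
    have "dim (span Y) \<noteq> dim (span X)" using subspace_dim_equal[OF subspace_span subspace_span sub] ne by auto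
    then have lt: "dim (span Y) < dim (span X)" using dim_subset[OF sub] by simp
    have nil: "\<exists>k. (br y ^^ k) x \<in> span Y" if xy: "x \<in> X" "y \<in> Y" for x y
    proof -
      have "\<exists>k. (br y ^^ k) x \<in> Z"
        using ad_nilpotent_of_rep[OF less.prems(1,2) xy(1)] xy(2) YX unfolding Z_def by blast
      then show ?thesis using ZY span_superset by blast
    qed
    have "\<exists>d. \<forall>xs. set xs \<subseteq> Y \<longrightarrow> length xs = d \<longrightarrow> (\<forall>v\<in>span X. foldr br xs v \<in> span Y)"
      by (rule engel_flag[OF _ nil_rep_ad_mod[OF less.prems(1) YX clY nil]]) (use less.hyps[OF lt clY] in blast)+
    then obtain d where d: "\<And>xs v. set xs \<subseteq> Y \<Longrightarrow> length xs = d \<Longrightarrow> v \<in> span X \<Longrightarrow> foldr br xs v \<in> span Y" by blast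
    \<comment> \<open>Otherwise brackets with elements of \<open>Y\<close> could be prolonged
      forever outside \<open>span Y\<close>, against the length \<open>d\<close> just
      obtained.\<close>
    have "\<exists>x\<in>X. x \<notin> span Y \<and> (\<forall>y\<in>Y. br y x \<in> span Y)"
    proof (rule ccontr)
      assume neg: "\<not> ?thesis"
      have "\<not> X \<subseteq> span Y" using ne sub span_minimal[OF _ subspace_span] by blast
      then obtain x0 where x0: "x0 \<in> X" "x0 \<notin> span Y" by blast
      have "\<exists>xs. set xs \<subseteq> Y \<and> length xs = k \<and> foldr br xs x0 \<in> X - span Y" for k
      proof (induction k)
        case 0
        show ?case using x0 by (intro exI[of _ "[]"]) auto
      next
        case (Suc k)
        then obtain xs where xs: "set xs \<subseteq> Y" "length xs = k" "foldr br xs x0 \<in> X - span Y" by blast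
        then obtain y where "y \<in> Y" "br y (foldr br xs x0) \<notin> span Y" using neg by blast
        then show ?case using xs YX Xbr by (intro exI[of _ "y # xs"]) auto
      qed
      then show False using d[of _ x0] x0 span_base by blast
    qed
    then obtain x where x: "x \<in> X" "x \<notin> span Y" "\<And>y. y \<in> Y \<Longrightarrow> br y x \<in> span Y" by blast
    have yx: "br y x \<in> Y" if "y \<in> Y" for y using x that YX Xbr spanY by (auto simp: Y_def)
    have xy: "br x y \<in> Y" if "y \<in> Y" for y
    proof -
      have "br x y \<in> X" using Xbr x(1) that YX by blast
      moreover have "br x y \<in> span Y0"
        unfolding br_anti[of x y] using yx[OF that] by (auto simp: Y_def intro: span_neg)
      ultimately show ?thesis by (simp add: Y_def)
    qed
    let ?Y = "insert x Y"
    have "closed_set ?Y" using clY xy yx by (auto simp: closed_set_def br_self)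
    moreover have "dim (span ?Y) > dim (span Y0)"
    proof -
      have sub2: "span Y \<subseteq> span ?Y" by (intro span_mono) auto
      moreover have "x \<in> span ?Y" by (rule span_base) simp
      ultimately have "dim (span Y) \<noteq> dim (span ?Y)"
        using subspace_dim_equal[OF subspace_span subspace_span sub2] x(2) by auto
      then show ?thesis using dim_subset[OF sub2] spanY by simp
    qed
    ultimately have spX: "span ?Y = span X" using Y0(2)[of ?Y] x(1) YX ZY unfolding \<Y>_def by fastforce
    \<comment> \<open>As \<open>x\<close> normalizes \<open>Y\<close>, it preserves this space of
      vectors killed by \<open>Y\<close> modulo \<open>U\<close>; being nilpotent modulo
      \<open>U\<close>, it kills one of them outside \<open>U\<close>. By maximality
      \<open>x\<close> and \<open>Y\<close> together span everything.\<close>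
    define W where "W = {v\<in>V. \<forall>y\<in>Y. \<rho> y v \<in> U}"
    obtain w where "w \<in> V" "w \<notin> U" "\<forall>y\<in>Y. \<rho> y w \<in> U"
      using less.hyps[OF lt clY nil_rep_subset[OF less.prems(2) YX] less.prems(3)] by blast
    then have WU: "W \<noteq> U" by (auto simp: W_def)
    have "U \<subseteq> W" using st(3,6) YX by (auto simp: W_def)
    moreover have "\<rho> x ` W \<subseteq> W"
    proof safe
      fix v assume v: "v \<in> W"
      have "\<rho> y (\<rho> x v) \<in> U" if y: "y \<in> Y" for y
      proof -
        have "\<rho> y (\<rho> x v) = \<rho> (br y x) v + \<rho> x (\<rho> y v)" using st(7)[of y x v] y YX x by auto
        moreover have "\<rho> (br y x) v \<in> U" using v yx[OF y] by (auto simp: W_def)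
        moreover have "\<rho> x (\<rho> y v) \<in> U" using v y st(6)[OF x(1)] by (auto simp: W_def)
        ultimately show ?thesis using subspace_add[OF st(2)] by simp
      qed
      then show "\<rho> x v \<in> W" using v st(5)[OF x(1)] by (auto simp: W_def)
    qed
    moreover have "\<exists>k. (\<rho> x ^^ k) v \<in> U" if "v \<in> W" for v using st(8)[OF x(1)] that by (auto simp: W_def)
    ultimately obtain v where v: "v \<in> W" "v \<notin> U" "\<rho> x v \<in> U"
      using nilpotent_kernel_mod[OF WU, of "\<rho> x"] by blast
    have "\<rho> z v \<in> U" if "z \<in> X" for z
      by (rule nil_rep_span[OF less.prems(2), of ?Y])
        (use x YX v spX that span_base in \<open>auto simp: W_def\<close>)
    then show ?thesis using v by (auto simp: W_def)
  qed
qed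

lemma engel_strong:
  assumes "closed_set X" "nil_rep X \<rho> V U"
  shows "\<exists>d. \<forall>xs. set xs \<subseteq> X \<longrightarrow> length xs = d \<longrightarrow> (\<forall>v\<in>V. foldr \<rho> xs v \<in> U)"
  by (rule engel_flag[OF _ assms(2)]) (rule engel_weak[OF assms(1)])

subsection \<open>Weights of nilpotent subalgebras\<close>

definition nilp_alg :: "'g set \<Rightarrow> bool" where
  "nilp_alg T \<longleftrightarrow> lie_subalgebra T \<and> lie_nilpotent T"

abbreviation wt :: "'g set \<Rightarrow> ('g \<Rightarrow> complex) set" where
  "wt T \<equiv> weights T br"

abbreviation gs :: "'g set \<Rightarrow> ('g \<Rightarrow> complex) \<Rightarrow> 'g set" where
  "gs T \<kappa> \<equiv> jgen T br \<kappa>"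

abbreviation prw :: "'g set \<Rightarrow> ('g \<Rightarrow> complex) \<Rightarrow> 'g \<Rightarrow> 'g" where
  "prw T \<equiv> pr (wt T) (gs T)"

lemma zero_supported: "0 \<in> supported T"
  by (simp add: supported_def)

lemma supported_add: "\<kappa> \<in> supported T \<Longrightarrow> \<mu> \<in> supported T \<Longrightarrow> \<kappa> + \<mu> \<in> supported T"
  by (simp add: supported_def)

lemma gs_br: "x \<in> gs T \<kappa> \<Longrightarrow> y \<in> gs T \<mu> \<Longrightarrow> br x y \<in> gs T (\<kappa> + \<mu>)"
  using gen_ad_br by (simp add: jgen_def)

lemma subspace_dual_space:
  assumes "f \<in> dual_space T" "g \<in> dual_space T"
  shows "f + g \<in> dual_space T" "f - g \<in> dual_space T"
  using assms by (auto simp: dual_space_def algebra_simps)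

lemma dual_space_supported: "dual_space T \<subseteq> supported T"
  by (auto simp: dual_space_def supported_def)

text \<open>A point that is good for \<open>F\<close> is moved along a line in a direction on which
  \<open>f\<close> does not vanish; each functional excludes at most one point of this line.\<close>

lemma avoid_hyperplanes:
  assumes T: "subspace T" and "finite F" "\<And>f. f \<in> F \<Longrightarrow> f \<in> dual_space T" "\<And>f. f \<in> F \<Longrightarrow> f \<noteq> 0"
  shows "\<exists>x\<in>T. \<forall>f\<in>F. f x \<noteq> 0"
  using assms(2-)
proof (induction F rule: finite_induct)
  case empty
  show ?case using subspace_0[OF T] by auto
next
  case (insert f F)
  obtain x where x: "x \<in> T" "\<And>g. g \<in> F \<Longrightarrow> g x \<noteq> 0" using insert by auto
  have f: "f \<in> dual_space T" "f \<noteq> 0" using insert.prems by blast+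
  obtain y where y: "f y \<noteq> 0" using f(2) by (auto simp: fun_eq_iff)
  then have yT: "y \<in> T" using f(1) by (auto simp: dual_space_def)
  \<comment> \<open>Where \<open>g y = 0\<close> the quotient is 0 by convention, which merely
    excludes \<open>c = 0\<close> as well.\<close>
  define B where "B = (\<lambda>g. - g x / g y) ` insert f F"
  have "finite B" using insert.hyps by (simp add: B_def)
  then obtain c where c: "c \<notin> B" using ex_new_if_finite[OF infinite_UNIV_char_0, where A = B] by blast
  have "g (x + c *s y) \<noteq> 0" if g: "g \<in> insert f F" for g
  proof
    assume 0: "g (x + c *s y) = 0"
    have "g \<in> dual_space T" using insert.prems(1) g by blast
    then have "g (x + c *s y) = g x + c * g y"
      using x(1) yT subspace_scale[OF T] by (simp add: dual_space_def)
    then have e: "g x + c * g y = 0" using 0 by simp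
    show False
    proof (cases "g y = 0")
      case True
      then show False using e g x y by auto
    next
      case False
      then have "c = - g x / g y" using e by (simp add: field_simps add_eq_0_iff)
      then show False using c g by (auto simp: B_def)
    qed
  qed
  moreover have "x + c *s y \<in> T" using x(1) yT T by (auto intro: subspace_add subspace_scale)
  ultimately show ?case by blast
qed

context
  fixes T
  assumes T: "nilp_alg T"
begin

lemma subspace_T: "subspace T"
  and T_br: "x \<in> T \<Longrightarrow> y \<in> T \<Longrightarrow> br x y \<in> T"
  using T by (auto simp: nilp_alg_def lie_subalgebra_def)

lemma T_in_gen: assumes "x \<in> T" "y \<in> T" shows "y \<in> gen (br x) 0"
proof -
  obtain k where k: "((\<lambda>X. br_span T X) ^^ k) T = {0}" using T by (auto simp: nilp_alg_def lie_nilpotent_def)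
  have "(br x ^^ m) y \<in> ((\<lambda>X. br_span T X) ^^ m) T" for m
  proof (induction m)
    case (Suc m)
    then show ?case using assms(1) unfolding funpow.simps o_apply br_span_def by (intro span_base) blast
  qed (use assms in simp)
  from this[of k] show ?thesis unfolding k by (auto simp: gen_def shift_zero)
qed

text \<open>Nilpotency puts \<open>T\<close> into the generalized null space of each
  \<open>br x\<close> with \<open>x\<close> in \<open>T\<close>; by \<open>gen_ad_br\<close> a
  bracket with an element of \<open>T\<close> then shifts generalized eigenvalues by 0.\<close>

lemma compat: "compatible T br"
  unfolding compatible_def
proof (intro conjI ballI allI subsetI)
  fix i j c v assume ij: "i \<in> T" "j \<in> T" and "v \<in> br j ` gen (br i) c"
  then obtain u where u: "u \<in> gen (br i) c" "v = br j u" by blast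
  have "br j u \<in> gen (br i) (0 + c)" by (rule gen_ad_br[OF T_in_gen[OF ij] u(1)])
  then show "v \<in> gen (br i) c" using u by simp
qed (rule lin_br)

lemma ds: "dsum (wt T) (gs T)"
  by (rule dsum_weights[OF compat])

lemma subspace_gs: "subspace (gs T \<kappa>)"
  by (rule subspace_jgen[OF compat])

lemma gs_empty: "\<kappa> \<in> supported T \<Longrightarrow> \<kappa> \<notin> wt T \<Longrightarrow> gs T \<kappa> = {0}"
  by (rule jgen_notin_weights[OF compat])

lemma T_in_gs0: "T \<subseteq> gs T 0"
  using T_in_gen by (auto simp: jgen_def)

lemma br_gs: assumes "t \<in> T" "v \<in> gs T \<kappa>" shows "br t v \<in> gs T \<kappa>"
  using gs_br[of t T 0 v \<kappa>] T_in_gs0 assms by auto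

lemma prw_br: "t \<in> T \<Longrightarrow> \<kappa> \<in> wt T \<Longrightarrow> prw T \<kappa> (br t v) = br t (prw T \<kappa> v)"
  by (rule pr_commute[OF ds lin_br]) (use br_gs in auto)

lemma prw_off:
  assumes "v \<in> gs T \<mu>" "\<mu> \<in> supported T" "\<mu> \<noteq> \<nu>" "\<nu> \<in> wt T" shows "prw T \<nu> v = 0"
proof (cases "\<mu> \<in> wt T")
  case True
  then show ?thesis using pr_mem[OF ds assms(1) True assms(4)] assms(3) by auto
next
  case False
  then have "v = 0" using gs_empty assms by blast
  then show ?thesis using lin_0[OF lin_pr[OF ds assms(4)]] by simp
qed

lemma wt_supported: "\<kappa> \<in> wt T \<Longrightarrow> \<kappa> \<in> supported T"
  by (simp add: weights_def)

lemma finite_wt: "finite (wt T)"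
  by (rule finite_weights[OF compat])

lemma dim_gs: assumes "\<kappa> \<in> wt T" shows "dim (gs T \<kappa>) \<noteq> 0"
  using dim_pos[OF subspace_gs, of \<kappa>] assms unfolding weights_def by force

lemma tr_weight:
  assumes "t \<in> T" "\<kappa> \<in> wt T"
  shows "tr (\<lambda>v. br t (prw T \<kappa> v)) = \<kappa> t * of_nat (dim (gs T \<kappa>))"
proof -
  have "prw T \<kappa> v \<in> gen (br t) (\<kappa> t)" for v
    using pr_in[OF ds assms(2), of v] assms(1) by (simp add: jgen_def)
  then have "tr (\<lambda>v. br t (prw T \<kappa> v)) = \<kappa> t * tr (prw T \<kappa>)"
    by (intro tr_single_eigenvalue lin_br lin_pr[OF ds assms(2)] prw_br[OF assms] pr_idem[OF ds assms(2)])
  then show ?thesis using tr_pr[OF ds assms(2)] by simp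
qed

text \<open>The trace of \<open>br t\<close> on the weight space is \<kappa>(t) times its dimension,
  and traces are linear in \<open>t\<close>.\<close>

lemma weight_linear: assumes "\<kappa> \<in> wt T" shows "\<kappa> \<in> dual_space T"
proof -
  let ?d = "of_nat (dim (gs T \<kappa>)) :: complex"
  have d: "?d \<noteq> 0" using dim_gs[OF assms] by simp
  have "\<kappa> (x + y) = \<kappa> x + \<kappa> y" if xy: "x \<in> T" "y \<in> T" for x y
  proof -
    have "\<kappa> (x + y) * ?d = (\<kappa> x + \<kappa> y) * ?d"
      using tr_weight[OF xy(1) assms] tr_weight[OF xy(2) assms]
        tr_weight[OF subspace_add[OF subspace_T xy] assms]
      by (simp add: br_add_left tr_add distrib_right)
    then show ?thesis using d by simp
  qed
  moreover have "\<kappa> (c *s x) = c * \<kappa> x" if x: "x \<in> T" for c x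
  proof -
    have "\<kappa> (c *s x) * ?d = (c * \<kappa> x) * ?d"
      using tr_weight[OF x assms] tr_weight[OF subspace_scale[OF subspace_T x] assms]
      by (simp only: br_scale_left tr_scale mult.assoc)
    then show ?thesis using d by simp
  qed
  ultimately show ?thesis using wt_supported[OF assms] by (auto simp: dual_space_def supported_def)
qed

text \<open>On the weight space the bracket acts as a commutator, whose trace is 0.\<close>

lemma weight_bracket: assumes "\<kappa> \<in> wt T" "x \<in> T" "y \<in> T" shows "\<kappa> (br x y) = 0"
proof -
  let ?P = "prw T \<kappa>"
  have "tr (\<lambda>v. br x (br y (?P v))) = tr (\<lambda>v. br y (?P (br x v)))"
    by (rule tr_cyc[OF lin_br lin_comp[OF lin_br lin_pr[OF ds assms(1)]]])
  also have "\<dots> = tr (\<lambda>v. br y (br x (?P v)))" using prw_br[OF assms(2,1)] by simp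
  finally have "tr (\<lambda>v. br (br x y) (?P v)) = 0" by (simp add: br_br tr_diff)
  then show ?thesis using tr_weight[OF T_br[OF assms(2,3)] assms(1)] dim_gs[OF assms(1)] by simp
qed

text \<open>Subtracting the weight leaves a representation because \<kappa> is linear and vanishes
  on brackets; this brings nonzero weights within reach of Engel's theorem.\<close>

lemma shift_nil_rep:
  assumes "\<kappa> \<in> wt T" shows "nil_rep T (\<lambda>t. shift (br t) (\<kappa> t)) (gs T \<kappa>) {0}"
proof (rule nil_repI)
  have sp: "span T = T" using subspace_T by simp
  have lam: "\<kappa> \<in> dual_space T" by (rule weight_linear[OF assms])
  fix x assume x: "x \<in> T"
  show "lin (shift (br x) (\<kappa> x))" by (rule lin_shift[OF lin_br])
  show "shift (br x) (\<kappa> x) ` gs T \<kappa> \<subseteq> gs T \<kappa>"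
    using br_gs[OF x] subspace_gs by (auto simp: shift_def intro!: subspace_diff subspace_scale)
  show "shift (br x) (\<kappa> x) ` {0} \<subseteq> {0}" by (simp add: shift_def)
  show "\<exists>k. (shift (br x) (\<kappa> x) ^^ k) v \<in> {0}" if "v \<in> gs T \<kappa>" for v
    using that x by (auto simp: jgen_def gen_def)
next
  fix x y v assume "x \<in> span T" "y \<in> span T"
  then show "shift (br (x + y)) (\<kappa> (x + y)) v = shift (br x) (\<kappa> x) v + shift (br y) (\<kappa> y) v"
    using weight_linear[OF assms] subspace_T
    by (simp add: shift_def dual_space_def span_eq_iff[THEN iffD2] br_add_left scale_left_distrib algebra_simps)
next
  fix x c v assume "x \<in> span T"
  then show "shift (br (c *s x)) (\<kappa> (c *s x)) v = c *s shift (br x) (\<kappa> x) v"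
    using weight_linear[OF assms] subspace_T
    by (simp add: shift_def dual_space_def span_eq_iff[THEN iffD2] br_scale_left scale_right_diff_distrib)
next
  fix x y v assume "x \<in> T" "y \<in> T"
  then show "shift (br (br x y)) (\<kappa> (br x y)) v =
      shift (br x) (\<kappa> x) (shift (br y) (\<kappa> y) v) - shift (br y) (\<kappa> y) (shift (br x) (\<kappa> x) v)"
    using weight_bracket[OF assms]
    by (simp add: shift_def br_br br_diff_right br_scale_right scale_right_diff_distrib mult.commute)
qed (use subspace_gs in \<open>auto simp: subspace_0\<close>)

lemma T_closed: "closed_set T"
  using subspace_0[OF subspace_T] T_br by (auto simp: closed_set_def)

lemma weight_vector:
  assumes "\<kappa> \<in> wt T" shows "\<exists>v. v \<noteq> 0 \<and> (\<forall>t\<in>T. br t v = \<kappa> t *s v)"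
proof -
  have "gs T \<kappa> \<noteq> {0}" using assms by (simp add: weights_def)
  then show ?thesis using engel_weak[OF T_closed shift_nil_rep[OF assms]] by (auto simp: shift_def)
qed

text \<open>\<open>br y\<close> and \<open>br v\<close> need not commute, so nilpotency of their
  product is not automatic. On a weight space \<open>br v\<close> is replaced by its shift, which
  makes the product a word in the action of \<open>shift_nil_rep\<close>; long words vanish by
  \<open>engel_strong\<close>. The correction \<kappa>(v) tr (ad y) is 0 because \<kappa>(y) =
  0.\<close>

lemma tr_ad_nilpotent:
  assumes y: "y \<in> T" "\<And>\<kappa>. \<kappa> \<in> wt T \<Longrightarrow> \<kappa> y = 0" and v: "v \<in> T"
  shows "tr (\<lambda>w. br y (br v w)) = 0"
proof -
  have "tr (\<lambda>w. br y (br v (prw T \<kappa> w))) = 0" if l: "\<kappa> \<in> wt T" for \<kappa>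
  proof -
    let ?\<rho> = "\<lambda>t. shift (br t) (\<kappa> t)" and ?P = "prw T \<kappa>"
    obtain d where d: "\<And>xs w. set xs \<subseteq> T \<Longrightarrow> length xs = d \<Longrightarrow> w \<in> gs T \<kappa> \<Longrightarrow> foldr ?\<rho> xs w = 0"
      using engel_strong[OF T_closed shift_nil_rep[OF l]] by auto
    have \<rho>y: "?\<rho> y w = br y w" for w using y(2)[OF l] by (simp add: shift_def)
    define F where "F = (\<lambda>w. br y (?\<rho> v (?P w)))"
    have linF: "lin F" unfolding F_def by (intro lin_comp[OF lin_br] lin_comp[OF lin_shift[OF lin_br]] lin_pr[OF ds l])
    have inv: "F w \<in> gs T \<kappa>" for w
      unfolding F_def shift_def
      by (intro br_gs[OF y(1)] subspace_diff[OF subspace_gs] subspace_scale[OF subspace_gs] br_gs[OF v] pr_in[OF ds l])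
    have pow: "(F ^^ k) w = foldr ?\<rho> (concat (replicate k [y, v])) w" if "w \<in> gs T \<kappa>" for k w
    proof (induction k)
      case (Suc k)
      have "(F ^^ k) w \<in> gs T \<kappa>" using that inv by (induction k) auto
      then have "?P ((F ^^ k) w) = (F ^^ k) w" using pr_mem[OF ds _ l l] by simp
      then show ?case using Suc \<rho>y by (simp add: F_def)
    qed simp
    \<comment> \<open>The power is a word of length 2d, and already its d innermost letters give
      0.\<close>
    have "(F ^^ d) w = 0" if w: "w \<in> gs T \<kappa>" for w
    proof -
      define zs where "zs = concat (replicate d [y, v])"
      have len: "length zs = 2 * d" unfolding zs_def by (induction d) auto
      have zT: "set zs \<subseteq> T" using y v by (auto simp: zs_def)
      have "foldr ?\<rho> (drop d zs) w = 0"
        by (rule d) (use len zT set_drop_subset[of d zs] w in auto)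
      moreover have "foldr ?\<rho> zs w = foldr ?\<rho> (take d zs) (foldr ?\<rho> (drop d zs) w)"
        by (metis append_take_drop_id comp_apply foldr_append)
      moreover have "foldr ?\<rho> xs 0 = 0" for xs by (induction xs) (auto simp: shift_def)
      ultimately show ?thesis using pow[OF w, of d] by (simp add: zs_def)
    qed
    then have "(F ^^ Suc d) w = 0" for w using inv[of w] by (simp only: funpow_Suc_right o_apply)
    then have "tr F = 0" by (rule tr_nilpotent[OF linF])
    moreover have "tr (\<lambda>w. br y (br v (?P w))) = tr (\<lambda>w. F w + \<kappa> v *s br y (?P w))"
      by (simp add: F_def shift_def br_diff_right br_scale_right)
    ultimately show ?thesis
      using tr_weight[OF y(1) l] y(2)[OF l] by (simp add: tr_add tr_scale)
  qed
  then show ?thesis using tr_dsum[OF ds lin_comp[OF lin_br lin_br], of y v] by simp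
qed

lemma tr_ad_off:
  assumes "x \<in> gs T \<kappa>" "y \<in> gs T \<mu>" "\<kappa> \<in> supported T" "\<mu> \<in> supported T" "\<kappa> + \<mu> \<noteq> 0"
  shows "tr (\<lambda>v. br x (br y v)) = 0"
proof (rule tr_off_diagonal[OF ds lin_comp[OF lin_br lin_br]])
  fix \<nu> v assume \<nu>: "\<nu> \<in> wt T" "v \<in> gs T \<nu>"
  have "br x (br y v) \<in> gs T (\<kappa> + (\<mu> + \<nu>))" using gs_br assms \<nu> by blast
  moreover have "\<kappa> + (\<mu> + \<nu>) \<noteq> \<nu>" using assms(5) by (simp add: add.assoc[symmetric])
  ultimately show "prw T \<nu> (br x (br y v)) = 0"
    using prw_off supported_add assms wt_supported[OF \<nu>(1)] \<nu>(1) by metis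
qed

lemma gs_spans:
  assumes "subspace U" "\<And>\<kappa>. \<kappa> \<in> wt T \<Longrightarrow> gs T \<kappa> \<subseteq> U" shows "v \<in> U"
proof -
  have "(\<Sum>\<kappa>\<in>wt T. prw T \<kappa> v) \<in> U"
    by (rule subspace_sum[OF assms(1)]) (use assms(2) pr_in[OF ds] in blast)
  then show ?thesis by (simp add: pr_sum[OF ds])
qed

text \<open>The weights \<mu> + k \<kappa> are pairwise distinct, while only finitely many weights
  occur.\<close>

lemma ad_root_nilpotent:
  assumes x: "x \<in> gs T \<kappa>" "\<kappa> \<in> supported T" "\<kappa> \<noteq> 0" shows "\<exists>k. (br x ^^ k) v = 0"
proof -
  have "gs T \<mu> \<subseteq> gen (br x) 0" if \<mu>: "\<mu> \<in> wt T" for \<mu>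
  proof
    fix v assume v: "v \<in> gs T \<mu>"
    obtain t where t: "\<kappa> t \<noteq> 0" using x(3) by (auto simp: fun_eq_iff)
    let ?\<mu> = "\<lambda>k::nat. (\<lambda>u. \<mu> u + of_nat k * \<kappa> u)"
    have sup: "?\<mu> k \<in> supported T" for k using wt_supported[OF \<mu>] x(2) by (auto simp: supported_def)
    have inj: "inj ?\<mu>" using t by (auto simp: inj_def fun_eq_iff dest!: spec[of _ t])
    have "(br x ^^ k) v \<in> gs T (?\<mu> k)" for k
    proof (induction k)
      case (Suc k)
      have "br x ((br x ^^ k) v) \<in> gs T (\<kappa> + ?\<mu> k)" by (rule gs_br[OF x(1) Suc])
      moreover have "\<kappa> + ?\<mu> k = ?\<mu> (Suc k)" by (auto simp: algebra_simps)
      ultimately show ?case by simp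
    qed (use v in simp)
    moreover have "\<exists>k. ?\<mu> k \<notin> wt T"
      using finite_subset[OF _ finite_wt, of "range ?\<mu>"] finite_imageD[OF _ inj] infinite_UNIV_nat by blast
    ultimately show "v \<in> gen (br x) 0" using gs_empty[OF sup] by (auto simp: gen_def shift_zero)
  qed
  then have "v \<in> gen (br x) 0" by (rule gs_spans[OF subspace_gen[OF lin_br]])
  then show ?thesis by (simp add: gen_def shift_zero)
qed

end

text \<open>If the weight-0 part of \<open>L\<close> were larger than \<open>C\<close>, Engel's
  theorem on the quotient would give an element outside \<open>C\<close> that normalizes
  \<open>C\<close>.\<close>

lemma cartan_zero_weight_space:
  assumes L: "lie_subalgebra L" and C: "cartan_subalgebra L C"
  shows "L \<inter> gs C 0 = C"
proof -
  have nC: "nilp_alg C" and CL: "C \<subseteq> L" and self: "{x \<in> L. \<forall>y\<in>C. br x y \<in> C} = C"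
    using C by (auto simp: cartan_subalgebra_def nilp_alg_def)
  let ?V = "L \<inter> gs C 0"
  have sub: "C \<subseteq> ?V" using CL T_in_gs0[OF nC] by blast
  have "nil_rep C br ?V C"
  proof (rule nil_repI)
    show "subspace ?V" using L subspace_gs[OF nC] by (auto simp: lie_subalgebra_def intro: subspace_inter)
    show "subspace C" by (rule subspace_T[OF nC])
    show "C \<subseteq> ?V" by (rule sub)
    fix x assume x: "x \<in> C"
    show "br x ` ?V \<subseteq> ?V" using br_gs[OF nC x] L x CL by (auto simp: lie_subalgebra_def)
    show "br x ` C \<subseteq> C" using T_br[OF nC x] by blast
    show "\<exists>k. (br x ^^ k) v \<in> C" if "v \<in> ?V" for v
    proof -
      have "v \<in> gen (br x) 0" using that x by (auto simp: jgen_def)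
      then obtain k where "(br x ^^ k) v = 0" by (auto simp: gen_def shift_zero)
      then show ?thesis using subspace_0[OF subspace_T[OF nC]] by metis
    qed
  qed (auto simp: lin_br br_add_left br_scale_left br_br)
  note rep = this
  have "?V = C"
  proof (rule ccontr)
    assume "?V \<noteq> C"
    then obtain v where v: "v \<in> ?V" "v \<notin> C" "\<forall>x\<in>C. br x v \<in> C"
      using engel_weak[OF T_closed[OF nC] rep] by blast
    then have "\<forall>y\<in>C. br v y \<in> C" using br_anti[of v] subspace_neg[OF subspace_T[OF nC]] by metis
    then show False using self v by blast
  qed
  then show ?thesis .
qed

subsection \<open>The Killing form\<close>

definition kf :: "'g \<Rightarrow> 'g \<Rightarrow> complex" where
  "kf x y = tr (\<lambda>v. br x (br y v))"

lemma kf_add_left: "kf (x + y) z = kf x z + kf y z"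
  and kf_add_right: "kf z (x + y) = kf z x + kf z y"
  and kf_scale_left: "kf (c *s x) z = c * kf x z"
  and kf_scale_right: "kf z (c *s x) = c * kf z x"
  by (simp_all add: kf_def br_add_left br_add_right tr_add br_scale_left br_scale_right tr_scale)

lemma kf_sym: "kf x y = kf y x"
  unfolding kf_def by (rule tr_cyc[OF lin_br lin_br])

lemma kf_invariant: "kf (br x y) z = kf x (br y z)"
proof -
  have "tr (\<lambda>v. br y (br x (br z v))) = tr (\<lambda>v. br x (br z (br y v)))"
    by (rule tr_cyc[OF lin_br lin_comp[OF lin_br lin_br]])
  then show ?thesis
    by (simp add: kf_def br_br br_diff_right tr_diff)
qed

lemma automorphism_lin: "lie_automorphism \<phi> \<Longrightarrow> lin \<phi>"
  by (simp add: lie_automorphism_def lin_iff_linear)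

lemma automorphism_bij: "lie_automorphism \<phi> \<Longrightarrow> bij \<phi>"
  by (simp add: lie_automorphism_def)

lemma automorphism_br: "lie_automorphism \<phi> \<Longrightarrow> \<phi> (br x y) = br (\<phi> x) (\<phi> y)"
  by (simp add: lie_automorphism_def)

lemma automorphismI:
  "lin \<phi> \<Longrightarrow> bij \<phi> \<Longrightarrow> (\<And>x y. \<phi> (br x y) = br (\<phi> x) (\<phi> y)) \<Longrightarrow> lie_automorphism \<phi>"
  by (simp add: lie_automorphism_def lin_iff_linear)

lemma automorphism_comp:
  assumes "lie_automorphism \<phi>" "lie_automorphism \<psi>" shows "lie_automorphism (\<phi> \<circ> \<psi>)"
  using assms by (intro automorphismI) (auto simp: automorphism_lin lin_o automorphism_br bij_comp automorphism_bij)

lemma automorphism_id: "lie_automorphism id"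
  by (intro automorphismI lin_id) auto

lemma automorphism_inv: assumes "lie_automorphism \<phi>" shows "lie_automorphism (inv \<phi>)"
proof (rule automorphismI)
  note b = automorphism_bij[OF assms]
  have s: "\<phi> (inv \<phi> x) = x" for x using b by (simp add: bij_is_surj surj_f_inv_f)
  have i: "inv \<phi> (\<phi> x) = x" for x using b by (simp add: bij_is_inj inv_f_f)
  show "bij (inv \<phi>)" using b by (rule bij_imp_bij_inv)
  show "lin (inv \<phi>)"
  proof (rule linI)
    show "inv \<phi> (x + y) = inv \<phi> x + inv \<phi> y" for x y
      using i[of "inv \<phi> x + inv \<phi> y"] lin_add[OF automorphism_lin[OF assms]] s by simp
    show "inv \<phi> (c *s x) = c *s inv \<phi> x" for c x
      using i[of "c *s inv \<phi> x"] lin_scale[OF automorphism_lin[OF assms]] s by simp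
  qed
  show "inv \<phi> (br x y) = br (inv \<phi> x) (inv \<phi> y)" for x y
    using i[of "br (inv \<phi> x) (inv \<phi> y)"] automorphism_br[OF assms] s by simp
qed

lemma automorphism_gs:
  assumes "lie_automorphism \<psi>" "\<And>t. t \<in> T \<Longrightarrow> \<psi> t = t" shows "\<psi> ` gs T \<kappa> \<subseteq> gs T \<kappa>"
proof -
  have "\<psi> v \<in> gen (br t) c" if "t \<in> T" "v \<in> gen (br t) c" for v t c
    by (rule gen_stable_comm[OF lin_br automorphism_lin[OF assms(1)] _ that(2)])
      (use automorphism_br[OF assms(1)] assms(2)[OF that(1)] in simp)
  then show ?thesis by (auto simp: jgen_def)
qed

text \<open>For \<open>Q = \<phi>\<^sup>k\<close> this is the invariance of the functional \<open>y \<mapsto> tr (\<phi>\<^sup>k ad y)\<close> under \<open>\<phi>\<close>.\<close>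

lemma tr_automorphism:
  assumes "lie_automorphism \<phi>" "lin Q" "\<And>v. Q (\<phi> v) = \<phi> (Q v)"
  shows "tr (\<lambda>v. Q (br (\<phi> y) v)) = tr (\<lambda>v. Q (br y v))"
proof -
  have s: "\<phi> (inv \<phi> x) = x" for x using automorphism_bij[OF assms(1)] by (simp add: bij_is_surj surj_f_inv_f)
  have i: "inv \<phi> (\<phi> x) = x" for x using automorphism_bij[OF assms(1)] by (simp add: bij_is_inj inv_f_f)
  have "tr (\<lambda>v. Q (br (\<phi> y) v)) = tr (\<lambda>v. \<phi> (Q (br y (inv \<phi> v))))"
    using automorphism_br[OF assms(1), of y] s by (metis assms(3))
  also have "\<dots> = tr (\<lambda>v. Q (br y (inv \<phi> (\<phi> v))))"
    by (rule tr_cyc[OF automorphism_lin[OF assms(1)]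
          lin_comp[OF assms(2) lin_comp[OF lin_br automorphism_lin[OF automorphism_inv[OF assms(1)]]]]])
  finally show ?thesis by (simp add: i)
qed

lemma kf_automorphism: assumes "lie_automorphism \<phi>" shows "kf (\<phi> x) (\<phi> y) = kf x y"
proof -
  have s: "\<phi> (inv \<phi> x) = x" for x using automorphism_bij[OF assms(1)] by (simp add: bij_is_surj surj_f_inv_f)
  have i: "inv \<phi> (\<phi> x) = x" for x using automorphism_bij[OF assms(1)] by (simp add: bij_is_inj inv_f_f)
  have "br (\<phi> x) (br (\<phi> y) v) = \<phi> (br x (br y (inv \<phi> v)))" for v
    by (simp add: automorphism_br[OF assms] s)
  then have "kf (\<phi> x) (\<phi> y) = tr (\<lambda>v. \<phi> (br x (br y (inv \<phi> v))))" by (simp add: kf_def)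
  also have "\<dots> = tr (\<lambda>v. br x (br y (inv \<phi> (\<phi> v))))"
    by (rule tr_cyc[OF automorphism_lin[OF assms(1)]
          lin_comp[OF lin_br lin_comp[OF lin_br automorphism_lin[OF automorphism_inv[OF assms(1)]]]]])
  finally show ?thesis by (simp add: i kf_def)
qed

end

subsection \<open>Generic properties of entire families\<close>

lemma countable_zeros_entire:
  assumes "f holomorphic_on UNIV" "f z \<noteq> 0" shows "countable {s. f s = 0}"
proof (cases "f constant_on UNIV")
  case True
  then have "f s \<noteq> 0" for s using assms(2) by (auto simp: constant_on_def)
  then show ?thesis by simp
next
  case False
  have "countable {s \<in> UNIV. f s = 0}"
    by (rule holomorphic_countable_zeros[OF assms(1) _ _ _ False]) auto
  then show ?thesis by simp
qed

text \<open>Gaussian elimination without division: one row removes the column \<open>j0\<close>.\<close>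

lemma generic_injective:
  fixes a :: "complex \<Rightarrow> 'i \<Rightarrow> 'j \<Rightarrow> complex"
  assumes "finite J" "\<And>i j. i \<in> I \<Longrightarrow> j \<in> J \<Longrightarrow> (\<lambda>s. a s i j) holomorphic_on UNIV"
    "\<And>x. \<forall>i\<in>I. (\<Sum>j\<in>J. a z i j * x j) = 0 \<Longrightarrow> \<forall>j\<in>J. x j = 0"
  shows "countable {s. \<exists>x. (\<forall>i\<in>I. (\<Sum>j\<in>J. a s i j * x j) = 0) \<and> \<not> (\<forall>j\<in>J. x j = 0)}"
  using assms
proof (induction J arbitrary: a rule: finite_induct)
  case (insert j0 J)
  \<comment> \<open>A zero column at \<open>z\<close> would put the unit vector of \<open>j0\<close>
    into the kernel.\<close>
  have "\<exists>p\<in>I. a z p j0 \<noteq> 0"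
  proof (rule ccontr)
    assume "\<not> ?thesis"
    then have "\<forall>i\<in>I. (\<Sum>j\<in>insert j0 J. a z i j * (if j = j0 then 1 else 0)) = 0"
      using insert.hyps by (auto intro!: sum.neutral)
    then have "\<forall>j\<in>insert j0 J. (if j = j0 then 1 else 0 :: complex) = 0" by (rule insert.prems(2))
    then show False by simp
  qed
  then obtain p where p: "p \<in> I" "a z p j0 \<noteq> 0" by blast
  \<comment> \<open>Multiplying by the pivot instead of dividing keeps the entries entire; the price
    is to exclude the countably many zeros of the pivot.\<close>
  define b where "b s i j = a s p j0 * a s i j - a s i j0 * a s p j" for s i j
  have sum_b: "(\<Sum>j\<in>J. b s i j * x j) = a s p j0 * (\<Sum>j\<in>J. a s i j * x j) - a s i j0 * (\<Sum>j\<in>J. a s p j * x j)" for s i x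
    by (simp add: b_def left_diff_distrib sum_subtractf sum_distrib_left mult.assoc)
  have "countable {s. \<exists>x. (\<forall>i\<in>I. (\<Sum>j\<in>J. b s i j * x j) = 0) \<and> \<not> (\<forall>j\<in>J. x j = 0)}"
  proof (rule insert.IH)
    show "(\<lambda>s. b s i j) holomorphic_on UNIV" if "i \<in> I" "j \<in> J" for i j
      unfolding b_def using insert.prems(1) that p(1) by (intro holomorphic_intros) auto
    fix x assume x: "\<forall>i\<in>I. (\<Sum>j\<in>J. b z i j * x j) = 0"
    \<comment> \<open>The pivot row is solved for the removed unknown, which extends
      \<open>x\<close> to a kernel vector of the original system.\<close>
    define y where "y j = (if j = j0 then - (\<Sum>j\<in>J. a z p j * x j) / a z p j0 else x j)" for j
    have yJ: "(\<Sum>j\<in>J. a z i j * y j) = (\<Sum>j\<in>J. a z i j * x j)" for i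
      using insert.hyps by (intro sum.cong) (auto simp: y_def)
    have "\<forall>i\<in>I. (\<Sum>j\<in>insert j0 J. a z i j * y j) = 0"
    proof
      fix i assume "i \<in> I"
      then have "a z p j0 * (\<Sum>j\<in>J. a z i j * x j) = a z i j0 * (\<Sum>j\<in>J. a z p j * x j)"
        using x sum_b[of z i x] by auto
      then show "(\<Sum>j\<in>insert j0 J. a z i j * y j) = 0"
        using insert.hyps p(2) by (simp add: yJ) (simp add: y_def field_simps)
    qed
    then have "\<forall>j\<in>insert j0 J. y j = 0" by (rule insert.prems(2))
    then show "\<forall>j\<in>J. x j = 0" using insert.hyps unfolding y_def by (metis insertCI)
  qed
  moreover have "countable {s. a s p j0 = 0}"
    by (rule countable_zeros_entire[of _ z]) (use insert.prems(1) p in auto)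
  ultimately have "countable ({s. a s p j0 = 0} \<union>
      {s. \<exists>x. (\<forall>i\<in>I. (\<Sum>j\<in>J. b s i j * x j) = 0) \<and> \<not> (\<forall>j\<in>J. x j = 0)})" by simp
  moreover have "a s p j0 = 0"
    if ex: "\<exists>x. (\<forall>i\<in>I. (\<Sum>j\<in>insert j0 J. a s i j * x j) = 0) \<and> \<not> (\<forall>j\<in>insert j0 J. x j = 0)"
      and nb: "\<nexists>x. (\<forall>i\<in>I. (\<Sum>j\<in>J. b s i j * x j) = 0) \<and> \<not> (\<forall>j\<in>J. x j = 0)" for s
  proof -
    obtain x j where x: "\<forall>i\<in>I. (\<Sum>j\<in>insert j0 J. a s i j * x j) = 0" and j: "j \<in> insert j0 J" "x j \<noteq> 0"
      using ex by blast
    have e: "(\<Sum>j\<in>J. a s i j * x j) = - (a s i j0 * x j0)" if "i \<in> I" for i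
      using x \<open>i \<in> I\<close> insert.hyps by (simp add: add_eq_0_iff)
    have "\<forall>i\<in>I. (\<Sum>j\<in>J. b s i j * x j) = 0" using e p(1) by (simp add: sum_b)
    then have x0: "\<forall>j\<in>J. x j = 0" using nb by blast
    then have "x j0 \<noteq> 0" using j by auto
    moreover have "a s p j0 * x j0 = 0" using e[OF p(1)] x0 by simp
    ultimately show ?thesis by simp
  qed
  ultimately show ?case by (elim countable_subset[rotated]) blast
qed simp

section \<open>Entire families of vectors and linear maps\<close>

context fd_space
begin

definition ent :: "(complex \<Rightarrow> 'g) \<Rightarrow> bool" where
  "ent w \<longleftrightarrow> (\<forall>b\<in>Bas. (\<lambda>s. co b (w s)) holomorphic_on UNIV)"

definition entop :: "(complex \<Rightarrow> 'g \<Rightarrow> 'g) \<Rightarrow> bool" where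
  "entop F \<longleftrightarrow> (\<forall>s. lin (F s)) \<and> (\<forall>v. ent (\<lambda>s. F s v))"

lemma entD: "ent w \<Longrightarrow> b \<in> Bas \<Longrightarrow> (\<lambda>s. co b (w s)) holomorphic_on UNIV"
  by (simp add: ent_def)

lemma ent_const: "ent (\<lambda>s. v)"
  by (simp add: ent_def)

lemma ent_add: "ent v \<Longrightarrow> ent w \<Longrightarrow> ent (\<lambda>s. v s + w s)"
  by (auto simp: ent_def co_add intro!: holomorphic_intros)

lemma ent_diff: "ent v \<Longrightarrow> ent w \<Longrightarrow> ent (\<lambda>s. v s - w s)"
  by (auto simp: ent_def co_diff intro!: holomorphic_intros)

lemma ent_scale: "f holomorphic_on UNIV \<Longrightarrow> ent w \<Longrightarrow> ent (\<lambda>s. f s *s w s)"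
  by (auto simp: ent_def co_scale intro!: holomorphic_intros)

lemma ent_sum: "(\<And>i. i \<in> I \<Longrightarrow> ent (w i)) \<Longrightarrow> ent (\<lambda>s. \<Sum>i\<in>I. w i s)"
  by (auto simp: ent_def co_sum intro!: holomorphic_intros)

lemma entop_lin: "lin F \<Longrightarrow> entop (\<lambda>s. F)"
  by (simp add: entop_def ent_const)

lemma ent_entop: assumes "entop F" "ent w" shows "ent (\<lambda>s. F s (w s))"
proof -
  have "F s (w s) = (\<Sum>b\<in>Bas. co b (w s) *s F s b)" for s
    using assms(1) lin_expand by (auto simp: entop_def)
  moreover have "ent (\<lambda>s. \<Sum>b\<in>Bas. co b (w s) *s F s b)"
    using assms by (intro ent_sum ent_scale) (auto simp: entop_def entD)
  ultimately show ?thesis by simp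
qed

lemma entop_comp: "entop F \<Longrightarrow> entop G \<Longrightarrow> entop (\<lambda>s v. F s (G s v))"
  using ent_entop[of F "\<lambda>s. G s _"] by (auto simp: entop_def intro: lin_comp)

lemma entop_funpow: "entop F \<Longrightarrow> entop (\<lambda>s. F s ^^ k)"
proof (induction k)
  case 0
  have "entop (\<lambda>s. id)" by (rule entop_lin[OF lin_id(2)])
  then show ?case by (simp add: funpow_0 id_def)
next
  case (Suc k)
  then show ?case using entop_comp[of F "\<lambda>s. F s ^^ k"] by (simp add: comp_def)
qed

lemma entop_add: "entop F \<Longrightarrow> entop G \<Longrightarrow> entop (\<lambda>s v. F s v + G s v)"
  by (auto simp: entop_def intro: lin_plus ent_add)

lemma entop_diff: "entop F \<Longrightarrow> entop G \<Longrightarrow> entop (\<lambda>s v. F s v - G s v)"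
  by (auto simp: entop_def intro: lin_minus_fun ent_diff)

lemma entop_scale: "f holomorphic_on UNIV \<Longrightarrow> entop F \<Longrightarrow> entop (\<lambda>s v. f s *s F s v)"
  by (auto simp: entop_def intro: lin_scaled ent_scale)

lemma entop_sum: "(\<And>i. i \<in> I \<Longrightarrow> entop (F i)) \<Longrightarrow> entop (\<lambda>s v. \<Sum>i\<in>I. F i s v)"
  by (auto simp: entop_def intro: lin_Sum ent_sum)

lemma tr_holomorphic: "entop F \<Longrightarrow> (\<lambda>s. tr (F s)) holomorphic_on UNIV"
  unfolding tr_def by (intro holomorphic_intros) (auto simp: entop_def entD)

lemma ent_zero:
  assumes "ent w" "uncountable {s. w s = 0}" shows "w s = 0"
proof (rule co_eq_0, rule ccontr)
  fix b assume b: "b \<in> Bas" "co b (w s) \<noteq> 0"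
  have "countable {s. co b (w s) = 0}" by (rule countable_zeros_entire[OF entD[OF assms(1) b(1)] b(2)])
  moreover have "{s. w s = 0} \<subseteq> {s. co b (w s) = 0}" by (auto simp: co_0)
  ultimately show False using assms(2) countable_subset by blast
qed

end

context fd_lie
begin

subsection \<open>Existence of Cartan subalgebras\<close>

text \<open>The candidate is a generalized null space \<open>E\<close> of some \<open>br z\<close>
  in \<open>L\<close>, of least dimension. It is self-normalizing because [z, x] in \<open>E\<close>
  forces x into \<open>E\<close>. Nilpotency follows from Engel's theorem once each \<open>x\<close>
  in \<open>E\<close> acts nilpotently on \<open>E\<close>; this is transported along the line from
  \<open>z\<close> to \<open>x\<close>.\<close>

lemma exists_cartan_subalgebra:
  assumes L: "lie_subalgebra L" shows "\<exists>C. cartan_subalgebra L C"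
proof -
  have sL: "subspace L" and brL: "\<And>x y. x \<in> L \<Longrightarrow> y \<in> L \<Longrightarrow> br x y \<in> L"
    using L by (auto simp: lie_subalgebra_def)
  define N where "N z = L \<inter> gen (br z) 0" for z
  have sN: "subspace (N z)" for z unfolding N_def by (intro subspace_inter sL subspace_gen lin_br)
  obtain z where z: "z \<in> L" "\<And>y. y \<in> L \<Longrightarrow> dim (N z) \<le> dim (N y)"
    using ex_has_least_nat[of "\<lambda>z. z \<in> L" 0 "\<lambda>z. dim (N z)"] subspace_0[OF sL] by blast
  define E where "E = N z"
  have sE: "subspace E" and EL: "E \<subseteq> L" using sN by (auto simp: E_def N_def)
  have brE: "br x y \<in> E" if "x \<in> E" "y \<in> E" for x y
    using gen_ad_br[of x z 0 y 0] that brL by (auto simp: E_def N_def)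
  have zE: "z \<in> E" using z(1) by (auto simp: E_def N_def gen_def shift_zero br_self intro!: exI[of _ 1])
  have ret: "v \<in> E" if "v \<in> L" "br z v \<in> E" for v
    using gen_shift_back[of "br z" 0 v] that by (auto simp: E_def N_def lin_br shift_zero)
  have nil: "\<exists>k. (br x ^^ k) v = 0" if x: "x \<in> E" and v: "v \<in> E" for x v
  proof -
    \<comment> \<open>The line runs from \<open>z\<close> at t = 0 to \<open>x\<close> at t = 1. For
      most t the null space of \<open>A t\<close> in \<open>L\<close> lies in \<open>E\<close>,
      hence equals \<open>E\<close> by minimality, so \<open>A t\<close> is nilpotent on
      \<open>E\<close>; the identity principle carries this to t = 1.\<close>
    define A where "A t = br (z + t *s (x - z))" for t
    have A_eq: "A t = (\<lambda>w. br z w + t *s br (x - z) w)" for t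
      by (rule ext) (simp add: A_def br_add_left br_scale_left)
    have entA: "entop A"
      unfolding A_eq[abs_def] by (intro entop_add entop_lin entop_scale lin_br holomorphic_intros)
    have tE: "z + t *s (x - z) \<in> E" for t
      using zE x sE by (intro subspace_add subspace_scale subspace_diff)
    have AE: "A t ` E \<subseteq> E" and AL: "A t ` L \<subseteq> L" for t
      unfolding A_def using brE[OF tE] brL[OF subsetD[OF EL tE]] by blast+
    obtain P where P: "lin P" "\<And>v. P v \<in> E" "\<And>v. v \<in> E \<Longrightarrow> P v = v" using exists_projection[OF sE] by blast
    define M where "M = L \<inter> {v. P v = 0}"
    obtain V where V: "V \<subseteq> M" "independent V" "M \<subseteq> span V" by (rule basis_exists[of M])
    have fV: "finite V" by (rule finiteI_independent[OF V(2)])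
    have sM: "subspace M" unfolding M_def by (intro subspace_inter sL subspace_kernel_lin P)
    have spanM: "span V \<subseteq> M" by (rule span_minimal[OF V(1) sM])
    \<comment> \<open>Matrix of \<open>A t\<close> on the complement \<open>M\<close> of
      \<open>E\<close> in \<open>L\<close>, read modulo \<open>E\<close> through the projection
      \<open>P\<close>. At t = 0 it is injective by \<open>ret\<close>.\<close>
    define a where "a t b v = co b (A t v - P (A t v))" for t b v
    have entQ: "entop (\<lambda>t w. A t w - P (A t w))"
      by (intro entop_diff entA entop_comp[OF entop_lin[OF P(1)]])
    have a_hol: "(\<lambda>t. a t b v) holomorphic_on UNIV" if "b \<in> Bas" for b v
      unfolding a_def using entQ that by (auto simp: entop_def entD)
    have a_sum: "(\<Sum>v\<in>V. a t b v * u v) = co b (A t (\<Sum>v\<in>V. u v *s v) - P (A t (\<Sum>v\<in>V. u v *s v)))" for t b u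
    proof -
      have l: "lin (\<lambda>w. A t w - P (A t w))" using entQ by (simp add: entop_def)
      show ?thesis by (subst lin_sum[OF l]) (simp add: co_sum lin_scale[OF l] co_scale a_def mult.commute)
    qed
    have a_kernel: "A t (\<Sum>v\<in>V. u v *s v) \<in> E" if k: "\<forall>b\<in>Bas. (\<Sum>v\<in>V. a t b v * u v) = 0" for t u
    proof -
      let ?w = "A t (\<Sum>v\<in>V. u v *s v)"
      have "?w - P ?w = 0" by (rule co_eq_0) (use k a_sum in auto)
      then have "?w = P ?w" by simp
      then show ?thesis using P(2)[of ?w] by simp
    qed
    have inM: "(\<Sum>v\<in>V. u v *s v) \<in> M" for u
      using V(1) by (intro subspace_sum[OF sM] subspace_scale[OF sM]) auto
    have "countable {t. \<exists>u. (\<forall>b\<in>Bas. (\<Sum>v\<in>V. a t b v * u v) = 0) \<and> \<not> (\<forall>v\<in>V. u v = 0)}" (is "countable ?bad")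
    proof (rule generic_injective[where z = 0, OF fV a_hol])
      fix u assume "\<forall>b\<in>Bas. (\<Sum>v\<in>V. a 0 b v * u v) = 0"
      then have "A 0 (\<Sum>v\<in>V. u v *s v) \<in> E" by (rule a_kernel)
      then have "br z (\<Sum>v\<in>V. u v *s v) \<in> E" by (simp add: A_def)
      then have "(\<Sum>v\<in>V. u v *s v) \<in> E" using inM ret by (auto simp: M_def)
      then have "P (\<Sum>v\<in>V. u v *s v) = (\<Sum>v\<in>V. u v *s v)" by (rule P(3))
      then have "(\<Sum>v\<in>V. u v *s v) = 0" using inM[of u] by (simp add: M_def)
      then show "\<forall>v\<in>V. u v = 0" using V(2) fV independent_explicit_finite_subsets by blast
    qed
    have good: "\<exists>k. \<forall>v\<in>E. (A t ^^ k) v = 0" if t: "t \<notin> ?bad" for t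
    proof -
      have step: "w \<in> E" if w: "w \<in> L" "A t w \<in> E" for w
      proof -
        have "w - P w \<in> M"
          using w P EL sL by (auto simp: M_def lin_diff intro!: subspace_diff)
        moreover have "A t (w - P w) \<in> E"
        proof -
          have "A t (P w) \<in> E" using AE P(2) by blast
          then show ?thesis using w(2) sE by (simp add: A_def br_diff_right subspace_diff)
        qed
        moreover obtain u where u: "w - P w = (\<Sum>v\<in>V. u v *s v)"
          using \<open>w - P w \<in> M\<close> V(3) span_finite[OF fV] by auto
        ultimately have "A t (\<Sum>v\<in>V. u v *s v) \<in> E" by simp
        then have "\<forall>b\<in>Bas. (\<Sum>v\<in>V. a t b v * u v) = 0" using P(3) a_sum by (simp add: co_0)
        then have "\<forall>v\<in>V. u v = 0" using t by blast
        then have "w = P w" using u by simp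
        then show ?thesis using P(2)[of w] by simp
      qed
      have "N (z + t *s (x - z)) \<subseteq> E"
      proof
        fix w assume "w \<in> N (z + t *s (x - z))"
        then obtain k where "(A t ^^ k) w = 0" "w \<in> L" by (auto simp: N_def gen_def shift_zero A_def)
        then have "(A t ^^ k) w \<in> E" using subspace_0[OF sE] by simp
        then show "w \<in> E" using \<open>w \<in> L\<close>
        proof (induction k arbitrary: w)
          case (Suc k)
          have "(A t ^^ k) (A t w) \<in> E" using Suc.prems(1) by (simp add: funpow_swap1)
          then have "A t w \<in> E" using Suc.IH AL Suc.prems(2) by blast
          then show ?case using step Suc.prems(2) by blast
        qed simp
      qed
      moreover have "dim E \<le> dim (N (z + t *s (x - z)))"
        unfolding E_def by (rule z(2)) (use tE EL in blast)
      ultimately have "N (z + t *s (x - z)) = E" by (rule subspace_dim_equal[OF sN sE])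
      then have "\<forall>v\<in>E. \<exists>k. (A t ^^ k) v = 0" by (auto simp: N_def gen_def shift_zero A_def)
      then show ?thesis using uniform_nilpotent[of "A t" E] sE lin_br by (auto simp: A_def)
    qed
    \<comment> \<open>Countably many exponents serve an uncountable set of parameters, so a single
      exponent serves uncountably many.\<close>
    have "\<exists>k. uncountable {t. \<forall>v\<in>E. (A t ^^ k) v = 0}"
    proof (rule ccontr)
      assume "\<not> ?thesis"
      then have "countable (?bad \<union> (\<Union>k. {t. \<forall>v\<in>E. (A t ^^ k) v = 0}))"
        using \<open>countable ?bad\<close> by (intro countable_Un countable_UN) auto
      moreover have "?bad \<union> (\<Union>k. {t. \<forall>v\<in>E. (A t ^^ k) v = 0}) = UNIV" using good by blast
      ultimately have "countable (UNIV :: complex set)" by (simp only:)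
      then show False using uncountable_UNIV_complex by simp
    qed
    then obtain k where k: "uncountable {t. \<forall>v\<in>E. (A t ^^ k) v = 0}" by blast
    have "(A 1 ^^ k) v = 0"
    proof (rule ent_zero[of "\<lambda>t. (A t ^^ k) v"])
      show "ent (\<lambda>t. (A t ^^ k) v)" using entop_funpow[OF entA] by (simp add: entop_def)
      have "{t. \<forall>v\<in>E. (A t ^^ k) v = 0} \<subseteq> {t. (A t ^^ k) v = 0}" using v by blast
      then show "uncountable {t. (A t ^^ k) v = 0}" using k countable_subset by blast
    qed
    then show ?thesis by (auto simp: A_def)
  qed
  have "closed_set E" using subspace_0[OF sE] brE by (auto simp: closed_set_def)
  moreover have "nil_rep E br E {0}"
    by (rule nil_repI) (use sE brE nil in \<open>auto simp: lin_br br_add_left br_scale_left br_br subspace_0\<close>)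
  ultimately obtain d where d: "\<And>xs v. set xs \<subseteq> E \<Longrightarrow> length xs = d \<Longrightarrow> v \<in> E \<Longrightarrow> foldr br xs v = 0"
    using engel_strong[of E br E "{0}"] by auto
  \<comment> \<open>The terms of the lower central series lie in spans of iterated brackets, so the
    length \<open>d\<close> from Engel's theorem bounds the nilpotency class.\<close>
  have lower: "((\<lambda>X. br_span E X) ^^ k) E \<subseteq> span {foldr br xs v | xs v. set xs \<subseteq> E \<and> length xs = k \<and> v \<in> E}" for k
  proof (induction k)
    case 0
    show ?case using span_superset[of E] by (auto intro!: span_base)
  next
    case (Suc k)
    let ?S = "\<lambda>k. {foldr br xs v | xs v. set xs \<subseteq> E \<and> length xs = k \<and> v \<in> E}"
    have "br x y \<in> span (?S (Suc k))" if x: "x \<in> E" and y: "y \<in> span (?S k)" for x y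
    proof -
      have "?S k \<subseteq> {y. br x y \<in> span (?S (Suc k))}"
      proof safe
        fix xs v assume "set xs \<subseteq> E" "k = length xs" "v \<in> E"
        then have "br x (foldr br xs v) \<in> ?S (Suc (length xs))" using x by (intro CollectI exI[of _ "x # xs"] exI[of _ v]) auto
        then show "br x (foldr br xs v) \<in> span (?S (Suc (length xs)))" by (rule span_base)
      qed
      then have "span (?S k) \<subseteq> {y. br x y \<in> span (?S (Suc k))}"
        by (rule span_minimal[OF _ subspace_preimage[OF lin_br subspace_span]])
      then show ?thesis using y by blast
    qed
    then have "{br x y | x y. x \<in> E \<and> y \<in> ((\<lambda>X. br_span E X) ^^ k) E} \<subseteq> span (?S (Suc k))"
      using Suc by blast
    then show ?case unfolding funpow.simps o_apply br_span_def[of E] by (rule span_minimal[OF _ subspace_span])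
  qed
  have "{foldr br xs v | xs v. set xs \<subseteq> E \<and> length xs = d \<and> v \<in> E} \<subseteq> {0}" using d by auto
  then have "((\<lambda>X. br_span E X) ^^ d) E \<subseteq> span {0}"
    by (rule subset_trans[OF lower span_mono])
  then have "((\<lambda>X. br_span E X) ^^ d) E \<subseteq> {0}" by simp
  moreover have "0 \<in> ((\<lambda>X. br_span E X) ^^ k) E" for k
    by (cases k) (auto simp: subspace_0[OF sE] br_span_def span_zero)
  ultimately have "lie_nilpotent E" unfolding lie_nilpotent_def by blast
  moreover have "{x \<in> L. \<forall>y\<in>E. br x y \<in> E} = E"
  proof (intro equalityI subsetI)
    fix x assume "x \<in> {x \<in> L. \<forall>y\<in>E. br x y \<in> E}"
    then have "x \<in> L" "br z x \<in> E" using zE br_anti[of z x] subspace_neg[OF sE] by auto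
    then show "x \<in> E" by (rule ret)
  qed (use EL brE in auto)
  ultimately have "cartan_subalgebra L E"
    unfolding cartan_subalgebra_def lie_subalgebra_def using sE brE EL by blast
  then show ?thesis by blast
qed

end

section \<open>Exponential sums and dimension counts\<close>

lemma exponential_sums_independent:
  fixes m :: "complex \<Rightarrow> complex"
  assumes "finite A" "\<And>k::nat. (\<Sum>a\<in>A. a ^ k * m a) = 0" "a \<in> A" shows "m a = 0"
proof -
  have p: "(\<Sum>a\<in>A. poly p a * m a) = 0" for p
  proof -
    have "(\<Sum>a\<in>A. poly p a * m a) = (\<Sum>a\<in>A. \<Sum>i\<le>degree p. coeff p i * (a ^ i * m a))"
      by (simp add: poly_altdef sum_distrib_right mult.assoc)
    also have "\<dots> = (\<Sum>i\<le>degree p. coeff p i * (\<Sum>a\<in>A. a ^ i * m a))"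
      by (subst sum.swap) (simp add: sum_distrib_left)
    finally show ?thesis using assms(2) by simp
  qed
  \<comment> \<open>Up to scaling the Lagrange interpolation polynomial at \<open>a\<close>: it
    singles out one summand.\<close>
  define q where "q = (\<Prod>b\<in>A - {a}. [:- b, 1:])"
  have q0: "poly q b = 0" if "b \<in> A" "b \<noteq> a" for b
    unfolding q_def poly_prod using assms(1) that by (subst prod_zero_iff) auto
  have qa: "poly q a \<noteq> 0"
    unfolding q_def poly_prod using assms(1) by (subst prod_zero_iff) auto
  have "(\<Sum>b\<in>A. poly q b * m b) = poly q a * m a"
    using assms(1,3) q0 by (subst sum.remove[of _ a]) (auto intro!: sum.neutral)
  then show ?thesis using p[of q] qa by simp
qed

context fd_space
begin

lemma dim_complement_le:
  assumes "subspace S" "subspace T" "S \<inter> T \<subseteq> {0}" shows "dim S + dim T \<le> dimension"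
proof -
  have "S \<inter> T = {0}" using assms(3) subspace_0[OF assms(1)] subspace_0[OF assms(2)] by blast
  then have "dim {x + y |x y. x \<in> S \<and> y \<in> T} = dim S + dim T" using dim_sums_Int[OF assms(1,2)] by simp
  moreover have "dim {x + y |x y. x \<in> S \<and> y \<in> T} \<le> dimension" by (rule dim_subset_UNIV)
  ultimately show ?thesis by simp
qed

lemma dim_kernel_complement:
  assumes F: "lin F"
  shows "\<exists>M. subspace M \<and> (\<forall>v\<in>M. F v = 0 \<longrightarrow> v = 0) \<and> dim {v. F v = 0} + dim M = dimension"
proof -
  let ?K = "{v. F v = 0}"
  have sK: "subspace ?K" by (rule subspace_kernel_lin[OF F])
  obtain P where P: "lin P" "\<And>v. P v \<in> ?K" "\<And>v. v \<in> ?K \<Longrightarrow> P v = v" using exists_projection[OF sK] by blast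
  let ?M = "{v. P v = 0}"
  have sM: "subspace ?M" by (rule subspace_kernel_lin[OF P(1)])
  have inj: "v = 0" if "v \<in> ?M" "F v = 0" for v using that P(3)[of v] by simp
  then have "?K \<inter> ?M = {0}" using lin_0[OF F] lin_0[OF P(1)] by auto
  then have "dim {x + y |x y. x \<in> ?K \<and> y \<in> ?M} = dim ?K + dim ?M" using dim_sums_Int[OF sK sM] by simp
  moreover have "{x + y |x y. x \<in> ?K \<and> y \<in> ?M} = UNIV"
  proof -
    have "v \<in> {x + y |x y. x \<in> ?K \<and> y \<in> ?M}" for v
    proof -
      have "P (v - P v) = 0" using lin_diff[OF P(1)] P(3)[OF P(2)] by simp
      then show ?thesis using P(2)[of v] by (intro CollectI exI[of _ "P v"] exI[of _ "v - P v"]) auto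
    qed
    then show ?thesis by blast
  qed
  ultimately have "dim ?K + dim ?M = dimension" using dim_UNIV by (simp add: dimension_def)
  then show ?thesis using sM inj by blast
qed

lemma dim_range_le:
  assumes F: "lin F" shows "dimension \<le> dim {v. F v = 0} + dim (range F)"
proof -
  obtain M where M: "subspace M" "\<And>v. v \<in> M \<Longrightarrow> F v = 0 \<Longrightarrow> v = 0" "dim {v. F v = 0} + dim M = dimension"
    using dim_kernel_complement[OF F] by blast
  have "inj_on F (span M)"
  proof (rule inj_onI)
    fix x y assume xy: "x \<in> span M" "y \<in> span M" "F x = F y"
    then have "x - y \<in> M" using span_diff[OF xy(1,2)] span_eq_iff[THEN iffD2, OF M(1)] by simp
    moreover have "F (x - y) = 0" using lin_diff[OF F] xy by simp
    ultimately have "x - y = 0" by (rule M(2))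
    then show "x = y" by simp
  qed
  then have "dim (F ` M) = dim M" 
    using self_pair.dim_image_eq[OF F[unfolded lin_iff_linear], of M] by blast
  moreover have "dim (F ` M) \<le> dim (range F)" by (rule dim_subset) blast
  ultimately show ?thesis using M(3) by simp
qed

end

context fd_lie
begin

subsection \<open>The generic dimension of fixed point subalgebras\<close>

text \<open>The functionals vanish on the range of \<phi> - 1 and separate the span of
  \<open>V\<close>, so these subspaces meet only in 0. Hence \<open>card V\<close> is at most the
  codimension of the range, which is at most the dimension of the kernel.\<close>

lemma fixed_dim_ge:
  assumes \<Phi>: "lie_automorphism \<phi>" and V: "finite V" "independent V"
    and ind: "\<And>u. \<forall>k::nat. (\<Sum>v\<in>V. tr (\<lambda>w. (\<phi> ^^ k) (br v w)) * u v) = 0 \<Longrightarrow> \<forall>v\<in>V. u v = 0"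
  shows "card V \<le> dim {v. \<phi> v = v}"
proof -
  let ?F = "\<lambda>v. \<phi> v - v"
  have lin\<phi>: "lin \<phi>" by (rule automorphism_lin[OF \<Phi>])
  have linF: "lin ?F" by (intro lin_minus_fun lin\<phi> lin_id)
  have t: "tr (\<lambda>w. (\<phi> ^^ k) (br (?F x) w)) = 0" for k x
  proof -
    have "(\<phi> ^^ k) (\<phi> v) = \<phi> ((\<phi> ^^ k) v)" for v by (rule funpow_comm) simp
    then have "tr (\<lambda>w. (\<phi> ^^ k) (br (\<phi> x) w)) = tr (\<lambda>w. (\<phi> ^^ k) (br x w))"
      by (rule tr_automorphism[OF \<Phi> lin_funpow[OF lin\<phi>]])
    then show ?thesis by (simp add: br_diff_left lin_diff[OF lin_funpow[OF lin\<phi>]] tr_diff)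
  qed
  have "range ?F \<inter> span V \<subseteq> {0}"
  proof
    fix w assume w: "w \<in> range ?F \<inter> span V"
    then obtain x where x: "w = ?F x" by blast
    obtain u where u: "w = (\<Sum>v\<in>V. u v *s v)" using w span_finite[OF V(1)] by auto
    have "(\<Sum>v\<in>V. tr (\<lambda>w. (\<phi> ^^ k) (br v w)) * u v) = 0" for k
    proof -
      have "tr (\<lambda>z. (\<phi> ^^ k) (br w z)) = (\<Sum>v\<in>V. tr (\<lambda>w. (\<phi> ^^ k) (br v w)) * u v)"
        by (simp add: u lin_sum[OF lin_br_left] br_scale_left lin_sum[OF lin_funpow[OF lin\<phi>]]
            lin_scale[OF lin_funpow[OF lin\<phi>]] tr_Sum tr_scale mult.commute)
      then show ?thesis using t[of k x] x by simp
    qed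
    then have "\<forall>v\<in>V. u v = 0" using ind by blast
    then show "w \<in> {0}" using u by simp
  qed
  then have "dim (range ?F) + dim (span V) \<le> dimension"
    by (rule dim_complement_le[OF subspace_image_lin[OF linF subspace_UNIV] subspace_span])
  moreover have "dimension \<le> dim {v. ?F v = 0} + dim (range ?F)" by (rule dim_range_le[OF linF])
  ultimately show ?thesis using dim_span_eq_card_independent[OF V(2)] by simp
qed

text \<open>Outside a countable set of parameters the fixed point space is no larger than at \<open>z\<close>, and no
  smaller than the span of the \<open>\<phi>\<close>-invariant functionals \<open>y \<mapsto> tr (\<phi>\<^sup>k ad y)\<close> at \<open>z\<close>.\<close>

lemma generic_fixed_dim:
  assumes \<Phi>: "entop \<Phi>" "\<And>s. lie_automorphism (\<Phi> s)"
    and T: "subspace T" "{v. \<Phi> z v = v} \<subseteq> T"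
    and nondeg: "\<And>y. y \<in> T \<Longrightarrow> \<forall>k::nat. tr (\<lambda>v. (\<Phi> z ^^ k) (br y v)) = 0 \<Longrightarrow> y = 0"
  shows "countable {s. dim {v. \<Phi> s v = v} \<noteq> dim T}"
proof -
  obtain V where V: "V \<subseteq> T" "independent V" "T \<subseteq> span V" "card V = dim T" by (rule basis_exists[of T])
  have fV: "finite V" by (rule finiteI_independent[OF V(2)])
  have lin\<Phi>: "lin (\<Phi> s)" for s using \<Phi>(1) by (simp add: entop_def)
  define a where "a s k v = tr (\<lambda>w. (\<Phi> s ^^ k) (br v w))" for s and k :: nat and v
  \<comment> \<open>Parameters at which the trace functionals no longer separate \<open>T\<close>;
    elsewhere the fixed space is large enough.\<close>
  define bad1 where "bad1 = {s. \<exists>u. (\<forall>k\<in>UNIV. (\<Sum>v\<in>V. a s k v * u v) = 0) \<and> \<not> (\<forall>v\<in>V. u v = 0)}"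
  have "countable bad1"
    unfolding bad1_def
  proof (rule generic_injective[where z = z, OF fV])
    show "(\<lambda>s. a s k v) holomorphic_on UNIV" for k v
      unfolding a_def by (intro tr_holomorphic entop_comp[OF entop_funpow[OF \<Phi>(1)] entop_lin[OF lin_br]])
    fix u assume u: "\<forall>k\<in>UNIV. (\<Sum>v\<in>V. a z k v * u v) = 0"
    let ?y = "\<Sum>v\<in>V. u v *s v"
    have "?y \<in> T" using V(1) by (intro subspace_sum[OF T(1)] subspace_scale[OF T(1)]) auto
    moreover have "tr (\<lambda>v. (\<Phi> z ^^ k) (br ?y v)) = 0" for k
    proof -
      have "tr (\<lambda>v. (\<Phi> z ^^ k) (br ?y v)) = (\<Sum>v\<in>V. a z k v * u v)"
        by (simp add: a_def lin_sum[OF lin_br_left] br_scale_left lin_sum[OF lin_funpow[OF lin\<Phi>]]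
            lin_scale[OF lin_funpow[OF lin\<Phi>]] tr_Sum tr_scale mult.commute)
      then show ?thesis using u by simp
    qed
    ultimately have "?y = 0" using nondeg by blast
    then show "\<forall>v\<in>V. u v = 0" using V(2) fV independent_explicit_finite_subsets by blast
  qed
  have ge: "dim T \<le> dim {v. \<Phi> s v = v}" if "s \<notin> bad1" for s
    using fixed_dim_ge[OF \<Phi>(2) fV V(2), of s] that V(4) unfolding bad1_def a_def by fastforce
  define F where "F s v = \<Phi> s v - v" for s v
  have linF: "lin (F s)" for s unfolding F_def[abs_def] by (intro lin_minus_fun lin\<Phi> lin_id)
  obtain M where M: "subspace M" "\<And>v. v \<in> M \<Longrightarrow> F z v = 0 \<Longrightarrow> v = 0" "dim {v. F z v = 0} + dim M = dimension"
    using dim_kernel_complement[OF linF, of z] by blast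
  obtain B where B: "B \<subseteq> M" "independent B" "M \<subseteq> span B" "card B = dim M" by (rule basis_exists[of M])
  have fB: "finite B" by (rule finiteI_independent[OF B(2)])
  \<comment> \<open>Parameters at which \<Phi> s - 1 degenerates on a complement of its kernel at
    \<open>z\<close>; elsewhere the fixed space has not grown.\<close>
  define bad2 where "bad2 = {s. \<exists>u. (\<forall>b\<in>Bas. (\<Sum>v\<in>B. co b (F s v) * u v) = 0) \<and> \<not> (\<forall>v\<in>B. u v = 0)}"
  have sum: "(\<Sum>v\<in>B. co b (F s v) * u v) = co b (F s (\<Sum>v\<in>B. u v *s v))" for b s u
    by (simp add: lin_sum[OF linF] lin_scale[OF linF] co_sum co_scale mult.commute)
  have "countable bad2"
    unfolding bad2_def
  proof (rule generic_injective[where z = z, OF fB])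
    have "entop F" unfolding F_def[abs_def] by (intro entop_diff \<Phi>(1) entop_lin lin_id)
    then show "(\<lambda>s. co b (F s v)) holomorphic_on UNIV" if "b \<in> Bas" for b v
      using that by (simp add: entop_def entD)
    fix u assume u: "\<forall>b\<in>Bas. (\<Sum>v\<in>B. co b (F z v) * u v) = 0"
    have "F z (\<Sum>v\<in>B. u v *s v) = 0" by (rule co_eq_0) (use u sum in auto)
    moreover have "(\<Sum>v\<in>B. u v *s v) \<in> M" using B(1) by (intro subspace_sum[OF M(1)] subspace_scale[OF M(1)]) auto
    ultimately have "(\<Sum>v\<in>B. u v *s v) = 0" using M(2) by blast
    then show "\<forall>v\<in>B. u v = 0" using B(2) fB independent_explicit_finite_subsets by blast
  qed
  have le: "dim {v. \<Phi> s v = v} \<le> dim T" if s: "s \<notin> bad2" for s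
  proof -
    have "{v. F s v = 0} \<inter> M \<subseteq> {0}"
    proof
      fix w assume w: "w \<in> {v. F s v = 0} \<inter> M"
      then obtain u where u: "w = (\<Sum>v\<in>B. u v *s v)" using B(3) span_finite[OF fB] by auto
      have "\<forall>b\<in>Bas. (\<Sum>v\<in>B. co b (F s v) * u v) = 0" using w u sum by (auto simp: co_0)
      then have "\<forall>v\<in>B. u v = 0" using s unfolding bad2_def by blast
      then show "w \<in> {0}" using u by simp
    qed
    then have "dim {v. F s v = 0} + dim M \<le> dimension"
      by (rule dim_complement_le[OF subspace_kernel_lin[OF linF] M(1)])
    then have "dim {v. F s v = 0} \<le> dim {v. F z v = 0}" using M(3) by simp
    also have "\<dots> \<le> dim T" by (rule dim_subset) (use T(2) in \<open>auto simp: F_def\<close>)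
    finally show ?thesis by (simp add: F_def)
  qed
  have "countable (bad1 \<union> bad2)" using \<open>countable bad1\<close> \<open>countable bad2\<close> by simp
  moreover have "{s. dim {v. \<Phi> s v = v} \<noteq> dim T} \<subseteq> bad1 \<union> bad2" using ge le le_antisym by blast
  ultimately show ?thesis by (rule countable_subset[rotated])
qed

subsection \<open>Automorphisms attached to the weights of a nilpotent subalgebra\<close>

lemma finite_eigenvalues: assumes "lin F" shows "finite {c. gen F c \<noteq> {0}}"
proof -
  let ?X = "\<lambda>_::unit. F"
  have "compatible UNIV ?X" using assms gen_self by (auto simp: compatible_def)
  then have "finite (weights UNIV ?X)" by (rule finite_weights)
  moreover have "{c. gen F c \<noteq> {0}} \<subseteq> (\<lambda>\<kappa>. \<kappa> ()) ` weights UNIV ?X"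
  proof
    fix c assume "c \<in> {c. gen F c \<noteq> {0}}"
    then have "(\<lambda>_. c) \<in> weights UNIV ?X" by (simp add: weights_def supported_def jgen_def)
    then show "c \<in> (\<lambda>\<kappa>. \<kappa> ()) ` weights UNIV ?X" by (rule rev_image_eqI) simp
  qed
  ultimately show ?thesis using finite_surj by blast
qed

text \<open>\<open>dil T x c\<close> is \<open>exp (c ad x)\<close> with \<open>ad x\<close> replaced by its semisimple part.\<close>

definition dil :: "'g set \<Rightarrow> 'g \<Rightarrow> complex \<Rightarrow> 'g \<Rightarrow> 'g" where
  "dil T x c v = (\<Sum>\<kappa>\<in>wt T. exp (c * \<kappa> x) *s prw T \<kappa> v)"

context
  fixes T
  assumes T: "nilp_alg T"
begin

lemma lin_dil: "lin (dil T x c)"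
  unfolding dil_def[abs_def] by (intro lin_Sum lin_scaled lin_pr[OF ds[OF T]])

lemma dil_gs: assumes "v \<in> gs T \<kappa>" "\<kappa> \<in> supported T" shows "dil T x c v = exp (c * \<kappa> x) *s v"
proof (cases "\<kappa> \<in> wt T")
  case True
  have "dil T x c v = (\<Sum>\<mu>\<in>wt T. if \<mu> = \<kappa> then exp (c * \<mu> x) *s v else 0)"
    unfolding dil_def by (intro sum.cong refl) (simp add: pr_mem[OF ds[OF T] assms(1) True])
  then show ?thesis using True finite_wt[OF T] by simp
next
  case False
  then have "v = 0" using gs_empty[OF T assms(2)] assms(1) by blast
  then show ?thesis using lin_0[OF lin_dil] by simp
qed

lemma dil_T: "t \<in> T \<Longrightarrow> dil T x c t = t"
  using dil_gs[OF _ zero_supported, of t] T_in_gs0[OF T] by auto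

lemma dil_dil: "dil T x c (dil T x d v) = dil T x (c + d) v"
proof (rule dsum_induct[OF ds[OF T] lin_comp[OF lin_dil lin_dil] lin_dil])
  fix \<kappa> v assume "\<kappa> \<in> wt T" "v \<in> gs T \<kappa>"
  then show "dil T x c (dil T x d v) = dil T x (c + d) v"
    using wt_supported[OF T] by (simp add: dil_gs lin_scale[OF lin_dil] ring_distribs exp_add mult.commute)
qed

lemma dil_0: "dil T x 0 v = v"
  by (simp add: dil_def pr_sum[OF ds[OF T]])

lemma dil_br: "dil T x c (br v w) = br (dil T x c v) (dil T x c w)"
proof (rule dsum_induct[OF ds[OF T], of "\<lambda>v. dil T x c (br v w)" "\<lambda>v. br (dil T x c v) (dil T x c w)"])
  show "lin (\<lambda>v. dil T x c (br v w))" by (rule lin_comp[OF lin_dil lin_br_left])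
  show "lin (\<lambda>v. br (dil T x c v) (dil T x c w))" by (rule lin_comp[OF lin_br_left lin_dil])
  fix \<kappa> v assume k: "\<kappa> \<in> wt T" "v \<in> gs T \<kappa>"
  show "dil T x c (br v w) = br (dil T x c v) (dil T x c w)"
  proof (rule dsum_induct[OF ds[OF T], of "\<lambda>w. dil T x c (br v w)" "\<lambda>w. br (dil T x c v) (dil T x c w)"])
    show "lin (\<lambda>w. dil T x c (br v w))" by (rule lin_comp[OF lin_dil lin_br])
    show "lin (\<lambda>w. br (dil T x c v) (dil T x c w))" by (rule lin_comp[OF lin_br lin_dil])
    fix \<mu> w assume m: "\<mu> \<in> wt T" "w \<in> gs T \<mu>"
    note sup = wt_supported[OF T k(1)] wt_supported[OF T m(1)]
    have "dil T x c (br v w) = exp (c * (\<kappa> + \<mu>) x) *s br v w"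
      by (rule dil_gs[OF gs_br[OF k(2) m(2)] supported_add[OF sup]])
    then show "dil T x c (br v w) = br (dil T x c v) (dil T x c w)"
      using sup k m by (simp add: dil_gs br_scale_left br_scale_right distrib_left exp_add)
  qed
qed

lemma dil_automorphism: "lie_automorphism (dil T x c)"
proof (rule automorphismI[OF lin_dil _ dil_br])
  show "bij (dil T x c)"
    by (rule o_bij[of "dil T x (- c)"]) (simp_all add: fun_eq_iff dil_dil dil_0)
qed

lemma entop_dil: "g holomorphic_on UNIV \<Longrightarrow> entop (\<lambda>s. dil T x (g s))"
  unfolding dil_def[abs_def]
  by (intro entop_sum entop_scale holomorphic_intros entop_lin lin_pr[OF ds[OF T]])

text \<open>The twist multiplies eigenvalues on the weight space of \<kappa> by exp(\<kappa>(x)),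
  and the products for different weights are to stay apart. A point separating the weights is scaled
  by \<open>u\<close>; each coincidence is then an equation in \<open>u\<close> with countably many
  solutions.\<close>

lemma generic_separation:
  assumes "finite S" "0 \<notin> S"
  obtains x where "x \<in> T" "\<And>a b \<kappa> \<mu>. a \<in> S \<Longrightarrow> b \<in> S \<Longrightarrow> \<kappa> \<in> insert 0 (wt T) \<Longrightarrow> \<mu> \<in> insert 0 (wt T) \<Longrightarrow> \<kappa> \<noteq> \<mu> \<Longrightarrow>
    a * exp (\<kappa> x) \<noteq> b * exp (\<mu> x)"
proof -
  define \<Lambda> where "\<Lambda> = insert 0 (wt T)"
  have fin: "finite \<Lambda>" using finite_wt[OF T] by (simp add: \<Lambda>_def)
  have dual: "\<kappa> \<in> dual_space T" if "\<kappa> \<in> \<Lambda>" for \<kappa>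
    using that weight_linear[OF T] by (auto simp: \<Lambda>_def dual_space_def)
  define F where "F = (\<lambda>(\<kappa>, \<mu>). \<kappa> - \<mu>) ` {(\<kappa>, \<mu>) \<in> \<Lambda> \<times> \<Lambda>. \<kappa> \<noteq> \<mu>}"
  have "\<exists>x\<in>T. \<forall>f\<in>F. f x \<noteq> 0"
  proof (rule avoid_hyperplanes[OF subspace_T[OF T]])
    show "finite F" unfolding F_def
      by (rule finite_imageI, rule finite_subset[OF _ finite_cartesian_product[OF fin fin]]) auto
    show "f \<in> dual_space T" if "f \<in> F" for f using that dual subspace_dual_space(2) by (auto simp: F_def)
    show "f \<noteq> 0" if "f \<in> F" for f using that by (auto simp: F_def)
  qed
  then obtain x0 where x0: "x0 \<in> T" "\<And>f. f \<in> F \<Longrightarrow> f x0 \<noteq> 0" by blast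
  have sep: "\<kappa> x0 \<noteq> \<mu> x0" if km: "\<kappa> \<in> \<Lambda>" "\<mu> \<in> \<Lambda>" "\<kappa> \<noteq> \<mu>" for \<kappa> \<mu>
  proof -
    have "\<kappa> - \<mu> \<in> F" using km by (auto simp: F_def)
    from x0(2)[OF this] show ?thesis by simp
  qed
  have cnt: "countable {u. a * exp (u * \<kappa> x0) - b * exp (u * \<mu> x0) = 0}"
    if "a \<in> S" "b \<in> S" "\<kappa> \<in> \<Lambda>" "\<mu> \<in> \<Lambda>" "\<kappa> \<noteq> \<mu>" for a b \<kappa> \<mu>
  proof -
    let ?f = "\<lambda>u. a * exp (u * \<kappa> x0) - b * exp (u * \<mu> x0)"
    have "\<exists>u. ?f u \<noteq> 0"
    proof (rule ccontr)
      assume n: "\<not> ?thesis"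
      then have "?f 0 = 0" by blast
      then have ab: "a = b" by simp
      \<comment> \<open>At this \<open>u\<close> the two exponents differ by 1, so equality would
        give e = 1.\<close>
      let ?u = "1 / (\<kappa> x0 - \<mu> x0)"
      have "?f ?u = 0" using n by blast
      then have "exp (?u * \<kappa> x0) = exp (?u * \<mu> x0)" using ab that(1) assms(2) by auto
      then have "exp (?u * \<kappa> x0 - ?u * \<mu> x0) = 1" by (simp add: exp_diff)
      moreover have "?u * \<kappa> x0 - ?u * \<mu> x0 = 1"
        using sep[OF that(3-5)] by (simp add: diff_divide_distrib[symmetric])
      ultimately have "exp (1::complex) = 1" by simp
      then have "norm (exp (1::complex)) = 1" by simp
      then show False by simp
    qed
    then obtain z where "?f z \<noteq> 0" by blast
    then show ?thesis by (intro countable_zeros_entire[of ?f z] holomorphic_intros)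
  qed
  define bad where "bad = (\<Union>(a, b, \<kappa>, \<mu>)\<in>{(a, b, \<kappa>, \<mu>) \<in> S \<times> S \<times> \<Lambda> \<times> \<Lambda>. \<kappa> \<noteq> \<mu>}. {u. a * exp (u * \<kappa> x0) - b * exp (u * \<mu> x0) = 0})"
  have "finite (S \<times> S \<times> \<Lambda> \<times> \<Lambda>)" using assms(1) fin by simp
  then have "countable {(a, b, \<kappa>, \<mu>) \<in> S \<times> S \<times> \<Lambda> \<times> \<Lambda>. \<kappa> \<noteq> \<mu>}"
    by (rule countable_finite[OF finite_subset[rotated]]) auto
  then have "countable bad" unfolding bad_def using cnt by (intro countable_UN) auto
  then have "bad \<noteq> UNIV" using uncountable_UNIV_complex by auto
  then obtain u where u: "u \<notin> bad" by blast
  show ?thesis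
  proof (rule that[of "u *s x0"])
    show "u *s x0 \<in> T" using x0(1) subspace_scale[OF subspace_T[OF T]] by blast
    fix a b \<kappa> \<mu> assume s: "a \<in> S" "b \<in> S" "\<kappa> \<in> insert 0 (wt T)" "\<mu> \<in> insert 0 (wt T)" "\<kappa> \<noteq> \<mu>"
    have "a * exp (u * \<kappa> x0) - b * exp (u * \<mu> x0) \<noteq> 0"
    proof
      assume "a * exp (u * \<kappa> x0) - b * exp (u * \<mu> x0) = 0"
      then have "u \<in> bad" unfolding bad_def using s by (intro UN_I[of "(a, b, \<kappa>, \<mu>)"]) (auto simp: \<Lambda>_def)
      then show False using u by blast
    qed
    moreover have "\<kappa> (u *s x0) = u * \<kappa> x0" "\<mu> (u *s x0) = u * \<mu> x0"
      using dual[of \<kappa>] dual[of \<mu>] s x0(1) by (auto simp: dual_space_def \<Lambda>_def)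
    ultimately show "a * exp (\<kappa> (u *s x0)) \<noteq> b * exp (\<mu> (u *s x0))" by simp
  qed
qed

end

text \<open>On \<open>W k\<close> the maps F - a and G - b are nilpotent and commute with
  \<open>F\<close> and \<open>G\<close>, so they contribute nothing to the traces, and F^n G counts
  as the scalar a^n b.\<close>

lemma tr_funpow_ad:
  assumes ds: "dsum \<Lambda> W" and k: "k \<in> \<Lambda>" and F: "lin F" and G: "lin G"
    and comm: "\<And>v. F (G v) = G (F v)" and st: "\<And>l. l \<in> \<Lambda> \<Longrightarrow> F ` W l \<subseteq> W l" "\<And>l. l \<in> \<Lambda> \<Longrightarrow> G ` W l \<subseteq> W l"
    and a: "W k \<subseteq> gen F a" and b: "W k \<subseteq> gen G b"
  shows "tr (\<lambda>v. (F ^^ n) (G (pr \<Lambda> W k v))) = a ^ n * b * of_nat (dim (W k))"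
proof -
  let ?P = "pr \<Lambda> W k"
  have P: "lin ?P" "\<And>v. ?P (?P v) = ?P v" "\<And>v. ?P v \<in> W k" using lin_pr[OF ds k] pr_idem[OF ds k] pr_in[OF ds k] by auto
  have PF: "?P (F v) = F (?P v)" and PG: "?P (G v) = G (?P v)" for v
    using pr_commute[OF ds F st(1) k] pr_commute[OF ds G st(2) k] by auto
  have PFn: "?P ((F ^^ n) v) = (F ^^ n) (?P v)" for n v
    by (rule funpow_comm[of F ?P, symmetric, OF PF[symmetric]])
  have FnG: "(F ^^ n) (G v) = G ((F ^^ n) v)" for n v by (rule funpow_comm[of F G, OF comm])
  have tF: "tr (\<lambda>v. (F ^^ n) (?P v)) = a ^ n * of_nat (dim (W k))" for n
  proof (induction n)
    case 0
    then show ?case using tr_pr[OF ds k] by simp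
  next
    case (Suc n)
    have "tr (\<lambda>v. (F ^^ n) (shift F a (?P v))) = 0"
    proof (rule tr_commuting_nilpotent[OF lin_funpow[OF F] lin_shift[OF F] P(1)])
      show "(F ^^ n) (shift F a v) = shift F a ((F ^^ n) v)" for v
        by (simp add: shift_def lin_diff[OF lin_funpow[OF F]] lin_scale[OF lin_funpow[OF F]] funpow_swap1)
      show "?P (shift F a v) = shift F a (?P v)" for v
        by (simp add: shift_def lin_diff[OF P(1)] lin_scale[OF P(1)] PF)
      show "\<exists>k. (shift F a ^^ k) (?P v) = 0" for v using P(3)[of v] a by (auto simp: gen_def)
    qed (simp_all add: PFn P)
    then have "tr (\<lambda>v. (F ^^ n) (F (?P v)) - a *s (F ^^ n) (?P v)) = 0"
      by (simp add: shift_def lin_diff[OF lin_funpow[OF F]] lin_scale[OF lin_funpow[OF F]])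
    then show ?case using Suc by (simp add: tr_diff tr_scale funpow_swap1)
  qed
  have "tr (\<lambda>v. (F ^^ n) (shift G b (?P v))) = 0"
  proof (rule tr_commuting_nilpotent[OF lin_funpow[OF F] lin_shift[OF G] P(1)])
    show "(F ^^ n) (shift G b v) = shift G b ((F ^^ n) v)" for v
      by (simp add: shift_def lin_diff[OF lin_funpow[OF F]] lin_scale[OF lin_funpow[OF F]] FnG)
    show "?P (shift G b v) = shift G b (?P v)" for v
      by (simp add: shift_def lin_diff[OF P(1)] lin_scale[OF P(1)] PG)
    show "\<exists>k. (shift G b ^^ k) (?P v) = 0" for v using P(3)[of v] b by (auto simp: gen_def)
  qed (simp_all add: PFn P)
  then have "tr (\<lambda>v. (F ^^ n) (G (?P v)) - b *s (F ^^ n) (?P v)) = 0"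
    by (simp add: shift_def lin_diff[OF lin_funpow[OF F]] lin_scale[OF lin_funpow[OF F]])
  then show ?thesis using tF[of n] by (simp add: tr_diff tr_scale)
qed

text \<open>A common generalization of a Cartan subalgebra of the fixed points of an involution and of the
  fixed points in \<open>H\<close> of a diagram automorphism.\<close>

definition fixed_torus :: "('g \<Rightarrow> 'g) \<Rightarrow> 'g set \<Rightarrow> bool" where
  "fixed_torus \<psi> T \<longleftrightarrow> lie_automorphism \<psi> \<and> nilp_alg T \<and> (\<forall>t\<in>T. \<psi> t = t) \<and>
     (\<forall>v\<in>gs T 0. \<psi> v = v \<longrightarrow> v \<in> T) \<and> (\<forall>v\<in>gs T 0. \<exists>t\<in>T. \<exists>w\<in>gs T 0. v = t + (\<psi> w - w))"

text \<open>\<open>y\<close> is Killing-orthogonal to the nonzero weight spaces by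
  \<open>tr_ad_off\<close>, to \<open>T\<close> by \<open>tr_ad_nilpotent\<close>, and to each
  \<psi> w - w because \<psi> fixes \<open>y\<close> and preserves the form. The decomposition of
  \<open>gs T 0\<close> in \<open>fixed_torus\<close> is made for this.\<close>

lemma fixed_torus_nondegenerate:
  assumes \<psi>T: "fixed_torus \<psi> T" and nd: "\<And>x. (\<And>y. kf x y = 0) \<Longrightarrow> x = 0"
    and y: "y \<in> T" "\<And>\<kappa>. \<kappa> \<in> wt T \<Longrightarrow> \<kappa> y = 0"
  shows "y = 0"
proof (rule nd)
  have \<psi>: "lie_automorphism \<psi>" and T: "nilp_alg T" and fx: "\<And>t. t \<in> T \<Longrightarrow> \<psi> t = t"
    and dec: "\<And>v. v \<in> gs T 0 \<Longrightarrow> \<exists>t\<in>T. \<exists>w\<in>gs T 0. v = t + (\<psi> w - w)"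
    using \<psi>T by (auto simp: fixed_torus_def)
  fix v
  have "v \<in> {v. kf y v = 0}"
  proof (rule gs_spans[OF T])
    show "subspace {v. kf y v = 0}"
      unfolding subspace_def using kf_scale_right[of y 0 0] by (auto simp: kf_add_right kf_scale_right)
    fix \<kappa> assume \<kappa>: "\<kappa> \<in> wt T"
    show "gs T \<kappa> \<subseteq> {v. kf y v = 0}"
    proof
      fix v assume v: "v \<in> gs T \<kappa>"
      have y0: "y \<in> gs T 0" using T_in_gs0[OF T] y(1) by blast
      show "v \<in> {v. kf y v = 0}"
      proof (cases "\<kappa> = 0")
        case True
        then obtain t w where tw: "t \<in> T" "v = t + (\<psi> w - w)" using dec v by blast
        have "kf y (\<psi> w) = kf y w" using kf_automorphism[OF \<psi>, of y w] fx[OF y(1)] by simp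
        moreover have "kf y t = 0" unfolding kf_def by (rule tr_ad_nilpotent[OF T y(1) _ tw(1)]) (rule y(2))
        moreover have "kf y (- w) = - kf y w" using kf_scale_right[of y "-1" w] by simp
        ultimately show ?thesis using tw(2) by (simp add: kf_add_right diff_conv_add_uminus del: add_uminus_conv_diff)
      next
        case False
        then have "kf y v = 0"
          unfolding kf_def by (intro tr_ad_off[OF T y0 v]) (use \<kappa> wt_supported[OF T] in \<open>auto simp: zero_supported\<close>)
        then show ?thesis by simp
      qed
    qed
  qed
  then show "kf y v = 0" by simp
qed

text \<open>For generic \<open>x\<close> an eigenvalue of the twisted map reveals the weight. So a
  fixed vector has weight 0, is fixed by \<psi> itself, and lies in \<open>T\<close>. The traces
  belonging to \<open>y\<close> are exponential sums in the eigenvalues, with coefficients that are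
  positive multiples of values of weights at \<open>y\<close>; if all traces vanish, so do these
  values.\<close>

lemma fixed_torus_generic:
  assumes \<psi>T: "fixed_torus \<psi> T" and nd: "\<And>x. (\<And>y. kf x y = 0) \<Longrightarrow> x = 0"
  shows "\<exists>x. {v. \<psi> (dil T x 1 v) = v} \<subseteq> T \<and>
    (\<forall>y\<in>T. (\<forall>k::nat. tr (\<lambda>v. ((\<lambda>u. \<psi> (dil T x 1 u)) ^^ k) (br y v)) = 0) \<longrightarrow> y = 0)"
proof -
  have \<psi>: "lie_automorphism \<psi>" and T: "nilp_alg T" and fx: "\<And>t. t \<in> T \<Longrightarrow> \<psi> t = t"
    and fixed: "\<And>v. v \<in> gs T 0 \<Longrightarrow> \<psi> v = v \<Longrightarrow> v \<in> T"
    using \<psi>T by (auto simp: fixed_torus_def)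
  note lin\<psi> = automorphism_lin[OF \<psi>]
  have inj\<psi>: "v = 0" if "\<psi> v = 0" for v
    using automorphism_bij[OF \<psi>] that lin_0[OF lin\<psi>] by (metis bij_is_inj injD)
  \<comment> \<open>Besides the eigenvalues of \<psi>, 1 is included so that the value 1 at weight 0
    takes part in the comparison.\<close>
  define S where "S = insert 1 {c. gen \<psi> c \<noteq> {0}}"
  have "finite S" unfolding S_def using finite_eigenvalues[OF lin\<psi>] by simp
  moreover have "0 \<notin> S"
  proof -
    have "v = 0" if "(\<psi> ^^ k) v = 0" for k v using that by (induction k) (auto dest: inj\<psi>)
    then have "gen \<psi> 0 \<subseteq> {0}" by (auto simp: gen_def shift_zero)
    then have "gen \<psi> 0 = {0}" using subspace_0[OF subspace_gen[OF lin\<psi>]] by blast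
    then show ?thesis by (simp add: S_def)
  qed
  ultimately obtain x where x: "x \<in> T" and sep: "\<And>a b \<kappa> \<mu>. a \<in> S \<Longrightarrow> b \<in> S \<Longrightarrow> \<kappa> \<in> insert 0 (wt T) \<Longrightarrow>
      \<mu> \<in> insert 0 (wt T) \<Longrightarrow> \<kappa> \<noteq> \<mu> \<Longrightarrow> a * exp (\<kappa> x) \<noteq> b * exp (\<mu> x)"
    using generic_separation[OF T] by blast
  define \<phi> where "\<phi> = (\<lambda>u. \<psi> (dil T x 1 u))"
  have lin\<phi>: "lin \<phi>" unfolding \<phi>_def by (rule lin_comp[OF lin\<psi> lin_dil[OF T]])
  have \<phi>_br: "\<phi> (br u v) = br (\<phi> u) (\<phi> v)" for u v
    by (simp add: \<phi>_def dil_br[OF T] automorphism_br[OF \<psi>])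
  have \<psi>_gs: "\<psi> ` gs T \<kappa> \<subseteq> gs T \<kappa>" for \<kappa>
    by (rule automorphism_gs[OF \<psi> fx])
  have \<phi>_eq: "\<phi> v = exp (\<kappa> x) *s \<psi> v" if "v \<in> gs T \<kappa>" "\<kappa> \<in> supported T" for v \<kappa>
    using dil_gs[OF T that] lin_scale[OF lin\<psi>] by (simp add: \<phi>_def)
  have \<phi>_gs: "\<phi> ` gs T \<kappa> \<subseteq> gs T \<kappa>" if "\<kappa> \<in> supported T" for \<kappa>
  proof safe
    fix v assume v: "v \<in> gs T \<kappa>"
    then have "\<psi> v \<in> gs T \<kappa>" using \<psi>_gs by blast
    then show "\<phi> v \<in> gs T \<kappa>" using \<phi>_eq[OF v that] subspace_scale[OF subspace_gs[OF T]] by simp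
  qed
  have \<phi>_pr: "prw T \<kappa> (\<phi> v) = \<phi> (prw T \<kappa> v)" if "\<kappa> \<in> wt T" for \<kappa> v
    by (rule pr_commute[OF ds[OF T] lin\<phi> \<phi>_gs[OF wt_supported[OF T]] that])
  \<comment> \<open>On a weight space \<phi> is exp(\<kappa>(x)) times \<psi>; dividing by this
    factor turns eigenvalues of \<phi> into eigenvalues of \<psi>.\<close>
  have eig: "a * exp (- \<kappa> x) \<in> S" if w: "w \<noteq> 0" "w \<in> gs T \<kappa>" "\<kappa> \<in> wt T" "w \<in> gen \<phi> a" for w \<kappa> a
  proof -
    let ?c = "a * exp (- \<kappa> x)"
    have e: "shift \<phi> a u = exp (\<kappa> x) *s shift \<psi> ?c u" if "u \<in> gs T \<kappa>" for u
      using \<phi>_eq[OF that wt_supported[OF T w(3)]]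
      by (simp add: shift_def scale_right_diff_distrib exp_minus)
    have "(shift \<phi> a ^^ k) w = exp (\<kappa> x) ^ k *s (shift \<psi> ?c ^^ k) w \<and> (shift \<psi> ?c ^^ k) w \<in> gs T \<kappa>" for k
    proof (induction k)
      case (Suc k)
      let ?u = "(shift \<psi> ?c ^^ k) w"
      have st: "shift \<psi> ?c ?u \<in> gs T \<kappa>"
      proof -
        have "\<psi> ?u - ?c *s ?u \<in> gs T \<kappa>"
          by (rule subspace_diff[OF subspace_gs[OF T] _ subspace_scale[OF subspace_gs[OF T]]])
            (use Suc \<psi>_gs in blast)+
        moreover have "shift \<psi> ?c ?u = \<psi> ?u - ?c *s ?u" by (simp add: shift_def)
        ultimately show ?thesis by (simp only:)
      qed
      have "shift \<phi> a (exp (\<kappa> x) ^ k *s ?u) = exp (\<kappa> x) ^ k *s (exp (\<kappa> x) *s shift \<psi> ?c ?u)"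
        using e[of ?u] Suc lin_scale[OF lin_shift[OF lin\<phi>]] by simp
      then show ?case using Suc st by (simp add: mult.commute)
    qed (use w in simp)
    moreover obtain k where "(shift \<phi> a ^^ k) w = 0" using w(4) by (auto simp: gen_def)
    ultimately have "(shift \<psi> ?c ^^ k) w = 0" by (metis exp_not_eq_zero power_not_zero scale_eq_0_iff)
    then have "w \<in> gen \<psi> ?c" by (auto simp: gen_def)
    then show ?thesis using w(1) by (auto simp: S_def)
  qed
  have part1: "v \<in> T" if v: "\<phi> v = v" for v
  proof -
    have "prw T \<kappa> v \<in> gs T 0" if \<kappa>: "\<kappa> \<in> wt T" for \<kappa>
    proof (cases "\<kappa> = 0 \<or> prw T \<kappa> v = 0")
      case True
      then show ?thesis using pr_in[OF ds[OF T] \<kappa>] subspace_0[OF subspace_gs[OF T]] by metis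
    next
      case False
      have "\<phi> (prw T \<kappa> v) = prw T \<kappa> v" using \<phi>_pr[OF \<kappa>, of v] v by simp
      then have "prw T \<kappa> v \<in> gen \<phi> 1" by (auto simp: gen_def shift_def intro!: exI[of _ 1])
      then have "1 * exp (- \<kappa> x) \<in> S" using eig False pr_in[OF ds[OF T] \<kappa>] \<kappa> by blast
      moreover have "1 \<in> S" by (simp add: S_def)
      ultimately have "1 * exp (- \<kappa> x) * exp (\<kappa> x) \<noteq> 1 * exp ((0 :: 'g \<Rightarrow> complex) x)"
        using sep[of "1 * exp (- \<kappa> x)" 1 \<kappa> 0] \<kappa> False by blast
      then show ?thesis by (simp add: exp_minus)
    qed
    then have "(\<Sum>\<kappa>\<in>wt T. prw T \<kappa> v) \<in> gs T 0" by (intro subspace_sum[OF subspace_gs[OF T]])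
    then have v0: "v \<in> gs T 0" by (simp add: pr_sum[OF ds[OF T]])
    then have "\<psi> v = v" using \<phi>_eq[OF v0 zero_supported] v by simp
    then show ?thesis by (rule fixed[OF v0])
  qed
  have part2: "y = 0" if y: "y \<in> T" and tr0: "\<And>k::nat. tr (\<lambda>v. (\<phi> ^^ k) (br y v)) = 0" for y
  proof (rule fixed_torus_nondegenerate[OF \<psi>T nd y])
    \<comment> \<open>The commuting pair of \<phi> (at \<open>True\<close>) and \<open>br y\<close>
      (at \<open>False\<close>), as a family to which the joint decomposition applies.\<close>
    define X where "X b = (if b then \<phi> else br y)" for b
    have \<phi>y: "\<phi> y = y" using dil_T[OF T y] fx[OF y] by (simp add: \<phi>_def)
    have comm: "\<phi> (br y v) = br y (\<phi> v)" for v using \<phi>_br[of y v] \<phi>y by simp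
    have linX: "lin (X b)" for b by (simp add: X_def lin\<phi> lin_br)
    have commX: "X b (X b' v) = X b' (X b v)" for b b' v by (simp add: X_def comm)
    have "X j v \<in> gen (X i) c" if "v \<in> gen (X i) c" for i j v c
      by (rule gen_stable_comm[of "X i" "X j", OF linX linX _ that]) (rule commX)
    then have compX: "compatible UNIV X" using linX by (auto simp: compatible_def)
    define \<Omega> where "\<Omega> = weights UNIV X"
    have dsX: "dsum \<Omega> (jgen UNIV X)" unfolding \<Omega>_def by (rule dsum_weights[OF compX])
    have finO: "finite \<Omega>" unfolding \<Omega>_def by (rule finite_weights[OF compX])
    have claim: "\<exists>\<kappa>\<in>wt T. \<omega> False = \<kappa> y \<and> \<omega> True * exp (- \<kappa> x) \<in> S" if \<omega>: "\<omega> \<in> \<Omega>" for \<omega>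
    proof -
      have "jgen UNIV X \<omega> \<noteq> {0}" using \<omega> by (simp add: \<Omega>_def weights_def)
      then obtain v where v: "v \<in> jgen UNIV X \<omega>" "v \<noteq> 0" using subspace_0[OF subspace_jgen[OF compX, of \<omega>]] by blast
      have "\<exists>\<kappa>\<in>wt T. prw T \<kappa> v \<noteq> 0"
      proof (rule ccontr)
        assume "\<not> ?thesis"
        then have "(\<Sum>\<kappa>\<in>wt T. prw T \<kappa> v) = 0" by (intro sum.neutral) auto
        then show False using v(2) by (simp add: pr_sum[OF ds[OF T]])
      qed
      then obtain \<kappa> where \<kappa>: "\<kappa> \<in> wt T" "prw T \<kappa> v \<noteq> 0" by blast
      let ?w = "prw T \<kappa> v"
      have w: "?w \<in> gs T \<kappa>" by (rule pr_in[OF ds[OF T] \<kappa>(1)])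
      have "?w \<in> gen \<phi> (\<omega> True)"
        by (rule gen_stable_comm[of \<phi> "prw T \<kappa>", OF lin\<phi> lin_pr[OF ds[OF T] \<kappa>(1)] \<phi>_pr[OF \<kappa>(1), symmetric]])
          (use v(1) in \<open>auto simp: jgen_def X_def dest: spec[of _ True]\<close>)
      then have "\<omega> True * exp (- \<kappa> x) \<in> S" using eig[OF \<kappa>(2) w \<kappa>(1)] by blast
      moreover have "?w \<in> gen (br y) (\<omega> False)"
        by (rule gen_stable_comm[of "br y" "prw T \<kappa>", OF lin_br lin_pr[OF ds[OF T] \<kappa>(1)] prw_br[OF T y \<kappa>(1), symmetric]])
          (use v(1) in \<open>auto simp: jgen_def X_def dest: spec[of _ False]\<close>)
      moreover have "?w \<in> gen (br y) (\<kappa> y)" using w y by (simp add: jgen_def)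
      ultimately show ?thesis using gen_inj[OF lin_br, of "\<omega> False" "\<kappa> y" ?w y] \<kappa> unfolding gen_def by blast
    qed
    have same: "\<omega> False = \<omega>' False" if oo: "\<omega> \<in> \<Omega>" "\<omega>' \<in> \<Omega>" "\<omega> True = \<omega>' True" for \<omega> \<omega>'
    proof -
      obtain \<kappa> \<mu> where k: "\<kappa> \<in> wt T" "\<omega> False = \<kappa> y" "\<omega> True * exp (- \<kappa> x) \<in> S"
        and m: "\<mu> \<in> wt T" "\<omega>' False = \<mu> y" "\<omega>' True * exp (- \<mu> x) \<in> S"
        using claim[OF oo(1)] claim[OF oo(2)] by blast
      have "\<omega> True * exp (- \<kappa> x) * exp (\<kappa> x) = \<omega>' True * exp (- \<mu> x) * exp (\<mu> x)"
        using oo(3) by (simp add: exp_minus)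
      then have "\<kappa> = \<mu>" using sep[OF k(3) m(3), of \<kappa> \<mu>] k m by blast
      then show ?thesis using k m by simp
    qed
    define d where "d \<omega> = (of_nat (dim (jgen UNIV X \<omega>)) :: complex)" for \<omega>
    \<comment> \<open>Coefficient of a^k in tr (\<phi>^k ad y): the eigenvalues of
      \<open>br y\<close>, with multiplicity, on the joint spaces where \<phi> has the eigenvalue
      \<open>a\<close>.\<close>
    define m where "m a = (\<Sum>\<omega>\<in>{\<omega>\<in>\<Omega>. \<omega> True = a}. \<omega> False * d \<omega>)" for a
    have "(\<Sum>a\<in>(\<lambda>\<omega>. \<omega> True) ` \<Omega>. a ^ k * m a) = 0" for k
    proof -
      have "(\<Sum>a\<in>(\<lambda>\<omega>. \<omega> True) ` \<Omega>. a ^ k * m a) =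
          (\<Sum>a\<in>(\<lambda>\<omega>. \<omega> True) ` \<Omega>. \<Sum>\<omega>\<in>{\<omega>\<in>\<Omega>. \<omega> True = a}. \<omega> True ^ k * \<omega> False * d \<omega>)"
        unfolding m_def sum_distrib_left by (intro sum.cong refl) (auto simp: mult.assoc)
      also have "\<dots> = (\<Sum>\<omega>\<in>\<Omega>. \<omega> True ^ k * \<omega> False * d \<omega>)"
        using sum.image_gen[OF finO, of "\<lambda>\<omega>. \<omega> True ^ k * \<omega> False * d \<omega>" "\<lambda>\<omega>. \<omega> True"] by simp
      also have "\<dots> = (\<Sum>\<omega>\<in>\<Omega>. tr (\<lambda>v. (\<phi> ^^ k) (br y (pr \<Omega> (jgen UNIV X) \<omega> v))))"
      proof (rule sum.cong[OF refl])
        fix \<omega> assume \<omega>: "\<omega> \<in> \<Omega>"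
        have st: "X b ` jgen UNIV X \<omega>' \<subseteq> jgen UNIV X \<omega>'" for b \<omega>'
          using compX unfolding jgen_def compatible_def by blast
        have "jgen UNIV X \<omega> \<subseteq> gen (X b) (\<omega> b)" for b by (auto simp: jgen_def)
        then show "\<omega> True ^ k * \<omega> False * d \<omega> = tr (\<lambda>v. (\<phi> ^^ k) (br y (pr \<Omega> (jgen UNIV X) \<omega> v)))"
          unfolding d_def
          using tr_funpow_ad[OF dsX \<omega> lin\<phi> lin_br comm, of "\<omega> True" "\<omega> False" k] st[of True] st[of False]
          by (simp add: X_def) (metis (full_types))
      qed
      also have "\<dots> = tr (\<lambda>v. (\<phi> ^^ k) (br y v))"
        using tr_dsum[OF dsX lin_comp[OF lin_funpow[OF lin\<phi>] lin_br]] by simp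
      finally show ?thesis using tr0 by simp
    qed
    then have m0: "m a = 0" if "a \<in> (\<lambda>\<omega>. \<omega> True) ` \<Omega>" for a
      using exponential_sums_independent[of "(\<lambda>\<omega>. \<omega> True) ` \<Omega>" m a] finO that by blast
    \<comment> \<open>Equal eigenvalues of \<phi> force equal weights, so the coefficient is one
      eigenvalue of \<open>br y\<close> times a positive integer.\<close>
    have zero: "\<omega> False = 0" if \<omega>: "\<omega> \<in> \<Omega>" for \<omega>
    proof -
      let ?A = "{\<omega>'\<in>\<Omega>. \<omega>' True = \<omega> True}"
      have "m (\<omega> True) = (\<Sum>\<omega>'\<in>?A. \<omega> False * d \<omega>')"
        unfolding m_def by (intro sum.cong refl) (use same[OF _ \<omega>] in auto)
      also have "\<dots> = \<omega> False * of_nat (\<Sum>\<omega>'\<in>?A. dim (jgen UNIV X \<omega>'))"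
        by (simp add: sum_distrib_left d_def)
      finally have "\<omega> False * of_nat (\<Sum>\<omega>'\<in>?A. dim (jgen UNIV X \<omega>')) = 0" using m0 \<omega> by simp
      moreover have "(\<Sum>\<omega>'\<in>?A. dim (jgen UNIV X \<omega>')) \<noteq> 0"
      proof -
        have "dim (jgen UNIV X \<omega>) > 0"
          by (rule dim_pos[OF subspace_jgen[OF compX]]) (use \<omega> in \<open>simp add: \<Omega>_def weights_def\<close>)
        also have "dim (jgen UNIV X \<omega>) \<le> (\<Sum>\<omega>'\<in>?A. dim (jgen UNIV X \<omega>'))"
          by (rule member_le_sum) (use finO \<omega> in auto)
        finally show ?thesis by linarith
      qed
      ultimately show ?thesis unfolding mult_eq_0_iff of_nat_eq_0_iff by blast
    qed
    have "pr \<Omega> (jgen UNIV X) \<omega> v \<in> gen (br y) 0" if "\<omega> \<in> \<Omega>" for \<omega> v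
      using pr_in[OF dsX that, of v] zero[OF that] by (auto simp: jgen_def X_def dest: spec[of _ False])
    then have "(\<Sum>\<omega>\<in>\<Omega>. pr \<Omega> (jgen UNIV X) \<omega> v) \<in> gen (br y) 0" for v
      by (intro subspace_sum[OF subspace_gen[OF lin_br]])
    then have all: "v \<in> gen (br y) 0" for v by (simp add: pr_sum[OF dsX])
    fix \<kappa> assume \<kappa>: "\<kappa> \<in> wt T"
    then have "gs T \<kappa> \<noteq> {0}" by (simp add: weights_def)
    then obtain v where v: "v \<in> gs T \<kappa>" "v \<noteq> 0" using subspace_0[OF subspace_gs[OF T, of \<kappa>]] by blast
    then have "v \<in> gen (br y) (\<kappa> y)" using y by (simp add: jgen_def)
    moreover obtain k where "(shift (br y) 0 ^^ k) v = 0" using all[of v] by (auto simp: gen_def)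
    ultimately show "\<kappa> y = 0" using gen_inj[OF lin_br] v(2) by blast
  qed
  show ?thesis using part1 part2 unfolding \<phi>_def by blast
qed

text \<open>The exponents 1 - s and s switch off the foreign twist at each end of the path, so
  \<open>generic_fixed_dim\<close> applies at 0 with \<open>S\<close> and at 1 with
  \<open>T\<close>. Two countable exceptional sets cannot cover the complex plane, so some fixed
  space has both dimensions.\<close>

theorem fixed_torus_dim_eq:
  assumes nd: "\<And>x. (\<And>y. kf x y = 0) \<Longrightarrow> x = 0"
    and "fixed_torus (\<Psi> 0) S" "fixed_torus (\<Psi> 1) T"
    and \<Psi>: "entop \<Psi>" "\<And>s. lie_automorphism (\<Psi> s)"
  shows "dim S = dim T"
proof -
  have S: "nilp_alg S" and T: "nilp_alg T" using assms by (auto simp: fixed_torus_def)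
  obtain x where x: "{v. \<Psi> 0 (dil S x 1 v) = v} \<subseteq> S"
    "\<And>y. y \<in> S \<Longrightarrow> \<forall>k::nat. tr (\<lambda>v. ((\<lambda>u. \<Psi> 0 (dil S x 1 u)) ^^ k) (br y v)) = 0 \<Longrightarrow> y = 0"
    using fixed_torus_generic[OF assms(2) nd] by blast
  obtain z where z: "{v. \<Psi> 1 (dil T z 1 v) = v} \<subseteq> T"
    "\<And>y. y \<in> T \<Longrightarrow> \<forall>k::nat. tr (\<lambda>v. ((\<lambda>u. \<Psi> 1 (dil T z 1 u)) ^^ k) (br y v)) = 0 \<Longrightarrow> y = 0"
    using fixed_torus_generic[OF assms(3) nd] by blast
  define \<Phi> where "\<Phi> s = (\<lambda>v. \<Psi> s (dil S x (1 - s) (dil T z s v)))" for s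
  have "entop (\<lambda>s. dil S x (1 - s))" "entop (\<lambda>s. dil T z s)"
    by (rule entop_dil[OF S], intro holomorphic_intros) (rule entop_dil[OF T], intro holomorphic_intros)
  note entop_comp[OF \<Psi>(1) entop_comp[OF this]]
  then have ent: "entop \<Phi>" by (simp only: \<Phi>_def[abs_def])
  have aut: "lie_automorphism (\<Phi> s)" for s
    using automorphism_comp[OF \<Psi>(2) automorphism_comp[OF dil_automorphism[OF S] dil_automorphism[OF T]]]
    by (simp add: \<Phi>_def comp_def)
  have \<Phi>0: "\<Phi> 0 = (\<lambda>v. \<Psi> 0 (dil S x 1 v))" and \<Phi>1: "\<Phi> 1 = (\<lambda>v. \<Psi> 1 (dil T z 1 v))"
    by (simp_all add: \<Phi>_def dil_0[OF S] dil_0[OF T])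
  have "countable {s. dim {v. \<Phi> s v = v} \<noteq> dim S}"
    by (rule generic_fixed_dim[OF ent aut subspace_T[OF S], of 0]) (use x in \<open>simp_all add: \<Phi>0\<close>)
  moreover have "countable {s. dim {v. \<Phi> s v = v} \<noteq> dim T}"
    by (rule generic_fixed_dim[OF ent aut subspace_T[OF T], of 1]) (use z in \<open>simp_all add: \<Phi>1\<close>)
  ultimately have c: "countable ({s. dim {v. \<Phi> s v = v} \<noteq> dim S} \<union> {s. dim {v. \<Phi> s v = v} \<noteq> dim T})" by simp
  show ?thesis
  proof (rule ccontr)
    assume "dim S \<noteq> dim T"
    then have "{s. dim {v. \<Phi> s v = v} \<noteq> dim S} \<union> {s. dim {v. \<Phi> s v = v} \<noteq> dim T} = UNIV" by auto
    then show False using c uncountable_UNIV_complex by (simp only:)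
  qed
qed

subsection \<open>Exponentials of nilpotent inner derivations\<close>

definition ad_nil :: "'g \<Rightarrow> bool" where
  "ad_nil y \<longleftrightarrow> (\<forall>v. \<exists>k. (br y ^^ k) v = 0)"

definition nil_index :: "'g \<Rightarrow> nat" where
  "nil_index y = (LEAST N. \<forall>v. (br y ^^ N) v = 0)"

definition dpow :: "'g \<Rightarrow> complex \<Rightarrow> nat \<Rightarrow> 'g \<Rightarrow> 'g" where
  "dpow y s k v = (s ^ k / fact k) *s (br y ^^ k) v"

text \<open>exp (s ad y), cut off where the powers of a nilpotent ad y vanish; the sum is polynomial
  in \<open>s\<close>, hence entire.\<close>

definition xp :: "'g \<Rightarrow> complex \<Rightarrow> 'g \<Rightarrow> 'g" where
  "xp y s v = (\<Sum>k<nil_index y. dpow y s k v)"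

lemma nil_index: assumes "ad_nil y" "nil_index y \<le> k" shows "(br y ^^ k) v = 0"
proof -
  have "\<exists>N. \<forall>v\<in>UNIV. (br y ^^ N) v = 0"
    by (rule uniform_nilpotent[OF lin_br subspace_UNIV]) (use assms(1) in \<open>simp add: ad_nil_def\<close>)
  then have "\<exists>N. \<forall>v. (br y ^^ N) v = 0" by blast
  from LeastI_ex[OF this] have N: "\<forall>v. (br y ^^ nil_index y) v = 0" unfolding nil_index_def .
  show ?thesis by (rule funpow_zero_mono[OF lin_br spec[OF N] assms(2)])
qed

lemma lin_dpow: "lin (dpow y s k)"
  unfolding dpow_def[abs_def] by (intro lin_scaled lin_funpow lin_br)

lemma lin_xp: "lin (xp y s)"
  unfolding xp_def[abs_def] by (intro lin_Sum lin_dpow)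

lemma entop_xp: assumes "g holomorphic_on UNIV" shows "entop (\<lambda>s. xp y (g s))"
  unfolding xp_def[abs_def] dpow_def[abs_def]
  by (intro entop_sum entop_scale holomorphic_intros assms entop_lin lin_funpow lin_br) simp

lemma xp_eq: assumes y: "ad_nil y" and j: "(br y ^^ j) v = 0" shows "xp y s v = (\<Sum>k<j. dpow y s k v)"
proof -
  have z1: "dpow y s k v = 0" if "nil_index y \<le> k" for k by (simp add: dpow_def nil_index[OF y that])
  have z2: "dpow y s k v = 0" if "j \<le> k" for k
    by (simp add: dpow_def funpow_zero_mono[OF lin_br j that])
  let ?m = "max j (nil_index y)"
  have "xp y s v = (\<Sum>k<?m. dpow y s k v)"
    unfolding xp_def by (rule sum.mono_neutral_left) (use z1 in auto)
  also have "\<dots> = (\<Sum>k<j. dpow y s k v)"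
    by (rule sum.mono_neutral_right) (use z2 in auto)
  finally show ?thesis .
qed

lemma dpow_Suc: "s *s br y (dpow y s k v) = of_nat (Suc k) *s dpow y s (Suc k) v"
  by (simp add: dpow_def br_scale_right field_simps del: of_nat_Suc)

lemma dpow_br: "dpow y s l (br u v) = (\<Sum>i\<le>l. br (dpow y s i u) (dpow y s (l - i) v))"
proof (induction l)
  case 0
  show ?case by (simp add: dpow_def)
next
  case (Suc l)
  let ?b = "\<lambda>i j. br (dpow y s i u) (dpow y s j v)"
  have "of_nat (Suc l) *s dpow y s (Suc l) (br u v) = s *s br y (\<Sum>i\<le>l. ?b i (l - i))"
    using dpow_Suc[of s y l "br u v"] Suc by simp
  also have "\<dots> = (\<Sum>i\<le>l. br (s *s br y (dpow y s i u)) (dpow y s (l - i) v)) +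
      (\<Sum>i\<le>l. br (dpow y s i u) (s *s br y (dpow y s (l - i) v)))"
    by (simp add: lin_sum[OF lin_br] br_leibniz[of y] scale_sum_right scale_right_distrib sum.distrib
        br_scale_left br_scale_right)
  also have "(\<Sum>i\<le>l. br (s *s br y (dpow y s i u)) (dpow y s (l - i) v)) =
      (\<Sum>i\<le>l. of_nat (Suc i) *s ?b (Suc i) (Suc l - Suc i))"
    by (simp only: dpow_Suc br_scale_left diff_Suc_Suc)
  also have "\<dots> = (\<Sum>i\<le>Suc l. of_nat i *s ?b i (Suc l - i))"
    by (subst sum.atMost_Suc_shift) simp
  also have "(\<Sum>i\<le>l. br (dpow y s i u) (s *s br y (dpow y s (l - i) v))) =
      (\<Sum>i\<le>l. of_nat (Suc l - i) *s ?b i (Suc l - i))"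
    by (intro sum.cong refl) (simp only: dpow_Suc br_scale_right Suc_diff_le atMost_iff)
  also have "\<dots> = (\<Sum>i\<le>Suc l. of_nat (Suc l - i) *s ?b i (Suc l - i))" by simp
  also have "(\<Sum>i\<le>Suc l. of_nat i *s ?b i (Suc l - i)) + \<dots> = (\<Sum>i\<le>Suc l. of_nat (Suc l) *s ?b i (Suc l - i))"
    unfolding sum.distrib[symmetric] scale_left_distrib[symmetric] of_nat_add[symmetric]
    by (intro sum.cong refl) simp
  finally have "of_nat (Suc l) *s dpow y s (Suc l) (br u v) = of_nat (Suc l) *s (\<Sum>i\<le>Suc l. ?b i (Suc l - i))"
    by (simp only: scale_sum_right)
  then show ?case by (simp del: of_nat_Suc sum.atMost_Suc)
qed

text \<open>The Leibniz rule \<open>dpow_br\<close> for divided powers is summed over all orders.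
  The cut-off 2N is large enough for the triangle of index pairs to contain the square of all pairs
  that contribute.\<close>

lemma xp_br: assumes y: "ad_nil y" shows "xp y s (br u v) = br (xp y s u) (xp y s v)"
proof -
  let ?N = "nil_index y" and ?b = "\<lambda>i j. br (dpow y s i u) (dpow y s j v)"
  have z: "dpow y s k w = 0" if "?N \<le> k" for k w by (simp add: dpow_def nil_index[OF y that])
  have "xp y s (br u v) = (\<Sum>l<2 * ?N. dpow y s l (br u v))"
    by (rule xp_eq[OF y]) (rule nil_index[OF y], simp)
  also have "\<dots> = (\<Sum>l<2 * ?N. \<Sum>i\<le>l. ?b i (l - i))" by (simp only: dpow_br)
  also have "\<dots> = (\<Sum>(i, j)\<in>{(i, j). i + j < 2 * ?N}. ?b i j)"
    by (rule sum.triangle_reindex[symmetric])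
  also have "\<dots> = (\<Sum>(i, j)\<in>{..<?N} \<times> {..<?N}. ?b i j)"
  proof (rule sum.mono_neutral_right)
    have "{(i, j). i + j < 2 * ?N} \<subseteq> {..2 * ?N} \<times> {..2 * ?N}" by auto
    then show "finite {(i, j). i + j < 2 * ?N}" by (rule finite_subset) simp
    show "\<forall>p\<in>{(i, j). i + j < 2 * ?N} - {..<?N} \<times> {..<?N}. (case p of (i, j) \<Rightarrow> ?b i j) = 0"
    proof
      fix p assume p: "p \<in> {(i, j). i + j < 2 * ?N} - {..<?N} \<times> {..<?N}"
      obtain i j where ij: "p = (i, j)" by (cases p)
      then have "?N \<le> i \<or> ?N \<le> j" using p by auto
      then have "dpow y s i u = 0 \<or> dpow y s j v = 0" using z by blast
      then show "(case p of (i, j) \<Rightarrow> ?b i j) = 0" using ij by auto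
    qed
  qed auto
  also have "\<dots> = br (xp y s u) (xp y s v)"
    unfolding sum.cartesian_product[symmetric] xp_def
    by (simp add: lin_sum[OF lin_br] lin_sum[OF lin_br_left]) (rule sum.swap)
  finally show ?thesis .
qed

text \<open>Injectivity: the highest power of \<open>br y\<close> that does not kill
  \<open>v\<close> leaves only the constant term of the exponential. Surjectivity then comes from
  finite dimension.\<close>

lemma xp_automorphism: assumes y: "ad_nil y" shows "lie_automorphism (xp y s)"
proof (rule automorphismI[OF lin_xp _ xp_br[OF y]])
  have "v = 0" if v: "xp y s v = 0" for v
  proof (rule ccontr)
    assume "v \<noteq> 0"
    obtain k where k: "(br y ^^ k) v = 0" using y by (auto simp: ad_nil_def)
    define j where "j = (LEAST k. (br y ^^ k) v = 0)"
    have j: "(br y ^^ j) v = 0" unfolding j_def by (rule LeastI[of _ k]) (rule k)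
    then have "j \<noteq> 0" using \<open>v \<noteq> 0\<close> by (metis funpow_0)
    then obtain l where l: "j = Suc l" using not0_implies_Suc by blast
    have nz: "(br y ^^ l) v \<noteq> 0" using not_less_Least[of l "\<lambda>k. (br y ^^ k) v = 0"] l unfolding j_def by simp
    have "(br y ^^ l) (dpow y s k v) = (if k = 0 then (br y ^^ l) v else 0)" for k
    proof (cases k)
      case (Suc i)
      have "(br y ^^ l) ((br y ^^ Suc i) v) = (br y ^^ (l + Suc i)) v" by (simp only: funpow_add o_apply)
      also have "\<dots> = 0" by (rule funpow_zero_mono[OF lin_br j]) (simp add: l)
      finally show ?thesis using Suc by (simp only: dpow_def lin_scale[OF lin_funpow[OF lin_br]]) simp
    qed (simp add: dpow_def)
    then have "(br y ^^ l) (xp y s v) = (\<Sum>k<j. if k = 0 then (br y ^^ l) v else 0)"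
      unfolding xp_eq[OF y j] lin_sum[OF lin_funpow[OF lin_br]] by (intro sum.cong refl)
    also have "\<dots> = (br y ^^ l) v" using l by simp
    finally show False using nz v lin_0[OF lin_funpow[OF lin_br]] by simp
  qed
  then have inj: "inj (xp y s)"
    by (intro injI) (metis lin_diff[OF lin_xp] right_minus_eq)
  moreover have "surj (xp y s)"
    by (rule linear_inj_imp_surj[OF _ inj]) (use lin_xp lin_iff_linear in blast)
  ultimately show "bij (xp y s)" by (simp add: bij_def)
qed

lemma xp_0: assumes "ad_nil y" shows "xp y 0 v = v"
proof -
  have "xp y 0 v = (\<Sum>k<Suc (nil_index y). dpow y 0 k v)"
    by (rule xp_eq[OF assms]) (rule nil_index[OF assms], simp)
  also have "\<dots> = (\<Sum>k<Suc (nil_index y). if k = 0 then v else 0)"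
    by (intro sum.cong refl) (auto simp: dpow_def)
  finally show ?thesis by simp
qed

text \<open>Chains of length 1, 2 and 3 are the ones met in \<open>refl_H\<close> by a Cartan
  element, \<open>e i\<close> and \<open>f i\<close>.\<close>

lemma xp_1: assumes "ad_nil y" "br y v = 0" shows "xp y s v = v"
  using xp_eq[OF assms(1), of 1 v s] assms(2) by (simp add: dpow_def)

lemma xp_2: assumes "ad_nil y" "br y (br y v) = 0" shows "xp y s v = v + s *s br y v"
  using xp_eq[OF assms(1), of 2 v s] assms(2) by (simp add: dpow_def numeral_2_eq_2)

lemma xp_3:
  assumes "ad_nil y" "br y (br y (br y v)) = 0" shows "xp y s v = v + s *s br y v + (s ^ 2 / 2) *s br y (br y v)"
  using xp_eq[OF assms(1), of 3 v s] assms(2) by (simp add: dpow_def numeral_3_eq_3 numeral_2_eq_2)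

subsection \<open>Dual bases of functionals\<close>

text \<open>As in Gram-Schmidt: some \<open>x\<close> is not accounted for by the functionals
  already dualized, else there would be a linear relation. Its residue, normalized, serves the new
  functional and corrects the older vectors.\<close>

lemma dual_vectors:
  assumes H: "subspace H" and "finite I"
  shows "(\<And>i. i \<in> I \<Longrightarrow> a i \<in> dual_space H) \<Longrightarrow>
    (\<And>u. (\<And>x. x \<in> H \<Longrightarrow> (\<Sum>i\<in>I. u i * a i x) = 0) \<Longrightarrow> \<forall>i\<in>I. u i = 0) \<Longrightarrow>
    \<exists>h. \<forall>j\<in>I. h j \<in> H \<and> (\<forall>i\<in>I. a i (h j) = (if i = j then 1 else 0))"
  using assms(2)
proof (induction I rule: finite_induct)
  case (insert l I)
  have "\<exists>h. \<forall>j\<in>I. h j \<in> H \<and> (\<forall>i\<in>I. a i (h j) = (if i = j then 1 else 0))"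
  proof (rule insert.IH)
    fix u assume u: "\<And>x. x \<in> H \<Longrightarrow> (\<Sum>i\<in>I. u i * a i x) = 0"
    have "\<forall>i\<in>insert l I. (if i = l then 0 else u i) = 0"
    proof (rule insert.prems(2))
      fix x assume "x \<in> H"
      have "(\<Sum>i\<in>I. (if i = l then 0 else u i) * a i x) = (\<Sum>i\<in>I. u i * a i x)"
        using insert.hyps by (intro sum.cong) auto
      then show "(\<Sum>i\<in>insert l I. (if i = l then 0 else u i) * a i x) = 0"
        using insert.hyps u[OF \<open>x \<in> H\<close>] by simp
    qed
    then show "\<forall>i\<in>I. u i = 0" using insert.hyps by (metis insertCI)
  qed (use insert.prems(1) in blast)
  then obtain h where h: "\<And>j. j \<in> I \<Longrightarrow> h j \<in> H" "\<And>i j. i \<in> I \<Longrightarrow> j \<in> I \<Longrightarrow> a i (h j) = (if i = j then 1 else 0)"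
    by blast
  have lin_a: "a i (\<Sum>k\<in>K. c k *s w k) = (\<Sum>k\<in>K. c k * a i (w k))"
    if i: "i \<in> insert l I" and K: "finite K" "\<And>k. k \<in> K \<Longrightarrow> w k \<in> H" for i K and c :: "'a \<Rightarrow> complex" and w
  proof -
    have d: "a i \<in> dual_space H" using insert.prems(1) i by blast
    have a0: "a i 0 = 0" using d subspace_0[OF H] unfolding dual_space_def by (metis (mono_tags, lifting) mem_Collect_eq mult_zero_left scale_zero_left)
    show ?thesis using K
    proof (induction K rule: finite_induct)
      case (insert k K)
      have "(\<Sum>k\<in>K. c k *s w k) \<in> H" using insert.prems by (intro subspace_sum[OF H] subspace_scale[OF H]) auto
      then show ?case using insert d subspace_scale[OF H] by (simp add: dual_space_def)
    qed (simp add: a0)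
  qed
  have add_a: "a i (x + y) = a i x + a i y" if "i \<in> insert l I" "x \<in> H" "y \<in> H" for i x y
    using insert.prems(1)[OF that(1)] that by (simp add: dual_space_def)
  have scale_a: "a i (c *s x) = c * a i x" if "i \<in> insert l I" "x \<in> H" for i x c
    using insert.prems(1)[OF that(1)] that by (simp add: dual_space_def)
  have diff_a: "a i (x - y) = a i x - a i y" if "i \<in> insert l I" "x \<in> H" "y \<in> H" for i x y
    using add_a[OF that(1,2), of "-1 *s y"] scale_a[OF that(1,3), of "-1"] subspace_neg[OF H that(3)] by simp
  have "\<exists>x\<in>H. a l x - (\<Sum>i\<in>I. a l (h i) * a i x) \<noteq> 0"
  proof (rule ccontr)
    assume "\<not> ?thesis"
    then have n: "\<And>x. x \<in> H \<Longrightarrow> a l x - (\<Sum>i\<in>I. a l (h i) * a i x) = 0" by blast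
    have "\<forall>i\<in>insert l I. (if i = l then 1 else - a l (h i)) = 0"
    proof (rule insert.prems(2))
      fix x assume "x \<in> H"
      have "(\<Sum>i\<in>I. (if i = l then 1 else - a l (h i)) * a i x) = - (\<Sum>i\<in>I. a l (h i) * a i x)"
        unfolding sum_negf[symmetric] using insert.hyps by (intro sum.cong) auto
      then show "(\<Sum>i\<in>insert l I. (if i = l then 1 else - a l (h i)) * a i x) = 0"
        using insert.hyps n[OF \<open>x \<in> H\<close>] by simp
    qed
    then show False by simp
  qed
  then obtain x where x: "x \<in> H" "a l x - (\<Sum>i\<in>I. a l (h i) * a i x) \<noteq> 0" by blast
  define d where "d = a l x - (\<Sum>i\<in>I. a l (h i) * a i x)"
  define s where "s = (\<Sum>i\<in>I. a i x *s h i)"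
  have sH: "s \<in> H" unfolding s_def using h(1) by (intro subspace_sum[OF H] subspace_scale[OF H]) auto
  have a_s: "a i s = a i x" if "i \<in> I" for i
  proof -
    have "a i s = (\<Sum>k\<in>I. a k x * a i (h k))" unfolding s_def by (rule lin_a) (use that h insert.hyps in auto)
    also have "\<dots> = (\<Sum>k\<in>I. if k = i then a k x else 0)" by (intro sum.cong) (use h that in auto)
    finally show ?thesis using that insert.hyps by simp
  qed
  have a_ls: "a l x - a l s = d"
    unfolding s_def d_def by (subst lin_a) (use h insert.hyps in \<open>auto simp: mult.commute\<close>)
  define g where "g = (1 / d) *s (x - s)"
  have gH: "g \<in> H" unfolding g_def by (intro subspace_scale[OF H] subspace_diff[OF H] x sH)
  have g: "a i g = (if i = l then 1 else 0)" if "i \<in> insert l I" for i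
  proof -
    have "a i g = (1 / d) * (a i x - a i s)"
      unfolding g_def using that x(1) sH by (simp add: scale_a diff_a subspace_diff[OF H])
    then show ?thesis using that a_s a_ls x(2) d_def by auto
  qed
  define h' where "h' j = (if j = l then g else h j - a l (h j) *s g)" for j
  have "h' j \<in> H \<and> (\<forall>i\<in>insert l I. a i (h' j) = (if i = j then 1 else 0))" if j: "j \<in> insert l I" for j
  proof (cases "j = l")
    case True
    then show ?thesis using gH g by (simp add: h'_def)
  next
    case False
    then have jI: "j \<in> I" using j by simp
    have H': "a l (h j) *s g \<in> H" by (rule subspace_scale[OF H gH])
    have "a i (h j - a l (h j) *s g) = (if i = j then 1 else 0)" if i: "i \<in> insert l I" for i
      using i False jI h gH g[OF i] insert.hyps(2)
      by (auto simp: diff_a[OF i h(1)[OF jI] H'] scale_a[OF i gH])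
    then show ?thesis using False subspace_diff[OF H h(1)[OF jI] H'] by (simp add: h'_def)
  qed
  then show ?case by blast
qed simp

end

sublocale semisimple_lie_algebra \<subseteq> fd_lie scale br
  by unfold_locales (rule finite_dim)

lemma sum_function_apply: "(\<Sum>i\<in>I. F i) x = (\<Sum>i\<in>I. F i x :: complex)"
  by (induction I rule: infinite_finite_induct) auto

context semisimple_with_chevalley_generators
begin

subsection \<open>Roots\<close>

lemma nilp_H: "nilp_alg H"
  using cartan by (simp add: cartan_subalgebra_def nilp_alg_def)

lemma subspace_H: "subspace H"
  by (rule subspace_T[OF nilp_H])

lemma gs_zero: "gs H 0 = H"
  using cartan_zero_weight_space[OF _ cartan] by (simp add: lie_subalgebra_def)

lemma root_space_gs: "root_space H \<beta> \<subseteq> gs H \<beta>"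
proof
  fix v assume v: "v \<in> root_space H \<beta>"
  have "(shift (br h) (\<beta> h) ^^ 1) v = 0" if "h \<in> H" for h
    using v that by (simp add: root_space_def shift_def)
  then show "v \<in> gs H \<beta>" unfolding jgen_def gen_def by blast
qed

lemma dual_supported: "\<beta> \<in> dual_space H \<Longrightarrow> \<beta> \<in> supported H"
  using dual_space_supported by blast

lemma root_wt: assumes "\<beta> \<in> roots H" shows "\<beta> \<in> wt H" "\<beta> \<noteq> 0"
proof -
  have "root_space H \<beta> \<noteq> {0}" "\<beta> \<in> dual_space H" and nz: "\<beta> \<noteq> 0" using assms by (auto simp: roots_def)
  moreover have "0 \<in> root_space H \<beta>" by (simp add: root_space_def)
  ultimately have "gs H \<beta> \<noteq> {0}" using root_space_gs by blast
  then show "\<beta> \<in> wt H" using dual_supported[OF \<open>\<beta> \<in> dual_space H\<close>] by (simp add: weights_def)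
  show "\<beta> \<noteq> 0" by (rule nz)
qed

lemma rootI:
  assumes "\<beta> \<in> dual_space H" "\<beta> \<noteq> 0" "v \<in> root_space H \<beta>" "v \<noteq> 0" shows "\<beta> \<in> roots H"
  using assms by (auto simp: roots_def)

lemma wt_root: assumes "\<kappa> \<in> wt H" "\<kappa> \<noteq> 0" shows "\<kappa> \<in> roots H"
proof -
  obtain v where "v \<noteq> 0" "\<forall>t\<in>H. br t v = \<kappa> t *s v" using weight_vector[OF nilp_H assms(1)] by blast
  then show ?thesis
    by (intro rootI[OF weight_linear[OF nilp_H assms(1)] assms(2)]) (auto simp: root_space_def)
qed

lemma finite_roots: "finite (roots H)"
  by (rule finite_subset[OF _ finite_wt[OF nilp_H]]) (use root_wt in blast)

lemma root_dual: "\<beta> \<in> roots H \<Longrightarrow> \<beta> \<in> dual_space H"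
  by (simp add: roots_def)

lemma alpha_root: "i \<in> {1..n} \<Longrightarrow> \<alpha> i \<in> roots H"
  using simple_roots by blast

lemma alpha_dual: "i \<in> {1..n} \<Longrightarrow> \<alpha> i \<in> dual_space H"
  using alpha_root root_dual by blast

lemma dual_add: "\<mu> \<in> dual_space H \<Longrightarrow> x \<in> H \<Longrightarrow> y \<in> H \<Longrightarrow> \<mu> (x + y) = \<mu> x + \<mu> y"
  and dual_scale: "\<mu> \<in> dual_space H \<Longrightarrow> x \<in> H \<Longrightarrow> \<mu> (c *s x) = c * \<mu> x"
  and dual_outside: "\<mu> \<in> dual_space H \<Longrightarrow> x \<notin> H \<Longrightarrow> \<mu> x = 0"
  by (simp_all add: dual_space_def)

lemma dual_0: "\<mu> \<in> dual_space H \<Longrightarrow> \<mu> 0 = 0"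
  using dual_scale[of \<mu> 0 0] subspace_0[OF subspace_H] by simp

lemma dual_diff: assumes "\<mu> \<in> dual_space H" "x \<in> H" "y \<in> H" shows "\<mu> (x - y) = \<mu> x - \<mu> y"
  using dual_add[OF assms(1,2), of "-1 *s y"] dual_scale[OF assms(1,3), of "-1"] subspace_neg[OF subspace_H assms(3)]
  by simp

lemma dual_sum:
  assumes "\<mu> \<in> dual_space H" "\<And>i. i \<in> I \<Longrightarrow> w i \<in> H"
  shows "\<mu> (\<Sum>i\<in>I. c i *s w i) = (\<Sum>i\<in>I. c i * \<mu> (w i))"
  using assms(2)
proof (induction I rule: infinite_finite_induct)
  case (insert k K)
  have "(\<Sum>k\<in>K. c k *s w k) \<in> H"
    using insert.prems by (intro subspace_sum[OF subspace_H] subspace_scale[OF subspace_H]) auto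
  then show ?case using insert by (simp add: dual_add[OF assms(1)] dual_scale[OF assms(1)] subspace_scale[OF subspace_H])
qed (simp_all add: dual_0[OF assms(1)])

lemma alpha_independent:
  assumes "\<And>x. x \<in> H \<Longrightarrow> (\<Sum>i\<in>{1..n}. u i * \<alpha> i x) = 0" shows "\<forall>i\<in>{1..n}. u i = 0"
proof -
  interpret fs: module "\<lambda>c (\<mu> :: 'g \<Rightarrow> complex) x. c * \<mu> x"
    by unfold_locales (auto simp: fun_eq_iff algebra_simps)
  define u' where "u' \<mu> = u (the_inv_into {1..n} \<alpha> \<mu>)" for \<mu>
  have u': "u' (\<alpha> i) = u i" if "i \<in> {1..n}" for i
    unfolding u'_def using the_inv_into_f_f[OF simple_roots_inj that] by simp
  have "(\<Sum>\<mu>\<in>\<alpha> ` {1..n}. (\<lambda>x. u' \<mu> * \<mu> x)) = (\<Sum>i\<in>{1..n}. (\<lambda>x. u' (\<alpha> i) * \<alpha> i x))"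
    by (subst sum.reindex[OF simple_roots_inj]) simp
  also have "\<dots> = 0"
  proof
    fix x
    have "(\<Sum>i\<in>{1..n}. (\<lambda>x. u' (\<alpha> i) * \<alpha> i x)) x = (\<Sum>i\<in>{1..n}. u i * \<alpha> i x)"
      unfolding sum_function_apply using u' by simp
    also have "\<dots> = 0"
      using assms[of x] dual_outside[OF alpha_dual] by (cases "x \<in> H") auto
    finally show "(\<Sum>i\<in>{1..n}. (\<lambda>x. u' (\<alpha> i) * \<alpha> i x)) x = 0 x" by simp
  qed
  finally have z: "(\<Sum>\<mu>\<in>\<alpha> ` {1..n}. (\<lambda>x. u' \<mu> * \<mu> x)) = 0" .
  have "u' \<mu> = 0" if "\<mu> \<in> \<alpha> ` {1..n}" for \<mu>
    using fs.independentD[OF simple_roots_independent _ order_refl z that] by simp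
  then show ?thesis using u' by auto
qed

text \<open>Fundamental coweights: evaluating at them reads off the coefficients of a root in the
  simple roots.\<close>

definition cw :: "nat \<Rightarrow> 'g" where
  "cw = (SOME h. \<forall>j\<in>{1..n}. h j \<in> H \<and> (\<forall>i\<in>{1..n}. \<alpha> i (h j) = (if i = j then 1 else 0)))"

lemma cw_props: "\<forall>j\<in>{1..n}. cw j \<in> H \<and> (\<forall>i\<in>{1..n}. \<alpha> i (cw j) = (if i = j then 1 else 0))"
proof -
  have "\<exists>h. \<forall>j\<in>{1..n}. h j \<in> H \<and> (\<forall>i\<in>{1..n}. \<alpha> i (h j) = (if i = j then 1 else 0))"
    by (rule dual_vectors[OF subspace_H]) (simp, rule alpha_dual, assumption, rule alpha_independent, assumption)
  from someI_ex[OF this] show ?thesis unfolding cw_def .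
qed

lemma cw_H: "j \<in> {1..n} \<Longrightarrow> cw j \<in> H"
  using cw_props by blast

lemma alpha_cw: "i \<in> {1..n} \<Longrightarrow> j \<in> {1..n} \<Longrightarrow> \<alpha> i (cw j) = (if i = j then 1 else 0)"
  using cw_props by blast

lemma combination_cw:
  assumes "\<beta> = (\<lambda>x. \<Sum>i=1..n. c i * \<alpha> i x)" "j \<in> {1..n}" shows "\<beta> (cw j) = c j"
proof -
  have "\<beta> (cw j) = (\<Sum>i=1..n. if i = j then c i else 0)"
    unfolding assms(1) using assms(2) by (intro sum.cong) (auto simp: alpha_cw)
  then show ?thesis using assms(2) by simp
qed

text \<open>Positive roots recognized by their values at the coweights, which turns sign arguments
  into statements on single coefficients.\<close>

definition posr :: "('g \<Rightarrow> complex) set" where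
  "posr = {\<beta> \<in> roots H. \<forall>i\<in>{1..n}. \<beta> (cw i) \<in> \<nat>}"

definition negr :: "('g \<Rightarrow> complex) set" where
  "negr = {\<beta> \<in> roots H. \<forall>i\<in>{1..n}. - \<beta> (cw i) \<in> \<nat>}"

lemma root_expand: assumes "\<beta> \<in> roots H" shows "\<beta> = (\<lambda>x. \<Sum>i=1..n. \<beta> (cw i) * \<alpha> i x)" "\<beta> \<in> posr \<union> negr"
proof -
  obtain c :: "nat \<Rightarrow> nat" where c: "\<beta> = (\<lambda>x. \<Sum>i=1..n. of_nat (c i) * \<alpha> i x) \<or>
      \<beta> = - (\<lambda>x. \<Sum>i=1..n. of_nat (c i) * \<alpha> i x)"
    using simple_roots_base[OF assms] by blast
  have "\<exists>d. \<beta> = (\<lambda>x. \<Sum>i=1..n. d i * \<alpha> i x) \<and> ((\<forall>i. d i \<in> \<nat>) \<or> (\<forall>i. - d i \<in> \<nat>))"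
    using c
  proof
    assume "\<beta> = - (\<lambda>x. \<Sum>i=1..n. of_nat (c i) * \<alpha> i x)"
    then have "\<beta> = (\<lambda>x. \<Sum>i=1..n. (- of_nat (c i)) * \<alpha> i x)" by (auto simp: fun_eq_iff sum_negf)
    then show ?thesis by (intro exI[of _ "\<lambda>i. - of_nat (c i)"]) auto
  qed (intro exI[of _ "\<lambda>i. of_nat (c i)"], auto)
  then obtain d where d: "\<beta> = (\<lambda>x. \<Sum>i=1..n. d i * \<alpha> i x)" "(\<forall>i. d i \<in> \<nat>) \<or> (\<forall>i. - d i \<in> \<nat>)" by blast
  have e: "\<beta> (cw i) = d i" if "i \<in> {1..n}" for i by (rule combination_cw[OF d(1) that])
  then show "\<beta> = (\<lambda>x. \<Sum>i=1..n. \<beta> (cw i) * \<alpha> i x)" by (subst d(1)) simp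
  show "\<beta> \<in> posr \<union> negr" using d(2) e assms by (auto simp: posr_def negr_def)
qed

lemma nat_neg_zero: assumes "(x::complex) \<in> \<nat>" "- x \<in> \<nat>" shows "x = 0"
proof -
  obtain a b where ab: "x = of_nat a" "- x = of_nat b" using assms by (elim Nats_cases)
  have "of_nat (a + b) = x + - x" unfolding of_nat_add ab(1)[symmetric] ab(2)[symmetric] ..
  then have "a + b = 0" by (simp only: add.right_inverse of_nat_eq_0_iff)
  then show ?thesis using ab(1) by simp
qed

lemma pos_neg_disjoint: "posr \<inter> negr = {}"
proof -
  have False if "\<beta> \<in> posr" "\<beta> \<in> negr" for \<beta>
  proof -
    have "\<beta> (cw i) = 0" if i: "i \<in> {1..n}" for i
      by (rule nat_neg_zero) (use \<open>\<beta> \<in> posr\<close> \<open>\<beta> \<in> negr\<close> i in \<open>auto simp: posr_def negr_def\<close>)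
    moreover have r: "\<beta> \<in> roots H" using \<open>\<beta> \<in> posr\<close> by (simp add: posr_def)
    ultimately have "\<beta> = 0" using root_expand(1)[OF r] by (simp add: fun_eq_iff)
    then show False using root_wt(2)[OF r] by blast
  qed
  then show ?thesis by blast
qed

lemma alpha_pos: "i \<in> {1..n} \<Longrightarrow> \<alpha> i \<in> posr"
  using alpha_root by (auto simp: posr_def alpha_cw)

lemma e_gs: "i \<in> {1..n} \<Longrightarrow> e i \<in> gs H (\<alpha> i)"
  and f_gs: "i \<in> {1..n} \<Longrightarrow> f i \<in> gs H (- \<alpha> i)"
  using e_root_vector f_root_vector root_space_gs by blast+

lemma coroot_H: assumes "i \<in> {1..n}" shows "coroot i \<in> H"
  using gs_br[OF e_gs[OF assms] f_gs[OF assms]] by (simp add: coroot_def gs_zero)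

lemma alpha_coroot: "i \<in> {1..n} \<Longrightarrow> \<alpha> i (coroot i) = 2"
  by (simp add: coroot_def e_f_normalized)

lemma br_H_e: "i \<in> {1..n} \<Longrightarrow> h \<in> H \<Longrightarrow> br h (e i) = \<alpha> i h *s e i"
  and br_H_f: "i \<in> {1..n} \<Longrightarrow> h \<in> H \<Longrightarrow> br h (f i) = - (\<alpha> i h *s f i)"
  using e_root_vector f_root_vector by (auto simp: root_space_def)

lemma e_ad_nil: "i \<in> {1..n} \<Longrightarrow> ad_nil (e i)"
  using ad_root_nilpotent[OF nilp_H e_gs] root_wt[OF alpha_root] wt_supported[OF nilp_H] by (auto simp: ad_nil_def)

lemma f_ad_nil: assumes "i \<in> {1..n}" shows "ad_nil (f i)"
proof -
  have "- \<alpha> i \<in> supported H" "- \<alpha> i \<noteq> 0"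
    using root_wt[OF alpha_root[OF assms]] wt_supported[OF nilp_H] by (auto simp: supported_def)
  then show ?thesis using ad_root_nilpotent[OF nilp_H f_gs[OF assms]] by (auto simp: ad_nil_def)
qed

subsection \<open>Simple reflections as automorphisms\<close>

text \<open>At s = 1 the classical lift exp (ad e) exp (- ad f) exp (ad e) of a simple
  reflection.\<close>

definition refl :: "nat \<Rightarrow> complex \<Rightarrow> 'g \<Rightarrow> 'g" where
  "refl i s = (\<lambda>v. xp (e i) s (xp (f i) (- s) (xp (e i) s v)))"

lemma refl_automorphism: "i \<in> {1..n} \<Longrightarrow> lie_automorphism (refl i s)"
  using automorphism_comp[OF xp_automorphism[OF e_ad_nil] automorphism_comp[OF xp_automorphism[OF f_ad_nil] xp_automorphism[OF e_ad_nil]]]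
  by (simp add: refl_def comp_def)

lemma refl_0: "i \<in> {1..n} \<Longrightarrow> refl i 0 v = v"
  by (simp add: refl_def xp_0 e_ad_nil f_ad_nil)

lemma entop_refl: "entop (refl i)"
proof -
  have 1: "entop (\<lambda>s. xp (e i) s)" "entop (\<lambda>s. xp (f i) (- s))"
    by (rule entop_xp, intro holomorphic_intros) (rule entop_xp, intro holomorphic_intros)
  show ?thesis
    using entop_comp[OF 1(1) entop_comp[OF 1(2) 1(1)]] by (simp only: refl_def[abs_def])
qed

lemma refl_H: assumes i: "i \<in> {1..n}" and h: "h \<in> H" shows "refl i 1 h = h - \<alpha> i h *s coroot i"
proof -
  let ?a = "\<alpha> i h" and ?c = "coroot i"
  have ce: "br ?c (e i) = 2 *s e i" and cf: "br ?c (f i) = - (2 *s f i)"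
    using br_H_e[OF i coroot_H[OF i]] br_H_f[OF i coroot_H[OF i]] alpha_coroot[OF i] by auto
  have ec: "br (e i) ?c = - (2 *s e i)" and fc: "br (f i) ?c = 2 *s f i"
    using br_anti[of "e i" ?c] br_anti[of "f i" ?c] ce cf by auto
  have ef: "br (e i) (f i) = ?c" and fe: "br (f i) (e i) = - ?c"
    using br_anti[of "f i" "e i"] by (auto simp: coroot_def)
  have eh: "br (e i) h = - (?a *s e i)" and fh: "br (f i) h = ?a *s f i"
    using br_anti[of "e i" h] br_anti[of "f i" h] br_H_e[OF i h] br_H_f[OF i h] by auto
  note ne = e_ad_nil[OF i] and nf = f_ad_nil[OF i]
  have xe_h: "xp (e i) 1 h = h - ?a *s e i"
    by (subst xp_2[OF ne]) (simp_all add: eh br_minus_right br_scale_right br_self)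
  have xe_e: "xp (e i) 1 (e i) = e i" by (rule xp_1[OF ne br_self])
  have xe_c: "xp (e i) 1 ?c = ?c - 2 *s e i"
    by (subst xp_2[OF ne]) (simp_all add: ec br_minus_right br_scale_right br_self)
  have xf_h: "xp (f i) (- 1) h = h - ?a *s f i"
    by (subst xp_2[OF nf]) (simp_all add: fh br_scale_right br_self)
  have xf_e: "xp (f i) (- 1) (e i) = e i + ?c - f i"
    by (subst xp_3[OF nf]) (simp_all add: fe fc br_minus_right br_scale_right br_self)
  have 1: "xp (f i) (- 1) (h - ?a *s e i) = h - ?a *s (e i + ?c)"
    by (simp add: lin_diff[OF lin_xp] lin_scale[OF lin_xp] xf_h xf_e scale_right_diff_distrib scale_right_distrib)
  have "xp (e i) 1 (h - ?a *s (e i + ?c)) = h - ?a *s ?c"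
    by (simp add: lin_diff[OF lin_xp] lin_scale[OF lin_xp] lin_add[OF lin_xp] xe_h xe_e xe_c
        scale_right_diff_distrib scale_right_distrib algebra_simps scale_left_distrib[symmetric])
  then show ?thesis by (simp add: refl_def xe_h 1)
qed

definition cartan_automorphism :: "('g \<Rightarrow> 'g) \<Rightarrow> bool" where
  "cartan_automorphism \<phi> \<longleftrightarrow> lie_automorphism \<phi> \<and> \<phi> ` H = H"

lemma cartan_automorphism_root:
  assumes \<phi>: "cartan_automorphism \<phi>" and \<mu>: "\<mu> \<in> dual_space H" "\<And>h. h \<in> H \<Longrightarrow> \<mu> (\<phi> h) = \<beta> h" and \<beta>: "\<beta> \<in> roots H"
  shows "\<mu> \<in> roots H"
proof -
  have a: "lie_automorphism \<phi>" and H: "\<phi> ` H = H" using \<phi> by (auto simp: cartan_automorphism_def)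
  obtain v where v: "v \<in> root_space H \<beta>" "v \<noteq> 0"
    using \<beta> unfolding roots_def root_space_def by fastforce
  have "\<phi> v \<in> root_space H \<mu>"
    unfolding root_space_def
  proof safe
    fix h assume "h \<in> H"
    then obtain k where k: "k \<in> H" "h = \<phi> k" using H by blast
    have "br h (\<phi> v) = \<phi> (br k v)" unfolding k(2) automorphism_br[OF a] ..
    also have "br k v = \<beta> k *s v" using v(1) k(1) by (simp add: root_space_def)
    finally show "br h (\<phi> v) = \<mu> h *s \<phi> v" using k \<mu>(2) lin_scale[OF automorphism_lin[OF a]] by simp
  qed
  moreover have "\<phi> v \<noteq> 0"
    using automorphism_bij[OF a] v(2) lin_0[OF automorphism_lin[OF a]] by (metis bij_is_inj injD)
  moreover have "\<mu> \<noteq> 0"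
  proof
    assume "\<mu> = 0"
    then have "\<beta> h = 0" for h using \<mu>(2)[of h] dual_outside[OF root_dual[OF \<beta>]] by (cases "h \<in> H") auto
    then show False using root_wt(2)[OF \<beta>] by (auto simp: fun_eq_iff)
  qed
  ultimately show ?thesis using rootI \<mu>(1) by blast
qed

lemma simple_reflection_dual: assumes "i \<in> {1..n}" "\<mu> \<in> dual_space H" shows "simple_reflection i \<mu> \<in> dual_space H"
  using assms(2) alpha_dual[OF assms(1)] by (auto simp: simple_reflection_def dual_space_def algebra_simps)

lemma refl_H_image: assumes i: "i \<in> {1..n}" shows "refl i 1 ` H = H"
proof
  have s: "refl i 1 h \<in> H" if "h \<in> H" for h
    using refl_H[OF i that] that coroot_H[OF i] subspace_H by (simp add: subspace_diff subspace_scale)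
  then show "refl i 1 ` H \<subseteq> H" by blast
  show "H \<subseteq> refl i 1 ` H"
  proof
    fix h assume h: "h \<in> H"
    have "\<alpha> i (refl i 1 h) = - \<alpha> i h"
      using refl_H[OF i h] h coroot_H[OF i] alpha_coroot[OF i]
      by (simp add: dual_diff[OF alpha_dual[OF i]] dual_scale[OF alpha_dual[OF i]] subspace_scale[OF subspace_H])
    then have "refl i 1 (refl i 1 h) = h" using refl_H[OF i s[OF h]] refl_H[OF i h] by simp
    then show "h \<in> refl i 1 ` H" using s[OF h] by (metis imageI)
  qed
qed

lemma refl_cartan: "i \<in> {1..n} \<Longrightarrow> cartan_automorphism (refl i 1)"
  by (simp add: cartan_automorphism_def refl_automorphism refl_H_image)

lemma simple_reflection_refl:
  assumes i: "i \<in> {1..n}" and \<mu>: "\<mu> \<in> dual_space H" and h: "h \<in> H"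
  shows "simple_reflection i \<mu> (refl i 1 h) = \<mu> h"
  unfolding refl_H[OF i h] using h coroot_H[OF i] alpha_coroot[OF i]
  by (simp add: simple_reflection_def dual_diff[OF alpha_dual[OF i]] dual_scale[OF alpha_dual[OF i]]
      dual_diff[OF \<mu>] dual_scale[OF \<mu>] subspace_scale[OF subspace_H] algebra_simps)

lemma simple_reflection_root:
  assumes "i \<in> {1..n}" "\<beta> \<in> roots H" shows "simple_reflection i \<beta> \<in> roots H"
  by (rule cartan_automorphism_root[OF refl_cartan simple_reflection_dual simple_reflection_refl])
    (use assms root_dual in blast)+

text \<open>For i \<noteq> j the reflection of \<alpha> j in the i-th simple root is again a root,
  so its coefficients are integers, and the i-th one is minus the number in question.\<close>

lemma coroot_int: assumes i: "i \<in> {1..n}" and j: "j \<in> {1..n}" shows "\<alpha> j (coroot i) \<in> \<int>"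
proof (cases "i = j")
  case True
  then show ?thesis using alpha_coroot[OF i] by simp
next
  case False
  let ?b = "simple_reflection i (\<alpha> j)"
  have "?b \<in> posr \<union> negr" by (rule root_expand(2)[OF simple_reflection_root[OF i alpha_root[OF j]]])
  then have "?b (cw i) \<in> \<int>"
  proof
    assume "?b \<in> negr"
    then have "- ?b (cw i) \<in> \<int>" using i Nats_subset_Ints unfolding negr_def by blast
    then show ?thesis using Ints_minus by fastforce
  qed (use i Nats_subset_Ints in \<open>auto simp: posr_def\<close>)
  moreover have "?b (cw i) = - \<alpha> j (coroot i)"
    using i j False by (simp add: simple_reflection_def alpha_cw)
  ultimately show ?thesis using Ints_minus by fastforce
qed

lemma root_coroot_int: assumes i: "i \<in> {1..n}" and \<beta>: "\<beta> \<in> roots H" shows "\<beta> (coroot i) \<in> \<int>"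
proof -
  have "\<beta> (cw j) \<in> \<int>" if "j \<in> {1..n}" for j
  proof -
    have "\<beta> (cw j) \<in> \<nat> \<or> - \<beta> (cw j) \<in> \<nat>"
      using root_expand(2)[OF \<beta>] that unfolding posr_def negr_def by blast
    then show ?thesis using Nats_subset_Ints minus_in_Ints_iff by blast
  qed
  then have "(\<Sum>j=1..n. \<beta> (cw j) * \<alpha> j (coroot i)) \<in> \<int>"
    by (intro Ints_sum Ints_mult coroot_int[OF i])
  then show ?thesis using root_expand(1)[OF \<beta>] by metis
qed

subsection \<open>Nondegeneracy of the Killing form\<close>

lemma kf_diagonal: assumes h: "h \<in> H" shows "kf h h = (\<Sum>\<kappa>\<in>wt H. \<kappa> h * \<kappa> h * of_nat (dim (gs H \<kappa>)))"
proof -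
  have "tr (\<lambda>v. br h (br h (prw H \<kappa> v))) = \<kappa> h * \<kappa> h * of_nat (dim (gs H \<kappa>))" if \<kappa>: "\<kappa> \<in> wt H" for \<kappa>
  proof -
    have st: "br h ` gs H l \<subseteq> gs H l" for l using br_gs[OF nilp_H h] by blast
    have sub: "gs H \<kappa> \<subseteq> gen (br h) (\<kappa> h)" using h by (auto simp: jgen_def)
    have "tr (\<lambda>v. (br h ^^ 1) (br h (prw H \<kappa> v))) = \<kappa> h ^ 1 * \<kappa> h * of_nat (dim (gs H \<kappa>))"
      by (rule tr_funpow_ad[where F = "br h" and G = "br h", OF ds[OF nilp_H] \<kappa> lin_br lin_br refl])
        (rule st sub)+
    then show ?thesis by simp
  qed
  then show ?thesis unfolding kf_def tr_dsum[OF ds[OF nilp_H] lin_comp[OF lin_br lin_br]] by simp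
qed

lemma kf_sum_left: "kf (\<Sum>i\<in>I. c i *s w i) x = (\<Sum>i\<in>I. c i * kf (w i) x)"
proof (induction I rule: infinite_finite_induct)
  case empty
  show ?case using kf_scale_left[of 0 0 x] by simp
next
  case (infinite I)
  then show ?case using kf_scale_left[of 0 0 x] by simp
qed (simp add: kf_add_left kf_scale_left)

lemma kf_sum_right: "kf x (\<Sum>i\<in>I. c i *s w i) = (\<Sum>i\<in>I. c i * kf x (w i))"
  unfolding kf_sym[of x] by (rule kf_sum_left)

lemma kf_coroot: assumes "i \<in> {1..n}" "h \<in> H" shows "kf h (coroot i) = \<alpha> i h * kf (e i) (f i)"
  unfolding coroot_def kf_invariant[symmetric] br_H_e[OF assms] kf_scale_left ..

text \<open>All weights take integer values at the coroot. Its Killing square is thus a sum of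
  integer squares with multiplicities, where \<alpha> i contributes 4 times a positive dimension; by
  \<open>kf_coroot\<close> this square is also twice the number in question.\<close>

lemma kf_e_f: assumes i: "i \<in> {1..n}" shows "kf (e i) (f i) \<noteq> 0"
proof
  assume z: "kf (e i) (f i) = 0"
  let ?c = "coroot i"
  have "\<kappa> ?c \<in> \<int>" if "\<kappa> \<in> wt H" for \<kappa>
    using root_coroot_int[OF i wt_root[OF that]] by (cases "\<kappa> = 0") auto
  then have "\<forall>\<kappa>\<in>wt H. \<exists>z. \<kappa> ?c = of_int z" by (metis Ints_cases)
  then obtain z where z: "\<And>\<kappa>. \<kappa> \<in> wt H \<Longrightarrow> \<kappa> ?c = of_int (z \<kappa>)" by metis
  let ?d = "\<lambda>\<kappa>. int (dim (gs H \<kappa>))"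
  have "kf ?c ?c = of_int (\<Sum>\<kappa>\<in>wt H. z \<kappa> * z \<kappa> * ?d \<kappa>)"
    unfolding kf_diagonal[OF coroot_H[OF i]] of_int_sum by (intro sum.cong refl) (simp add: z)
  moreover have "kf ?c ?c = 0" using kf_coroot[OF i coroot_H[OF i]] \<open>kf (e i) (f i) = 0\<close> by simp
  ultimately have s0: "(\<Sum>\<kappa>\<in>wt H. z \<kappa> * z \<kappa> * ?d \<kappa>) = 0" by (metis of_int_eq_0_iff)
  have "z (\<alpha> i) * z (\<alpha> i) * ?d (\<alpha> i) = 0"
    using sum_nonneg_0[OF finite_wt[OF nilp_H] _ s0 root_wt(1)[OF alpha_root[OF i]]] by simp
  then have "z (\<alpha> i) = 0" using dim_gs[OF nilp_H root_wt(1)[OF alpha_root[OF i]]] by (simp del: dim_eq_0)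
  then show False using z[OF root_wt(1)[OF alpha_root[OF i]]] alpha_coroot[OF i] by simp
qed

lemma root_vanish: assumes "\<And>i. i \<in> {1..n} \<Longrightarrow> \<alpha> i h = 0" "\<kappa> \<in> wt H" shows "\<kappa> h = 0"
proof (cases "\<kappa> = 0")
  case False
  have "\<kappa> h = (\<Sum>i=1..n. \<kappa> (cw i) * \<alpha> i h)"
    using root_expand(1)[OF wt_root[OF assms(2) False]] by metis
  then show ?thesis using assms(1) by simp
qed simp

text \<open>The radical \<open>N\<close> of the form is an ideal. Its elements in \<open>H\<close>
  are killed by all simple roots, since \<open>kf_e_f\<close> excludes the other factor. So every
  weight component of \<open>N\<close> acts nilpotently, and Engel's theorem gives a nonzero vector
  of \<open>N\<close> commuting with \<open>N\<close>. The center of \<open>N\<close> would be a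
  nonzero abelian ideal, against semisimplicity.\<close>

lemma killing_nondegenerate: assumes "\<And>y. kf x y = 0" shows "x = 0"
proof -
  define N where "N = {x. \<forall>y. kf x y = 0}"
  have sN: "subspace N"
    using kf_scale_left[of 0 0] by (auto simp: N_def subspace_def kf_add_left kf_scale_left)
  have ideal: "br z x \<in> N" if "x \<in> N" for x z
    using that kf_invariant[of x z] br_anti[of z x] kf_scale_left[of "-1" "br x z"] by (simp add: N_def)
  have ideal': "br x z \<in> N" if "x \<in> N" for x z
    using that by (simp add: N_def kf_invariant)
  have N_H: "\<kappa> h = 0" if h: "h \<in> N" "h \<in> H" and \<kappa>: "\<kappa> \<in> wt H" for h \<kappa>
  proof (rule root_vanish[OF _ \<kappa>])
    fix i assume i: "i \<in> {1..n}"
    then show "\<alpha> i h = 0" using h(1) kf_coroot[OF i h(2)] kf_e_f[OF i] by (auto simp: N_def)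
  qed
  \<comment> \<open>A union of weight components, closed under brackets though not under sums:
    Engel's theorem for sets is aimed at this case.\<close>
  define X where "X = insert 0 (\<Union>\<kappa>\<in>wt H. N \<inter> gs H \<kappa>)"
  have "closed_set X"
    unfolding closed_set_def
  proof (intro conjI ballI)
    show "0 \<in> X" by (simp add: X_def)
    fix x y assume "x \<in> X" "y \<in> X"
    then consider "x = 0 \<or> y = 0" | \<kappa> \<mu> where "\<kappa> \<in> wt H" "\<mu> \<in> wt H" "x \<in> N" "x \<in> gs H \<kappa>" "y \<in> gs H \<mu>"
      unfolding X_def by blast
    then show "br x y \<in> X"
    proof cases
      case 2
      have b: "br x y \<in> gs H (\<kappa> + \<mu>)" "br x y \<in> N" using gs_br 2 ideal' by blast+
      have sup: "\<kappa> + \<mu> \<in> supported H" using 2 wt_supported[OF nilp_H] supported_add by blast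
      show ?thesis
      proof (cases "\<kappa> + \<mu> \<in> wt H")
        case False
        then show ?thesis using gs_empty[OF nilp_H sup] b by (simp add: X_def)
      qed (use b in \<open>auto simp: X_def\<close>)
    qed (auto simp: X_def)
  qed
  moreover have "nil_rep X br N {0}"
  proof (rule nil_repI)
    fix x assume "x \<in> X"
    then consider "x = 0" | \<kappa> where "\<kappa> \<in> wt H" "x \<in> N" "x \<in> gs H \<kappa>" unfolding X_def by blast
    then have "\<exists>k. (br x ^^ k) v = 0" for v
    proof cases
      case 1
      then show ?thesis by (intro exI[of _ 1]) simp
    next
      case 2
      show ?thesis
      proof (cases "\<kappa> = 0")
        case True
        then have "x \<in> H" using 2 gs_zero by simp
        have "gs H \<mu> \<subseteq> gen (br x) 0" if "\<mu> \<in> wt H" for \<mu>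
          using N_H[OF 2(2) \<open>x \<in> H\<close> that] \<open>x \<in> H\<close> by (auto simp: jgen_def)
        then have "v \<in> gen (br x) 0" by (rule gs_spans[OF nilp_H subspace_gen[OF lin_br]])
        then show ?thesis by (simp add: gen_def shift_zero)
      next
        case False
        then show ?thesis using ad_root_nilpotent[OF nilp_H 2(3) wt_supported[OF nilp_H 2(1)]] by blast
      qed
    qed
    then show "\<exists>k. (br x ^^ k) v \<in> {0}" for v by blast
    show "br x ` N \<subseteq> N" using ideal by blast
  qed (use sN in \<open>auto simp: lin_br br_add_left br_scale_left br_br subspace_0\<close>)
  ultimately have engel: "N \<noteq> {0} \<Longrightarrow> \<exists>v\<in>N. v \<notin> {0} \<and> (\<forall>x\<in>X. br x v \<in> {0})" by (rule engel_weak)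
  have "N \<subseteq> span X"
  proof -
    have "N \<subseteq> span (\<Union>\<kappa>\<in>supported H. gs H \<kappa> \<inter> N)"
      by (rule joint_decomposition[OF compat[OF nilp_H] sN]) (use ideal in blast)
    also have "\<dots> \<subseteq> span X"
    proof (rule span_mono, rule UN_least)
      fix \<kappa> assume "\<kappa> \<in> supported H"
      then show "gs H \<kappa> \<inter> N \<subseteq> X" using gs_empty[OF nilp_H, of \<kappa>] by (cases "\<kappa> \<in> wt H") (auto simp: X_def)
    qed
    finally show ?thesis .
  qed
  define Z where "Z = {v \<in> N. \<forall>x\<in>N. br x v = 0}"
  have "lie_ideal Z"
    unfolding lie_ideal_def
  proof (intro conjI allI ballI)
    show "subspace Z"
      using sN by (auto simp: Z_def subspace_def br_add_right br_scale_right)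
    fix z v assume v: "v \<in> Z"
    have "br x (br z v) = 0" if "x \<in> N" for x
      using v br_leibniz[of x z v] ideal'[OF that, of z] that by (simp add: Z_def)
    then show "br z v \<in> Z" using v ideal by (simp add: Z_def)
  qed
  moreover have "lie_solvable Z"
  proof -
    have "{br x y | x y. x \<in> Z \<and> y \<in> Z} \<subseteq> {0}" by (auto simp: Z_def)
    then have "br_span Z Z \<subseteq> span {0}" unfolding br_span_def by (rule span_mono)
    then have "br_span Z Z = {0}" using span_zero unfolding br_span_def by auto
    then show ?thesis unfolding lie_solvable_def by (intro exI[of _ 1]) simp
  qed
  ultimately have Z0: "Z = {0}" by (rule semisimple)
  have "N = {0}"
  proof (rule ccontr)
    assume "N \<noteq> {0}"
    then obtain v where v: "v \<in> N" "v \<noteq> 0" "\<forall>x\<in>X. br x v = 0" using engel by blast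
    have "span X \<subseteq> {x. br x v = 0}"
      by (rule span_minimal[OF _ subspace_kernel_lin[OF lin_br_left]]) (use v(3) in blast)
    then have "v \<in> Z" using v(1) \<open>N \<subseteq> span X\<close> by (auto simp: Z_def)
    then show False using Z0 v(2) by blast
  qed
  then show ?thesis using assms by (auto simp: N_def)
qed

lemma kf_H_zero: assumes x: "x \<in> H" and z: "\<And>h. h \<in> H \<Longrightarrow> kf h x = 0" shows "x = 0"
proof (rule killing_nondegenerate)
  fix y
  have "y \<in> {y. kf x y = 0}"
  proof (rule gs_spans[OF nilp_H])
    show "subspace {y. kf x y = 0}"
      using kf_scale_right[of x 0 0] by (auto simp: subspace_def kf_add_right kf_scale_right)
    fix \<kappa> assume \<kappa>: "\<kappa> \<in> wt H"
    show "gs H \<kappa> \<subseteq> {y. kf x y = 0}"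
    proof
      fix y assume y: "y \<in> gs H \<kappa>"
      show "y \<in> {y. kf x y = 0}"
      proof (cases "\<kappa> = 0")
        case True
        then show ?thesis using z[of y] y gs_zero kf_sym by simp
      next
        case False
        have x0: "x \<in> gs H 0" using x gs_zero by simp
        have "kf x y = 0"
          unfolding kf_def using False
          by (intro tr_ad_off[OF nilp_H x0 y zero_supported wt_supported[OF nilp_H \<kappa>]]) simp
        then show ?thesis by simp
      qed
    qed
  qed
  then show "kf x y = 0" by simp
qed

text \<open>Such an element is annihilated by every weight, so by \<open>tr_ad_nilpotent\<close> it
  is Killing-orthogonal to \<open>H\<close>. From here on identities in \<open>H\<close> are checked
  on simple roots.\<close>

lemma H_separated: assumes h: "h \<in> H" and z: "\<And>i. i \<in> {1..n} \<Longrightarrow> \<alpha> i h = 0" shows "h = 0"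
proof (rule kf_H_zero[OF h])
  fix x assume x: "x \<in> H"
  have "kf h x = 0"
    unfolding kf_def by (rule tr_ad_nilpotent[OF nilp_H h _ x]) (rule root_vanish, rule z)
  then show "kf x h = 0" by (simp add: kf_sym)
qed

lemma H_expand: assumes h: "h \<in> H" shows "h = (\<Sum>j=1..n. \<alpha> j h *s cw j)"
proof -
  have s: "(\<Sum>j=1..n. \<alpha> j h *s cw j) \<in> H"
    by (intro subspace_sum[OF subspace_H] subspace_scale[OF subspace_H] cw_H)
  have "h - (\<Sum>j=1..n. \<alpha> j h *s cw j) = 0"
  proof (rule H_separated)
    show "h - (\<Sum>j=1..n. \<alpha> j h *s cw j) \<in> H" using subspace_diff[OF subspace_H h s] .
    fix i assume i: "i \<in> {1..n}"
    have "\<alpha> i (\<Sum>j=1..n. \<alpha> j h *s cw j) = (\<Sum>j=1..n. \<alpha> j h * \<alpha> i (cw j))"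
      by (rule dual_sum[OF alpha_dual[OF i] cw_H])
    also have "\<dots> = (\<Sum>j=1..n. if j = i then \<alpha> j h else 0)"
      using i by (intro sum.cong refl) (auto simp: alpha_cw)
    also have "\<dots> = \<alpha> i h" using i by simp
    finally show "\<alpha> i (h - (\<Sum>j=1..n. \<alpha> j h *s cw j)) = 0" using dual_diff[OF alpha_dual[OF i] h s] by simp
  qed
  then show ?thesis by simp
qed

lemma dual_expand: assumes "\<mu> \<in> dual_space H" shows "\<mu> = (\<lambda>x. \<Sum>j=1..n. \<mu> (cw j) * \<alpha> j x)"
proof
  fix x
  show "\<mu> x = (\<Sum>j=1..n. \<mu> (cw j) * \<alpha> j x)"
  proof (cases "x \<in> H")
    case True
    have "\<mu> (\<Sum>j=1..n. \<alpha> j x *s cw j) = (\<Sum>j=1..n. \<alpha> j x * \<mu> (cw j))" by (rule dual_sum[OF assms cw_H])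
    then show ?thesis using H_expand[OF True] by (simp add: mult.commute)
  next
    case False
    then show ?thesis using dual_outside[OF assms] dual_outside[OF alpha_dual] by simp
  qed
qed

lemma dual_ext: "\<mu> \<in> dual_space H \<Longrightarrow> \<nu> \<in> dual_space H \<Longrightarrow> (\<And>h. h \<in> H \<Longrightarrow> \<mu> h = \<nu> h) \<Longrightarrow> \<mu> = \<nu>"
  by (auto simp: fun_eq_iff) (metis dual_outside)

text \<open>Under the Killing form coroots correspond to multiples of simple roots, and \<phi>
  preserves the form, so \<phi> maps one coroot to a multiple of the other. Evaluating \<alpha> i
  fixes the factor.\<close>

lemma cartan_automorphism_coroot:
  assumes \<phi>: "cartan_automorphism \<phi>" and i: "i \<in> {1..n}" and j: "j \<in> {1..n}"
    and c: "\<And>h. h \<in> H \<Longrightarrow> \<alpha> i (\<phi> h) = c * \<alpha> j h"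
  shows "\<phi> (coroot j) = c *s coroot i"
proof -
  have a: "lie_automorphism \<phi>" and H: "\<phi> ` H = H" using \<phi> by (auto simp: cartan_automorphism_def)
  have pH: "\<phi> (coroot j) \<in> H" using H coroot_H[OF j] by blast
  have "c \<noteq> 0"
  proof
    assume "c = 0"
    obtain k where "k \<in> H" "coroot i = \<phi> k" using H coroot_H[OF i] by blast
    then show False using c[of k] \<open>c = 0\<close> alpha_coroot[OF i] by simp
  qed
  define t where "t = kf (e j) (f j) / (c * kf (e i) (f i))"
  have "\<phi> (coroot j) - t *s coroot i = 0"
  proof (rule kf_H_zero)
    show "\<phi> (coroot j) - t *s coroot i \<in> H"
      using pH coroot_H[OF i] subspace_H by (simp add: subspace_diff subspace_scale)
    fix h assume "h \<in> H"
    then obtain k where k: "k \<in> H" "h = \<phi> k" using H by blast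
    have "kf h (\<phi> (coroot j)) = \<alpha> j k * kf (e j) (f j)"
      using kf_automorphism[OF a] kf_coroot[OF j k(1)] k(2) by simp
    moreover have "kf h (coroot i) = c * \<alpha> j k * kf (e i) (f i)"
      using kf_coroot[OF i \<open>h \<in> H\<close>] c[OF k(1)] k(2) by simp
    moreover have "kf h (- x) = - kf h x" for x using kf_scale_right[of h "-1" x] by simp
    ultimately show "kf h (\<phi> (coroot j) - t *s coroot i) = 0"
      using \<open>c \<noteq> 0\<close> kf_e_f[OF i]
      by (simp add: diff_conv_add_uminus kf_add_right kf_scale_right t_def field_simps del: add_uminus_conv_diff)
  qed
  then have e: "\<phi> (coroot j) = t *s coroot i" by simp
  have "t * 2 = c * 2"
    using c[OF coroot_H[OF j]] e alpha_coroot[OF i] alpha_coroot[OF j] dual_scale[OF alpha_dual[OF i] coroot_H[OF i]] by simp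
  then show ?thesis using e by simp
qed

text \<open>Fundamental weights, as Killing functionals of the coweights; the denominator is the
  factor in \<open>kf_coroot\<close>.\<close>

definition fw :: "nat \<Rightarrow> 'g \<Rightarrow> complex" where
  "fw i = (\<lambda>h. if h \<in> H then kf h (cw i) / kf (e i) (f i) else 0)"

lemma fw_dual: "fw i \<in> dual_space H"
  using subspace_add[OF subspace_H] subspace_scale[OF subspace_H]
  by (auto simp: fw_def dual_space_def kf_add_left kf_scale_left add_divide_distrib)

lemma fw_coroot: assumes "i \<in> {1..n}" "j \<in> {1..n}" shows "fw i (coroot j) = (if i = j then 1 else 0)"
  using kf_coroot[OF assms(2) cw_H[OF assms(1)]] kf_e_f[OF assms(2)] coroot_H[OF assms(2)] assms
  by (auto simp: fw_def kf_sym[of "coroot j"] alpha_cw)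

lemma coroot_expand: assumes h: "h \<in> H" shows "h = (\<Sum>i=1..n. fw i h *s coroot i)"
proof -
  let ?s = "\<Sum>i=1..n. fw i h *s coroot i"
  have s: "?s \<in> H" by (intro subspace_sum[OF subspace_H] subspace_scale[OF subspace_H] coroot_H)
  have d: "h - ?s \<in> H" by (rule subspace_diff[OF subspace_H h s])
  have "\<alpha>' = 0" if "\<alpha>' = kf (h - ?s) (cw j)" "j \<in> {1..n}" for \<alpha>' j
  proof -
    have "kf ?s (cw j) = (\<Sum>i=1..n. fw i h * kf (coroot i) (cw j))" by (rule kf_sum_left)
    also have "\<dots> = (\<Sum>i=1..n. if i = j then fw i h * kf (e i) (f i) else 0)"
      using that(2) by (intro sum.cong refl) (auto simp: kf_sym[of "coroot _"] kf_coroot cw_H alpha_cw)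
    also have "\<dots> = kf h (cw j)" using that(2) h kf_e_f[OF that(2)] by (simp add: fw_def)
    finally have "kf ?s (cw j) = kf h (cw j)" .
    moreover have "kf (- ?s) (cw j) = - kf ?s (cw j)" using kf_scale_left[of "-1" ?s "cw j"] by simp
    ultimately show ?thesis
      using that(1) by (simp add: diff_conv_add_uminus kf_add_left del: add_uminus_conv_diff)
  qed
  then have z: "kf (h - ?s) (cw j) = 0" if "j \<in> {1..n}" for j using that by blast
  have "h - ?s = 0"
  proof (rule kf_H_zero[OF d])
    fix x assume x: "x \<in> H"
    have "kf (h - ?s) (\<Sum>j=1..n. \<alpha> j x *s cw j) = (\<Sum>j=1..n. \<alpha> j x * kf (h - ?s) (cw j))"
      by (rule kf_sum_right)
    also have "\<dots> = 0" by (intro sum.neutral ballI) (simp only: z mult_zero_right)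
    finally have "kf (h - ?s) (\<Sum>j=1..n. \<alpha> j x *s cw j) = 0" .
    then show "kf x (h - ?s) = 0" using H_expand[OF x] kf_sym by metis
  qed
  then show ?thesis by simp
qed

lemma dual_coroot_expand: assumes "\<mu> \<in> dual_space H" "h \<in> H" shows "\<mu> h = (\<Sum>i=1..n. fw i h * \<mu> (coroot i))"
  using dual_sum[OF assms(1) coroot_H, of "{1..n}" "\<lambda>i. i" "\<lambda>i. fw i h"] coroot_expand[OF assms(2)] by simp

subsection \<open>The Weyl group\<close>

text \<open>At s = 1 a lift of \<open>reflection_product\<close> to an automorphism, whose action on
  \<open>H\<close> is contragredient to that of the same word on weights.\<close>

definition word :: "nat list \<Rightarrow> complex \<Rightarrow> 'g \<Rightarrow> 'g" where
  "word is s = foldr (\<lambda>i g. refl i s \<circ> g) is id"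

lemma word_simps [simp]: "word [] s = id" "word (i # is) s = refl i s \<circ> word is s"
  by (simp_all add: word_def)

lemma reflection_product_simps [simp]:
  "reflection_product [] = id" "reflection_product (i # is) = simple_reflection i \<circ> reflection_product is"
  by (simp_all add: reflection_product_def)

lemma reflection_product_append: "reflection_product (is @ js) = reflection_product is \<circ> reflection_product js"
  by (induction "is") auto

lemma word_automorphism: "is \<in> lists {1..n} \<Longrightarrow> lie_automorphism (word is s)"
proof (induction "is")
  case (Cons i "is")
  then show ?case unfolding word_simps by (intro automorphism_comp refl_automorphism) auto
qed (simp add: automorphism_id)

lemma word_cartan: "is \<in> lists {1..n} \<Longrightarrow> cartan_automorphism (word is 1)"
proof (induction "is")
  case (Cons i "is")
  then have "word is 1 ` H = H" "refl i 1 ` H = H" using refl_H_image by (auto simp: cartan_automorphism_def)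
  then have "word (i # is) 1 ` H = H" unfolding word_simps image_comp[symmetric] by (simp only:)
  then show ?case using word_automorphism[OF Cons.prems] by (simp only: cartan_automorphism_def)
qed (simp add: cartan_automorphism_def automorphism_id)

lemma word_0: "is \<in> lists {1..n} \<Longrightarrow> word is 0 = id"
  by (induction "is") (auto simp: refl_0 fun_eq_iff)

lemma entop_word: "entop (word is)"
proof (induction "is")
  case Nil
  have "word [] = (\<lambda>s. id)" by (rule ext) simp
  then show ?case using entop_lin[OF lin_id(2)] by (simp only:)
next
  case (Cons i "is")
  have "word (i # is) = (\<lambda>s v. refl i s (word is s v))" by (intro ext) simp
  then show ?case using entop_comp[OF entop_refl Cons] by (simp only:)
qed

lemma reflection_product_dual: "is \<in> lists {1..n} \<Longrightarrow> \<mu> \<in> dual_space H \<Longrightarrow> reflection_product is \<mu> \<in> dual_space H"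
  by (induction "is") (auto intro!: simple_reflection_dual)

lemma reflection_product_word:
  "is \<in> lists {1..n} \<Longrightarrow> \<mu> \<in> dual_space H \<Longrightarrow> h \<in> H \<Longrightarrow> reflection_product is \<mu> (word is 1 h) = \<mu> h"
proof (induction "is")
  case (Cons i "is")
  have "word is 1 h \<in> H" using word_cartan[of "is"] Cons.prems by (auto simp: cartan_automorphism_def)
  then show ?case using Cons simple_reflection_refl[OF _ reflection_product_dual] by simp
qed simp

lemma reflection_product_root: "is \<in> lists {1..n} \<Longrightarrow> \<beta> \<in> roots H \<Longrightarrow> reflection_product is \<beta> \<in> roots H"
  by (induction "is") (auto intro!: simple_reflection_root)

lemma simple_reflection_linear:
  "simple_reflection i (\<lambda>x. a * \<mu> x + \<nu> x) = (\<lambda>x. a * simple_reflection i \<mu> x + simple_reflection i \<nu> x)"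
  by (simp add: simple_reflection_def algebra_simps fun_eq_iff)

lemma reflection_product_linear:
  "reflection_product is (\<lambda>x. a * \<mu> x + \<nu> x) = (\<lambda>x. a * reflection_product is \<mu> x + reflection_product is \<nu> x)"
  by (induction "is") (simp_all add: simple_reflection_linear)

lemma reflection_product_zero: "reflection_product is (\<lambda>x. 0) = (\<lambda>x. 0)"
  by (induction "is") (simp_all add: simple_reflection_def)

lemma reflection_product_sum:
  "finite I \<Longrightarrow> reflection_product is (\<lambda>x. \<Sum>j\<in>I. c j * \<nu> j x) = (\<lambda>x. \<Sum>j\<in>I. c j * reflection_product is (\<nu> j) x)"
  by (induction I rule: finite_induct) (simp_all add: reflection_product_zero reflection_product_linear)

lemma reflection_product_expand:
  assumes "\<mu> \<in> dual_space H"
  shows "reflection_product is \<mu> = (\<lambda>x. \<Sum>j=1..n. \<mu> (cw j) * reflection_product is (\<alpha> j) x)"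
  using reflection_product_sum[of "{1..n}" "is" "\<lambda>j. \<mu> (cw j)" \<alpha>] dual_expand[OF assms] by simp

lemma reflection_product_fixes:
  "is \<in> lists {1..n} \<Longrightarrow> (\<And>i. i \<in> {1..n} \<Longrightarrow> \<mu> (coroot i) = 0) \<Longrightarrow> reflection_product is \<mu> = \<mu>"
  by (induction "is") (auto simp: simple_reflection_def)

text \<open>Reflections act on all functions, not only on the dual of \<open>H\<close>. Subtracting
  the combination of fundamental weights with the same values at the coroots leaves a function that
  every reflection fixes, so comparing images of simple roots suffices.\<close>

lemma reflection_product_eqI:
  assumes w: "is \<in> lists {1..n}" "js \<in> lists {1..n}"
    and eq: "\<And>j. j \<in> {1..n} \<Longrightarrow> reflection_product is (\<alpha> j) = reflection_product js (\<alpha> j)"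
  shows "reflection_product is = reflection_product js"
proof
  fix \<mu> :: "'g \<Rightarrow> complex"
  define \<mu>' where "\<mu>' = (\<lambda>x. \<Sum>i=1..n. \<mu> (coroot i) * fw i x)"
  have d: "\<mu>' \<in> dual_space H"
    using dual_add[OF fw_dual] dual_scale[OF fw_dual] dual_outside[OF fw_dual]
    by (auto simp: \<mu>'_def dual_space_def sum.distrib distrib_left sum_distrib_left algebra_simps)
  define \<nu> where "\<nu> = (\<lambda>x. \<mu> x - \<mu>' x)"
  have "\<nu> (coroot j) = 0" if j: "j \<in> {1..n}" for j
  proof -
    have "\<mu>' (coroot j) = (\<Sum>i=1..n. if i = j then \<mu> (coroot i) else 0)"
      unfolding \<mu>'_def using j by (intro sum.cong refl) (auto simp: fw_coroot)
    then show ?thesis using j by (simp add: \<nu>_def)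
  qed
  then have \<nu>: "reflection_product ks \<nu> = \<nu>" if "ks \<in> lists {1..n}" for ks
    using reflection_product_fixes[OF that] by blast
  have \<mu>: "\<mu> = (\<lambda>x. 1 * \<mu>' x + \<nu> x)" by (simp add: \<nu>_def)
  have "reflection_product is \<mu>' = reflection_product js \<mu>'"
    unfolding reflection_product_expand[OF d] using eq by (intro ext sum.cong) auto
  then show "reflection_product is \<mu> = reflection_product js \<mu>"
    by (subst (1 2) \<mu>) (simp only: reflection_product_linear \<nu>[OF w(1)] \<nu>[OF w(2)])
qed

text \<open>An element is determined by the images of the simple roots, which lie in the finite set
  of roots.\<close>

lemma finite_weyl_group: assumes "J \<subseteq> {1..n}" shows "finite (weyl_group J)"
proof -
  let ?r = "\<lambda>w. restrict (\<lambda>j. w (\<alpha> j)) {1..n}"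
  have "inj_on ?r (weyl_group J)"
  proof (rule inj_onI)
    fix w w' assume "w \<in> weyl_group J" "w' \<in> weyl_group J" and r: "?r w = ?r w'"
    then obtain "is" js where i: "is \<in> lists {1..n}" "w = reflection_product is" "js \<in> lists {1..n}" "w' = reflection_product js"
      unfolding weyl_group_def using lists_mono[OF assms] by blast
    have "w (\<alpha> j) = w' (\<alpha> j)" if "j \<in> {1..n}" for j
      using fun_cong[OF r, of j] that by simp
    then show "w = w'" using reflection_product_eqI[OF i(1,3)] i by simp
  qed
  moreover have "?r ` weyl_group J \<subseteq> {1..n} \<rightarrow>\<^sub>E roots H"
  proof
    fix g assume "g \<in> ?r ` weyl_group J"
    then obtain "is" where i: "is \<in> lists {1..n}" "g = ?r (reflection_product is)"
      unfolding weyl_group_def using lists_mono[OF assms] by blast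
    then show "g \<in> {1..n} \<rightarrow>\<^sub>E roots H" using reflection_product_root[OF i(1) alpha_root] by auto
  qed
  moreover have "finite ({1..n} \<rightarrow>\<^sub>E roots H)" by (intro finite_PiE finite_atLeastAtMost finite_roots)
  ultimately show ?thesis using finite_imageD finite_subset by blast
qed

lemma simple_reflection_simple_reflection: "i \<in> {1..n} \<Longrightarrow> simple_reflection i (simple_reflection i \<mu>) = \<mu>"
  by (simp add: simple_reflection_def fun_eq_iff alpha_coroot algebra_simps)

lemma simple_reflection_cw: "i \<in> {1..n} \<Longrightarrow> j \<in> {1..n} \<Longrightarrow> simple_reflection i \<beta> (cw j) = \<beta> (cw j) - (if i = j then \<beta> (coroot i) else 0)"
  by (simp add: simple_reflection_def alpha_cw)

text \<open>A simple reflection changes a single coefficient, so a positive root that turns negative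
  has no other nonzero coefficient.\<close>

lemma sign_change_multiple:
  assumes i: "i \<in> {1..n}" and \<beta>: "\<beta> \<in> posr" and neg: "simple_reflection i \<beta> \<in> negr"
  shows "\<beta> = (\<lambda>x. \<beta> (cw i) * \<alpha> i x)" "\<beta> (cw i) \<noteq> 0"
proof -
  have r: "\<beta> \<in> roots H" using \<beta> by (simp add: posr_def)
  have z: "\<beta> (cw j) = 0" if j: "j \<in> {1..n}" "j \<noteq> i" for j
  proof (rule nat_neg_zero)
    show "\<beta> (cw j) \<in> \<nat>" using \<beta> j by (simp add: posr_def)
    have "- simple_reflection i \<beta> (cw j) \<in> \<nat>" using neg j(1) unfolding negr_def by blast
    then show "- \<beta> (cw j) \<in> \<nat>" using j simple_reflection_cw[OF i j(1), of \<beta>] by simp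
  qed
  show e: "\<beta> = (\<lambda>x. \<beta> (cw i) * \<alpha> i x)"
  proof
    fix x
    have "\<beta> x = (\<Sum>j=1..n. \<beta> (cw j) * \<alpha> j x)" using root_expand(1)[OF r] by metis
    also have "\<dots> = (\<Sum>j=1..n. if j = i then \<beta> (cw j) * \<alpha> j x else 0)"
      using z by (intro sum.cong refl) auto
    finally show "\<beta> x = \<beta> (cw i) * \<alpha> i x" using i by simp
  qed
  show "\<beta> (cw i) \<noteq> 0"
  proof
    assume "\<beta> (cw i) = 0"
    then have "\<beta> = 0" by (subst e) (simp add: fun_eq_iff)
    then show False using root_wt(2)[OF r] by blast
  qed
qed

text \<open>If \<open>w \<alpha>\<^sub>j = c \<alpha>\<^sub>i\<close>, then \<open>w s\<^sub>j = s\<^sub>i w\<close>, because the Killing form identifies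
  \<open>w\<close> of the \<open>j\<close>-th coroot with a multiple of the \<open>i\<close>-th.\<close>

lemma reflection_conjugate:
  assumes w: "is \<in> lists {1..n}" and i: "i \<in> {1..n}" and j: "j \<in> {1..n}" and c: "c \<noteq> 0"
    and eq: "reflection_product is (\<alpha> j) = (\<lambda>x. c * \<alpha> i x)"
  shows "reflection_product (is @ [j]) = reflection_product (i # is)"
proof (rule reflection_product_eqI)
  show "is @ [j] \<in> lists {1..n}" "i # is \<in> lists {1..n}" using w i j by auto
  fix k assume k: "k \<in> {1..n}"
  let ?w = "reflection_product is" and ?\<phi> = "word is 1"
  have "\<alpha> i (?\<phi> h) = (1 / c) * \<alpha> j h" if "h \<in> H" for h
    using reflection_product_word[OF w alpha_dual[OF j] that] c unfolding eq by (simp add: field_simps)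
  then have cor: "?\<phi> (coroot j) = (1 / c) *s coroot i"
    by (rule cartan_automorphism_coroot[OF word_cartan[OF w] i j])
  note wk = reflection_product_dual[OF w alpha_dual[OF k]]
  have "?w (\<alpha> k) ((1 / c) *s coroot i) = \<alpha> k (coroot j)"
    using reflection_product_word[OF w alpha_dual[OF k] coroot_H[OF j]] cor by simp
  then have v: "?w (\<alpha> k) (coroot i) = c * \<alpha> k (coroot j)"
    using c by (simp add: dual_scale[OF wk coroot_H[OF i]] field_simps)
  have "simple_reflection j (\<alpha> k) = (\<lambda>x. (- \<alpha> k (coroot j)) * \<alpha> j x + \<alpha> k x)"
    by (simp add: simple_reflection_def)
  then have "?w (simple_reflection j (\<alpha> k)) = (\<lambda>x. (- \<alpha> k (coroot j)) * ?w (\<alpha> j) x + ?w (\<alpha> k) x)"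
    by (simp only: reflection_product_linear)
  also have "\<dots> = simple_reflection i (?w (\<alpha> k))"
    by (simp add: simple_reflection_def v eq fun_eq_iff)
  finally show "reflection_product (is @ [j]) (\<alpha> k) = reflection_product (i # is) (\<alpha> k)"
    by (simp add: reflection_product_append)
qed

text \<open>Follow \<alpha> j through the word from right to left. Just before the letter
  \<open>i\<close> that first makes it negative it is a multiple of \<alpha> i, so
  \<open>reflection_conjugate\<close> moves the reflection of \<open>j\<close> leftwards until it
  cancels this letter.\<close>

lemma exchange:
  assumes "is \<in> lists {1..n}" "j \<in> {1..n}" "reflection_product is (\<alpha> j) \<in> negr"
  shows "\<exists>js\<in>lists (set is). length is = Suc (length js) \<and> reflection_product (is @ [j]) = reflection_product js"
  using assms
proof (induction "is" rule: list.induct)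
  case Nil
  then show ?case using alpha_pos pos_neg_disjoint by auto
next
  case (Cons i "is")
  have w: "is \<in> lists {1..n}" and i: "i \<in> {1..n}" using Cons.prems(1) unfolding Cons_in_lists_iff by blast+
  let ?g = "reflection_product is (\<alpha> j)"
  have "?g \<in> posr \<union> negr" by (rule root_expand(2)[OF reflection_product_root[OF w alpha_root[OF Cons.prems(2)]]])
  then show ?case
  proof
    assume "?g \<in> negr"
    then obtain js where js: "js \<in> lists (set is)" "length is = Suc (length js)"
      "reflection_product (is @ [j]) = reflection_product js" using Cons.IH[OF w Cons.prems(2)] by blast
    then show ?thesis by (intro bexI[of _ "i # js"]) auto
  next
    assume pos: "?g \<in> posr"
    have neg: "simple_reflection i ?g \<in> negr" using Cons.prems(3) by simp
    have "reflection_product (is @ [j]) = reflection_product (i # is)"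
      by (rule reflection_conjugate[OF w i Cons.prems(2) sign_change_multiple(2,1)[OF i pos neg]])
    then have "reflection_product ((i # is) @ [j]) = simple_reflection i \<circ> reflection_product (i # is)"
      by (simp only: append_Cons reflection_product_simps(2))
    also have "\<dots> = reflection_product is"
      by (rule ext) (simp add: simple_reflection_simple_reflection[OF i])
    finally have "reflection_product ((i # is) @ [j]) = reflection_product is" .
    then show ?thesis by (intro bexI[of _ "is"]) auto
  qed
qed

text \<open>If the longest element sent \<alpha> j to a positive root, its product with the
  reflection of \<open>j\<close> would send it to a negative one. The exchange condition then
  shortens a minimal word for the product to a word for the longest element, making the product
  longer.\<close>

lemma longest_element:
  assumes J: "J \<subseteq> {1..n}"
  shows "longest_element J \<in> weyl_group J" "j \<in> J \<Longrightarrow> longest_element J (\<alpha> j) \<in> negr"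
proof -
  let ?w = "longest_element J" and ?l = "weyl_length J"
  have mem: "id \<in> weyl_group J" unfolding weyl_group_def by (rule image_eqI[of _ _ "[]"]) auto
  obtain b where b: "\<And>w. w \<in> weyl_group J \<Longrightarrow> ?l w < b"
    using finite_weyl_group[OF J] finite_nat_set_iff_bounded[of "?l ` weyl_group J"] by auto
  have max: "?w \<in> weyl_group J \<and> (\<forall>w. w \<in> weyl_group J \<longrightarrow> ?l w \<le> ?l ?w)"
    unfolding longest_element_def arg_max_on_def
    by (rule arg_max_nat_lemma[of "\<lambda>w. w \<in> weyl_group J" id, OF mem]) (use b in blast)
  then show "?w \<in> weyl_group J" by blast
  assume j: "j \<in> J"
  then have jn: "j \<in> {1..n}" using J by blast
  obtain ws where ws: "ws \<in> lists J" "?w = reflection_product ws" using max unfolding weyl_group_def by blast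
  have wsn: "ws \<in> lists {1..n}" using ws(1) lists_mono[OF J] by blast
  have root: "?w (\<alpha> j) \<in> posr \<union> negr"
    unfolding ws(2) by (rule root_expand(2)[OF reflection_product_root[OF wsn alpha_root[OF jn]]])
  show "?w (\<alpha> j) \<in> negr"
  proof (rule ccontr)
    assume "?w (\<alpha> j) \<notin> negr"
    then have pos: "?w (\<alpha> j) \<in> posr" using root by blast
    let ?v = "reflection_product (ws @ [j])"
    have vJ: "ws @ [j] \<in> lists J" using ws(1) j by auto
    have "simple_reflection j (\<alpha> j) = (\<lambda>x. (- 2) * \<alpha> j x + \<alpha> j x)"
      by (simp add: simple_reflection_def alpha_coroot[OF jn])
    then have v: "?v (\<alpha> j) = (\<lambda>x. (- 2) * ?w (\<alpha> j) x + ?w (\<alpha> j) x)"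
      unfolding reflection_product_append ws(2) by (simp only: o_apply reflection_product_simps reflection_product_linear id_apply)
    have "?v (\<alpha> j) \<in> roots H"
      using vJ lists_mono[OF J] by (intro reflection_product_root alpha_root jn) blast
    then have neg: "?v (\<alpha> j) \<in> negr" using pos by (simp add: posr_def negr_def v)
    have "\<exists>k. \<exists>is\<in>lists J. length is = k \<and> reflection_product is = ?v" using vJ by blast
    from LeastI_ex[OF this] obtain "is" where i: "is \<in> lists J" "length is = ?l ?v" "reflection_product is = ?v"
      unfolding weyl_length_def by blast
    have "is \<in> lists {1..n}" using i(1) lists_mono[OF J] by blast
    then obtain js where js: "js \<in> lists (set is)" "length is = Suc (length js)"
      "reflection_product (is @ [j]) = reflection_product js" using exchange[OF _ jn] neg i(3) by metis
    have "reflection_product js = ?w"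
    proof (rule ext)
      fix \<mu>
      have "reflection_product js \<mu> = reflection_product is (simple_reflection j \<mu>)"
        unfolding js(3)[symmetric] by (simp add: reflection_product_append)
      then show "reflection_product js \<mu> = ?w \<mu>"
        unfolding i(3) ws(2) by (simp add: reflection_product_append simple_reflection_simple_reflection[OF jn])
    qed
    moreover have "js \<in> lists J" using js(1) i(1) by auto
    ultimately have "?l ?w \<le> length js" unfolding weyl_length_def by (intro Least_le) blast
    also have "\<dots> < ?l ?v" using js(2) i(2) by simp
    also have "?v \<in> weyl_group J" unfolding weyl_group_def using vJ by (rule imageI)
    then have "?l ?v \<le> ?l ?w" using max by blast
    finally show False by simp
  qed
qed

end

subsection \<open>Orbits and free commutative monoids\<close>

text \<open>Orbits are described through invariant functions: two indices are equivalent when every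
  invariant function agrees on them. Both value types occur later, as natural coefficients and as
  complex values of roots and weights.\<close>

lemma orbit_index:
  fixes n :: nat and \<sigma> :: "nat \<Rightarrow> nat"
  assumes \<sigma>: "\<sigma> ` {1..n} \<subseteq> {1..n}"
  shows "\<exists>(r::nat) orb. orb ` {1..n} = {1..r} \<and>
    (\<forall>x :: nat \<Rightarrow> nat. (\<forall>i\<in>{1..n}. x (\<sigma> i) = x i) \<longleftrightarrow> (\<forall>i\<in>{1..n}. \<forall>j\<in>{1..n}. orb i = orb j \<longrightarrow> x i = x j)) \<and>
    (\<forall>x :: nat \<Rightarrow> complex. (\<forall>i\<in>{1..n}. x (\<sigma> i) = x i) \<longleftrightarrow> (\<forall>i\<in>{1..n}. \<forall>j\<in>{1..n}. orb i = orb j \<longrightarrow> x i = x j))"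
proof -
  \<comment> \<open>Functions that are not invariant get the value 0 at every index, so they never
    tell two indices apart.\<close>
  define V where "V i = (\<lambda>x::nat \<Rightarrow> nat. if \<forall>k\<in>{1..n}. x (\<sigma> k) = x k then x i else 0)" for i
  define R where "R = {(i, j). i \<in> {1..n} \<and> j \<in> {1..n} \<and> V i = V j}"
  have R: "equiv {1..n} R"
    by (rule equivI) (auto simp: R_def refl_on_def sym_def trans_def)
  define Q where "Q = {1..n} // R"
  have "finite Q" unfolding Q_def by (rule finite_quotient) (auto simp: R_def)
  then obtain h where h: "bij_betw h Q {1..card Q}"
    using ex_bij_betw_finite_nat[of Q] bij_betw_iff_card[of Q "{1..card Q}"] by auto
  define orb where "orb i = h (R `` {i})" for i
  have orb_eq: "orb i = orb j \<longleftrightarrow> (i, j) \<in> R" if "i \<in> {1..n}" "j \<in> {1..n}" for i j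
  proof -
    have "R `` {i} \<in> Q" "R `` {j} \<in> Q" using that by (auto simp: Q_def intro: quotientI)
    then have "orb i = orb j \<longleftrightarrow> R `` {i} = R `` {j}"
      unfolding orb_def by (rule inj_on_eq_iff[OF bij_betw_imp_inj_on[OF h]])
    then show ?thesis using eq_equiv_class_iff[OF R that] by simp
  qed
  have inv: "(\<forall>i\<in>{1..n}. x (\<sigma> i) = x i) \<longleftrightarrow> (\<forall>i\<in>{1..n}. \<forall>j\<in>{1..n}. orb i = orb j \<longrightarrow> x i = x j)" for x :: "nat \<Rightarrow> 'b"
  proof (intro iffI ballI impI)
    fix i j assume x: "\<forall>i\<in>{1..n}. x (\<sigma> i) = x i" and ij: "i \<in> {1..n}" "j \<in> {1..n}" "orb i = orb j"
    \<comment> \<open>A natural-valued indicator reduces invariants of any value type to those that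
      define \<open>R\<close>.\<close>
    define y where "y k = (if x k = x i then 0 else 1 :: nat)" for k
    have "(i, j) \<in> R" using orb_eq ij by blast
    moreover have "\<forall>k\<in>{1..n}. y (\<sigma> k) = y k" using x by (simp add: y_def)
    moreover from \<open>(i, j) \<in> R\<close> have "V i y = V j y" by (simp add: R_def)
    ultimately have "y i = y j" by (simp add: V_def)
    then show "x i = x j" by (simp add: y_def split: if_splits)
  next
    fix i assume x: "\<forall>i\<in>{1..n}. \<forall>j\<in>{1..n}. orb i = orb j \<longrightarrow> x i = x j" and i: "i \<in> {1..n}"
    have \<sigma>i: "\<sigma> i \<in> {1..n}" using \<sigma> i by blast
    then have "(\<sigma> i, i) \<in> R" using i by (auto simp: R_def V_def fun_eq_iff)
    then show "x (\<sigma> i) = x i" using x i \<sigma>i orb_eq by blast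
  qed
  have "orb ` {1..n} = h ` Q" by (auto simp: orb_def Q_def quotient_def)
  also have "\<dots> = {1..card Q}" using h by (simp add: bij_betw_def)
  finally have "orb ` {1..n} = {1..card Q}" .
  then show ?thesis
    by (intro exI[of _ "card Q"] exI[of _ orb] conjI allI) (assumption, rule inv, rule inv)
qed

text \<open>Indecomposable elements. Their number depends on the monoid only, so it identifies the
  rank whatever free generators are given.\<close>

definition atoms :: "('g \<Rightarrow> complex) set \<Rightarrow> ('g \<Rightarrow> complex) set" where
  "atoms P = {p \<in> P. p \<noteq> 0 \<and> (\<forall>a\<in>P. \<forall>b\<in>P. p = a + b \<longrightarrow> a = 0 \<or> b = 0)}"

lemma free_rank_atoms:
  assumes "freely_generates m \<nu> P" shows "card (atoms P) = m"
proof -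
  define C where "C = ({1..m} \<rightarrow>\<^sub>E UNIV :: (nat \<Rightarrow> nat) set)"
  define S where "S c = (\<lambda>x. \<Sum>i=1..m. of_nat (c i) * \<nu> i x)" for c :: "nat \<Rightarrow> nat"
  have bij: "bij_betw S C P" using assms by (simp add: freely_generates_def S_def[abs_def] C_def)
  have inj: "c i = d i" if "S c = S d" "i \<in> {1..m}" for c d i
  proof -
    have "S (restrict c {1..m}) = S (restrict d {1..m})" using that(1) by (simp add: S_def)
    then have "restrict c {1..m} = restrict d {1..m}"
      using bij by (auto simp: bij_betw_def C_def intro: inj_onD[of S C])
    then show ?thesis using that(2) by (metis restrict_apply')
  qed
  have P: "S c \<in> P" for c
  proof -
    have "S (restrict c {1..m}) \<in> P" using bij by (auto simp: bij_betw_def C_def)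
    moreover have "S (restrict c {1..m}) = S c" by (simp add: S_def)
    ultimately show ?thesis by simp
  qed
  have surj: "\<exists>c. p = S c" if "p \<in> P" for p using bij that unfolding bij_betw_def by blast
  have add: "S c + S d = S (\<lambda>i. c i + d i)" for c d
    by (simp add: S_def fun_eq_iff sum.distrib distrib_right)
  define \<delta> where "\<delta> i = (\<lambda>j. if j = i then 1 else 0 :: nat)" for i :: nat
  have S0: "S (\<lambda>i. 0) = 0" by (simp add: S_def fun_eq_iff)
  have S\<delta>: "S (\<delta> i) = \<nu> i" if i: "i \<in> {1..m}" for i
  proof
    fix x
    have "S (\<delta> i) x = (\<Sum>j=1..m. if j = i then \<nu> j x else 0)"
      unfolding S_def \<delta>_def by (intro sum.cong) auto
    then show "S (\<delta> i) x = \<nu> i x" using i by simp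
  qed
  have zero: "c i = 0" if "S c = 0" "i \<in> {1..m}" for c i using inj[of c "\<lambda>i. 0" i] S0 that by simp
  have inj\<nu>: "inj_on \<nu> {1..m}"
  proof (rule inj_onI)
    fix i j assume ij: "i \<in> {1..m}" "j \<in> {1..m}" "\<nu> i = \<nu> j"
    then have "\<delta> i i = \<delta> j i" using inj[of "\<delta> i" "\<delta> j" i] S\<delta> by simp
    then show "i = j" by (simp add: \<delta>_def split: if_splits)
  qed
  have "atoms P = \<nu> ` {1..m}"
  proof
    show "atoms P \<subseteq> \<nu> ` {1..m}"
    proof
      fix p assume p: "p \<in> atoms P"
      then have "p \<in> P" by (simp add: atoms_def)
      then obtain c where c: "p = S c" using surj by blast
      have "p \<noteq> 0" using p by (simp add: atoms_def)
      then have "\<exists>i\<in>{1..m}. c i \<noteq> 0" unfolding c by (auto simp: S_def fun_eq_iff intro: ccontr)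
      then obtain i where i: "i \<in> {1..m}" "c i \<noteq> 0" by blast
      define d where "d j = c j - \<delta> i j" for j
      have "c = (\<lambda>j. \<delta> i j + d j)" using i(2) by (auto simp: d_def \<delta>_def)
      then have e: "p = S (\<delta> i) + S d" using add[of "\<delta> i" d] c by simp
      moreover have "S (\<delta> i) \<noteq> 0" using zero[of "\<delta> i" i] i(1) by (auto simp: \<delta>_def)
      ultimately have "S d = 0" using p P unfolding atoms_def by blast
      then have "p = \<nu> i" using e S\<delta>[OF i(1)] by simp
      then show "p \<in> \<nu> ` {1..m}" using i(1) by blast
    qed
    show "\<nu> ` {1..m} \<subseteq> atoms P"
    proof
      fix p assume "p \<in> \<nu> ` {1..m}"
      then obtain i where i: "i \<in> {1..m}" "p = \<nu> i" by blast
      have pS: "p = S (\<delta> i)" using S\<delta> i by simp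
      have "p \<noteq> 0" unfolding pS using zero[of "\<delta> i" i] i(1) by (auto simp: \<delta>_def)
      moreover have "a = 0 \<or> b = 0" if ab: "a \<in> P" "b \<in> P" "p = a + b" for a b
      proof -
        obtain c d where cd: "a = S c" "b = S d" using surj ab by blast
        then have "S (\<delta> i) = S (\<lambda>j. c j + d j)" using ab(3) pS add by simp
        then have sum: "\<delta> i j = c j + d j" if "j \<in> {1..m}" for j using inj that by blast
        have "c i = 0 \<or> d i = 0" using sum[OF i(1)] by (auto simp: \<delta>_def)
        then have "(\<forall>j\<in>{1..m}. c j = 0) \<or> (\<forall>j\<in>{1..m}. d j = 0)"
          using sum by (metis \<delta>_def add_is_0)
        then show ?thesis unfolding cd by (auto simp: S_def fun_eq_iff)
      qed
      ultimately show "p \<in> atoms P" using P[of "\<delta> i"] pS by (auto simp: atoms_def)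
    qed
  qed
  then show ?thesis using card_image[OF inj\<nu>] by simp
qed

section \<open>Cartan subalgebras of the fixed points of an involution\<close>

context fd_lie
begin

lemma fixed_points_subalgebra:
  assumes "lie_automorphism \<theta>" shows "lie_subalgebra (fixed_points \<theta>)"
  using automorphism_lin[OF assms] unfolding lie_subalgebra_def fixed_points_def subspace_def
  by (auto simp: lin_0 lin_add lin_scale automorphism_br[OF assms])

lemma fixed_torus_cartan:
  assumes \<theta>: "lie_automorphism \<theta>" "\<And>v. \<theta> (\<theta> v) = v" and C: "cartan_subalgebra (fixed_points \<theta>) C"
  shows "fixed_torus \<theta> C"
proof -
  have lin\<theta>: "lin \<theta>" by (rule automorphism_lin[OF \<theta>(1)])
  from cartan_zero_weight_space[OF fixed_points_subalgebra[OF \<theta>(1)] C] have zero: "fixed_points \<theta> \<inter> gs C 0 = C" .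
  have nC: "nilp_alg C" using C by (simp add: cartan_subalgebra_def nilp_alg_def)
  have fixC: "\<theta> t = t" if "t \<in> C" for t using zero that by (auto simp: fixed_points_def)
  have gsC: "\<theta> ` gs C 0 \<subseteq> gs C 0" by (rule automorphism_gs[OF \<theta>(1) fixC])
  have "\<exists>t\<in>C. \<exists>w\<in>gs C 0. v = t + (\<theta> w - w)" if v: "v \<in> gs C 0" for v
  proof -
    \<comment> \<open>The symmetric part (v + \<theta> v)/2 lies in \<open>C\<close>; for w = - v/2
      the difference \<theta> w - w is the antisymmetric part.\<close>
    let ?t = "(1 / 2) *s (v + \<theta> v)" and ?w = "(- 1 / 2) *s v"
    have "?t \<in> gs C 0"
      using gsC v by (intro subspace_scale[OF subspace_gs[OF nC]] subspace_add[OF subspace_gs[OF nC]]) auto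
    moreover have "?t \<in> fixed_points \<theta>"
      by (simp add: fixed_points_def lin_scale[OF lin\<theta>] lin_add[OF lin\<theta>] \<theta>(2) add.commute)
    ultimately have "?t \<in> C" using zero by blast
    moreover have "?w \<in> gs C 0" using v by (intro subspace_scale[OF subspace_gs[OF nC]])
    moreover have "v = ?t + (\<theta> ?w - ?w)"
    proof -
      have "?t + (\<theta> ?w - ?w) = (1 / 2) *s v + (1 / 2) *s v"
        by (simp add: lin_scale[OF lin\<theta>] scale_right_distrib lin_minus[OF lin\<theta>])
      also have "\<dots> = v" by (simp only: scale_left_distrib[symmetric]) simp
      finally show ?thesis by simp
    qed
    ultimately show ?thesis by blast
  qed
  then show ?thesis
    unfolding fixed_torus_def using \<theta>(1) nC fixC zero by (auto simp: fixed_points_def)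
qed

end

section \<open>Automorphisms preserving the Cartan subalgebra\<close>

context semisimple_with_chevalley_generators
begin

lemma cartan_automorphism_comp: "cartan_automorphism \<phi> \<Longrightarrow> cartan_automorphism \<psi> \<Longrightarrow> cartan_automorphism (\<phi> \<circ> \<psi>)"
  unfolding cartan_automorphism_def by (simp only: automorphism_comp image_comp[symmetric])

lemma cartan_automorphism_inv: assumes "cartan_automorphism \<phi>" shows "cartan_automorphism (inv \<phi>)"
proof -
  have a: "lie_automorphism \<phi>" and H: "\<phi> ` H = H" using assms by (auto simp: cartan_automorphism_def)
  have "inv \<phi> ` (\<phi> ` H) = H" by (rule image_inv_f_f[OF bij_is_inj[OF automorphism_bij[OF a]]])
  then show ?thesis unfolding cartan_automorphism_def H using automorphism_inv[OF a] by simp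
qed

lemma cartan_automorphism_mem: "cartan_automorphism \<phi> \<Longrightarrow> h \<in> H \<Longrightarrow> \<phi> h \<in> H"
  unfolding cartan_automorphism_def by blast

lemma cartan_automorphism_outside: assumes "cartan_automorphism \<phi>" "x \<notin> H" shows "\<phi> x \<notin> H"
proof
  assume "\<phi> x \<in> H"
  then obtain h where "h \<in> H" "\<phi> x = \<phi> h" using assms(1) unfolding cartan_automorphism_def by blast
  then show False using assms automorphism_bij unfolding cartan_automorphism_def by (metis bij_is_inj injD)
qed

lemma cartan_automorphism_dual:
  assumes "cartan_automorphism \<phi>" "\<mu> \<in> dual_space H" shows "\<mu> \<circ> \<phi> \<in> dual_space H"
proof -
  have l: "lin \<phi>" using assms(1) automorphism_lin by (simp add: cartan_automorphism_def)
  show ?thesis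
    using cartan_automorphism_mem[OF assms(1)] cartan_automorphism_outside[OF assms(1)]
      dual_add[OF assms(2)] dual_scale[OF assms(2)] dual_outside[OF assms(2)]
    by (simp add: dual_space_def lin_add[OF l] lin_scale[OF l])
qed

lemma cartan_automorphism_root_comp:
  assumes \<phi>: "cartan_automorphism \<phi>" and \<beta>: "\<beta> \<in> roots H" shows "\<beta> \<circ> \<phi> \<in> roots H"
proof (rule cartan_automorphism_root[OF cartan_automorphism_inv[OF \<phi>] cartan_automorphism_dual[OF \<phi> root_dual[OF \<beta>]] _ \<beta>])
  have "bij \<phi>" using \<phi> automorphism_bij by (simp add: cartan_automorphism_def)
  then show "(\<beta> \<circ> \<phi>) (inv \<phi> h) = \<beta> h" for h by (simp add: bij_is_surj surj_f_inv_f)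
qed

lemma H_abelian: assumes "x \<in> H" "y \<in> H" shows "br x y = 0"
proof (rule H_separated)
  show "br x y \<in> H" by (rule T_br[OF nilp_H assms])
  show "\<alpha> i (br x y) = 0" if "i \<in> {1..n}" for i
    by (rule weight_bracket[OF nilp_H root_wt(1)[OF alpha_root[OF that]] assms])
qed

lemma nat_sum_prod: "finite I \<Longrightarrow> (\<And>i. i \<in> I \<Longrightarrow> (a i :: complex) \<in> \<nat>) \<Longrightarrow> (\<And>i. i \<in> I \<Longrightarrow> b i \<in> \<nat>) \<Longrightarrow> (\<Sum>i\<in>I. a i * b i) \<in> \<nat>"
  by (induction I rule: finite_induct) auto

text \<open>An automorphism mapping simple roots to positive roots has an inverse with the same property,
  so it permutes the indecomposable positive roots.\<close>

lemma positive_automorphism_permutes: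
  assumes \<psi>: "cartan_automorphism \<psi>" and pos: "\<And>i. i \<in> {1..n} \<Longrightarrow> \<alpha> i \<circ> \<psi> \<in> posr"
  obtains \<sigma> where "\<And>i. i \<in> {1..n} \<Longrightarrow> \<sigma> i \<in> {1..n}" "\<And>i. i \<in> {1..n} \<Longrightarrow> \<alpha> i \<circ> \<psi> = \<alpha> (\<sigma> i)"
proof -
  have bij: "bij \<psi>" using \<psi> automorphism_bij by (simp add: cartan_automorphism_def)
  let ?\<chi> = "inv \<psi>"
  have \<chi>: "cartan_automorphism ?\<chi>" by (rule cartan_automorphism_inv[OF \<psi>])
  have inv1: "?\<chi> (\<psi> x) = x" and inv2: "\<psi> (?\<chi> x) = x" for x
    using bij by (simp_all add: bij_is_inj inv_f_f bij_is_surj surj_f_inv_f)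
  \<comment> \<open>If it were negative, composing with \<psi> would express \<alpha> j with
    nonpositive coefficients.\<close>
  have pos': "\<alpha> j \<circ> ?\<chi> \<in> posr" if j: "j \<in> {1..n}" for j
  proof (rule ccontr)
    let ?b = "\<alpha> j \<circ> ?\<chi>"
    have r: "?b \<in> roots H" by (rule cartan_automorphism_root_comp[OF \<chi> alpha_root[OF j]])
    assume "?b \<notin> posr"
    then have neg: "?b \<in> negr" using root_expand(2)[OF r] by blast
    have "- \<alpha> j (cw j) = - ?b (\<psi> (cw j))" by (simp add: inv1)
    also have "\<dots> = - (\<Sum>k=1..n. ?b (cw k) * \<alpha> k (\<psi> (cw j)))" using root_expand(1)[OF r] by metis
    also have "\<dots> = (\<Sum>k=1..n. (- ?b (cw k)) * (\<alpha> k \<circ> \<psi>) (cw j))" by (simp add: sum_negf)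
    also have "\<dots> \<in> \<nat>"
      by (rule nat_sum_prod) (use neg pos j in \<open>auto simp: negr_def posr_def\<close>)
    finally have "- \<alpha> j (cw j) \<in> \<nat>" .
    then have "\<alpha> j (cw j) = 0" using nat_neg_zero[of "\<alpha> j (cw j)"] alpha_cw[OF j j] by simp
    then show False using alpha_cw[OF j j] by simp
  qed
  have "\<exists>k\<in>{1..n}. \<alpha> i \<circ> \<psi> = \<alpha> k" if i: "i \<in> {1..n}" for i
  proof -
    let ?\<nu> = "\<alpha> i \<circ> \<psi>"
    have r: "?\<nu> \<in> roots H" using pos[OF i] by (simp add: posr_def)
    have "\<forall>k\<in>{1..n}. \<exists>m. ?\<nu> (cw k) = of_nat m" using pos[OF i] unfolding posr_def by (blast elim: Nats_cases)
    then obtain a where a: "\<And>k. k \<in> {1..n} \<Longrightarrow> ?\<nu> (cw k) = of_nat (a k)" by metis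
    \<comment> \<open>Heights of the simple roots composed with the inverse. Expanding \<alpha> i
      \<circ> \<psi> and composing back writes the height 1 of \<alpha> i as the sum of
      \<open>a k\<close> times these positive heights, so one coefficient is 1 and the others are
      0.\<close>
    have "\<forall>k\<in>{1..n}. \<exists>m. (\<Sum>j=1..n. (\<alpha> k \<circ> ?\<chi>) (cw j)) = of_nat m \<and> m \<noteq> 0"
    proof
      fix k assume k: "k \<in> {1..n}"
      have "\<forall>j\<in>{1..n}. \<exists>m. (\<alpha> k \<circ> ?\<chi>) (cw j) = of_nat m" using pos'[OF k] unfolding posr_def by (blast elim: Nats_cases)
      then obtain b where b: "\<And>j. j \<in> {1..n} \<Longrightarrow> (\<alpha> k \<circ> ?\<chi>) (cw j) = of_nat (b j)" by metis
      have "(\<Sum>j=1..n. (\<alpha> k \<circ> ?\<chi>) (cw j)) = of_nat (\<Sum>j=1..n. b j)"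
        unfolding of_nat_sum by (intro sum.cong refl b)
      moreover have "(\<Sum>j=1..n. b j) \<noteq> 0"
      proof
        assume "(\<Sum>j=1..n. b j) = 0"
        then have z: "b j = 0" if "j \<in> {1..n}" for j using that by simp
        have rk: "\<alpha> k \<circ> ?\<chi> \<in> roots H" using pos'[OF k] by (simp add: posr_def)
        have "(\<alpha> k \<circ> ?\<chi>) x = 0" for x
        proof -
          have "(\<alpha> k \<circ> ?\<chi>) x = (\<Sum>j=1..n. (\<alpha> k \<circ> ?\<chi>) (cw j) * \<alpha> j x)" using root_expand(1)[OF rk] by metis
          also have "\<dots> = 0" by (intro sum.neutral ballI) (simp only: b z of_nat_0 mult_zero_left)
          finally show ?thesis .
        qed
        then have "\<alpha> k \<circ> ?\<chi> = (\<lambda>x. 0)" by (rule ext)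
        then show False using root_wt(2)[OF rk] unfolding zero_fun_def by blast
      qed
      ultimately show "\<exists>m. (\<Sum>j=1..n. (\<alpha> k \<circ> ?\<chi>) (cw j)) = of_nat m \<and> m \<noteq> 0" by blast
    qed
    then obtain ht where ht: "\<And>k. k \<in> {1..n} \<Longrightarrow> (\<Sum>j=1..n. (\<alpha> k \<circ> ?\<chi>) (cw j)) = of_nat (ht k)"
      "\<And>k. k \<in> {1..n} \<Longrightarrow> ht k \<noteq> 0" by metis
    have \<alpha>i: "\<alpha> i (cw j) = (\<Sum>k=1..n. of_nat (a k) * (\<alpha> k \<circ> ?\<chi>) (cw j))" for j
    proof -
      have "\<alpha> i (cw j) = ?\<nu> (?\<chi> (cw j))" by (simp add: inv2)
      also have "\<dots> = (\<Sum>k=1..n. ?\<nu> (cw k) * \<alpha> k (?\<chi> (cw j)))" using root_expand(1)[OF r] by metis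
      also have "\<dots> = (\<Sum>k=1..n. of_nat (a k) * (\<alpha> k \<circ> ?\<chi>) (cw j))"
        by (intro sum.cong refl) (simp only: a[symmetric] o_apply)
      finally show ?thesis .
    qed
    have "(of_nat (\<Sum>k=1..n. a k * ht k) :: complex) = (\<Sum>k=1..n. of_nat (a k) * (\<Sum>j=1..n. (\<alpha> k \<circ> ?\<chi>) (cw j)))"
      unfolding of_nat_sum of_nat_mult by (intro sum.cong refl) (simp only: ht)
    also have "\<dots> = (\<Sum>j=1..n. \<alpha> i (cw j))"
      unfolding \<alpha>i sum_distrib_left by (rule sum.swap)
    also have "\<dots> = (\<Sum>j=1..n. if j = i then 1 else 0)" using i by (intro sum.cong refl) (auto simp: alpha_cw)
    also have "\<dots> = of_nat 1" using i by simp
    finally have "(\<Sum>k=1..n. a k * ht k) = 1" by (simp only: of_nat_eq_iff)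
    then have "\<exists>k\<in>{1..n}. a k * ht k = 1 \<and> (\<forall>l\<in>{1..n}. k \<noteq> l \<longrightarrow> a l * ht l = 0)"
      by (simp only: sum_eq_1_iff[OF finite_atLeastAtMost])
    then obtain k where k: "k \<in> {1..n}" "a k * ht k = 1" "\<forall>l\<in>{1..n}. k \<noteq> l \<longrightarrow> a l * ht l = 0"
      by (elim bexE conjE)
    have ak: "a k = 1" using k(2) by simp
    have al: "a l = 0" if "l \<in> {1..n}" "l \<noteq> k" for l using bspec[OF k(3) that(1)] that(2) ht(2)[OF that(1)] by simp
    have "?\<nu> x = \<alpha> k x" for x
    proof -
      have "?\<nu> x = (\<Sum>l=1..n. ?\<nu> (cw l) * \<alpha> l x)" using root_expand(1)[OF r] by metis
      also have "\<dots> = (\<Sum>l=1..n. if l = k then \<alpha> l x else 0)"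
        by (intro sum.cong refl) (simp only: a ak al of_nat_0 of_nat_1 split: if_split, simp add: ak al)
      finally show ?thesis using k(1) by simp
    qed
    then show ?thesis using k(1) by blast
  qed
  then obtain \<sigma> where "\<forall>i\<in>{1..n}. \<sigma> i \<in> {1..n} \<and> \<alpha> i \<circ> \<psi> = \<alpha> (\<sigma> i)" by metis
  then show ?thesis by (intro that[of \<sigma>]) blast+
qed

subsection \<open>Diagram automorphisms\<close>

text \<open>The weight-0 space of the fixed part is \<open>H\<close> because the fixed part contains
  a regular element, and \<psi> has finite order on \<open>H\<close>, so averaging splits off the
  fixed part.\<close>

lemma diagram_fixed_torus:
  assumes \<psi>: "cartan_automorphism \<psi>" and \<sigma>: "\<And>i. i \<in> {1..n} \<Longrightarrow> \<sigma> i \<in> {1..n}"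
    "\<And>i. i \<in> {1..n} \<Longrightarrow> \<alpha> i \<circ> \<psi> = \<alpha> (\<sigma> i)"
  shows "fixed_torus \<psi> {h \<in> H. \<psi> h = h}"
proof -
  let ?T = "{h \<in> H. \<psi> h = h}"
  have a: "lie_automorphism \<psi>" using \<psi> by (simp add: cartan_automorphism_def)
  have lin\<psi>: "lin \<psi>" by (rule automorphism_lin[OF a])
  have \<psi>H: "\<psi> h \<in> H" if "h \<in> H" for h using cartan_automorphism_mem[OF \<psi> that] .
  have \<alpha>\<psi>: "\<alpha> i (\<psi> h) = \<alpha> (\<sigma> i) h" if "i \<in> {1..n}" for i h
    using fun_cong[OF \<sigma>(2)[OF that], of h] by simp
  have sT: "subspace ?T"
    using subspace_H by (auto simp: subspace_def lin_0[OF lin\<psi>] lin_add[OF lin\<psi>] lin_scale[OF lin\<psi>])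
  have br0: "br x y = 0" if "x \<in> ?T" "y \<in> ?T" for x y using H_abelian that by blast
  have "br_span ?T ?T = {0}"
  proof -
    have "{br x y | x y. x \<in> ?T \<and> y \<in> ?T} \<subseteq> {0}" using br0 by blast
    then have "br_span ?T ?T \<subseteq> span {0}" unfolding br_span_def by (rule span_mono)
    then show ?thesis using span_zero unfolding br_span_def by auto
  qed
  then have "lie_nilpotent ?T" unfolding lie_nilpotent_def by (intro exI[of _ 1]) simp
  moreover have "lie_subalgebra ?T"
    unfolding lie_subalgebra_def
  proof (intro conjI ballI)
    fix x y assume "x \<in> ?T" "y \<in> ?T"
    then show "br x y \<in> ?T" using br0[of x y] subspace_0[OF sT] by (simp only:)
  qed (rule sT)
  ultimately have nT: "nilp_alg ?T" by (simp add: nilp_alg_def)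
  \<comment> \<open>Each simple root is 1 at \<rho>, so \<psi> fixes \<rho>; any root takes there
    the sum of its coefficients, which is not 0.\<close>
  define \<rho> where "\<rho> = (\<Sum>j=1..n. cw j)"
  have \<rho>H: "\<rho> \<in> H" unfolding \<rho>_def by (intro subspace_sum[OF subspace_H] cw_H)
  have \<mu>\<rho>: "\<mu> \<rho> = (\<Sum>j=1..n. \<mu> (cw j))" if "\<mu> \<in> dual_space H" for \<mu>
    using dual_sum[OF that cw_H, of "{1..n}" "\<lambda>j. j" "\<lambda>j. 1"] by (simp add: \<rho>_def)
  have \<alpha>\<rho>: "\<alpha> i \<rho> = 1" if i: "i \<in> {1..n}" for i
  proof -
    have "\<alpha> i \<rho> = (\<Sum>j=1..n. if j = i then 1 else 0)"
      unfolding \<mu>\<rho>[OF alpha_dual[OF i]] using i by (intro sum.cong refl) (auto simp: alpha_cw)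
    then show ?thesis using i by simp
  qed
  have "\<psi> \<rho> - \<rho> = 0"
  proof (rule H_separated)
    show "\<psi> \<rho> - \<rho> \<in> H" by (rule subspace_diff[OF subspace_H \<psi>H[OF \<rho>H] \<rho>H])
    show "\<alpha> i (\<psi> \<rho> - \<rho>) = 0" if "i \<in> {1..n}" for i
      using dual_diff[OF alpha_dual[OF that] \<psi>H[OF \<rho>H] \<rho>H] \<alpha>\<psi>[OF that] \<alpha>\<rho>[OF that] \<alpha>\<rho>[OF \<sigma>(1)[OF that]] by simp
  qed
  then have \<rho>T: "\<rho> \<in> ?T" using \<rho>H by simp
  have root\<rho>: "\<kappa> \<rho> \<noteq> 0" if \<kappa>: "\<kappa> \<in> wt H" "\<kappa> \<noteq> 0" for \<kappa>
  proof
    assume z: "\<kappa> \<rho> = 0"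
    note r = wt_root[OF \<kappa>]
    have s: "(\<Sum>j=1..n. \<kappa> (cw j)) = 0" using z \<mu>\<rho>[OF root_dual[OF r]] by simp
    have "\<forall>j\<in>{1..n}. \<kappa> (cw j) = 0"
    proof -
      have *: "\<forall>j\<in>{1..n}. x j = 0" if x: "\<forall>j\<in>{1..n}. x j \<in> \<nat>" "(\<Sum>j=1..n. x j) = 0" for x :: "nat \<Rightarrow> complex"
      proof -
        have "\<forall>j\<in>{1..n}. \<exists>m. x j = of_nat m" using x(1) by (blast elim: Nats_cases)
        then obtain m where m: "\<And>j. j \<in> {1..n} \<Longrightarrow> x j = of_nat (m j)" by metis
        have "(of_nat (\<Sum>j=1..n. m j) :: complex) = (\<Sum>j=1..n. x j)"
          unfolding of_nat_sum by (intro sum.cong refl) (simp only: m)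
        then have "(\<Sum>j=1..n. m j) = 0" using x(2) by (simp only: of_nat_eq_0_iff)
        then show ?thesis using m by simp
      qed
      have "(\<Sum>j=1..n. - \<kappa> (cw j)) = 0" using s by (simp add: sum_negf)
      note s' = this
      from root_expand(2)[OF r] show ?thesis
      proof
        assume "\<kappa> \<in> posr"
        then have "\<forall>j\<in>{1..n}. \<kappa> (cw j) \<in> \<nat>" unfolding posr_def by blast
        then show ?thesis using s by (rule *)
      next
        assume "\<kappa> \<in> negr"
        then have "\<forall>j\<in>{1..n}. - \<kappa> (cw j) \<in> \<nat>" unfolding negr_def by blast
        then have "\<forall>j\<in>{1..n}. - \<kappa> (cw j) = 0" using s' by (rule *)
        then show ?thesis by simp
      qed
    qed
    then have "\<kappa> x = 0" for x
      using fun_cong[OF root_expand(1)[OF r], of x] by simp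
    then show False using \<kappa>(2) by (simp add: fun_eq_iff)
  qed
  have gs0: "gs ?T 0 = H"
  proof
    show "H \<subseteq> gs ?T 0"
    proof
      fix h assume h: "h \<in> H"
      have "h \<in> gen (br t) 0" if "t \<in> ?T" for t
        using H_abelian[of t h] h that by (auto simp: gen_def shift_zero intro!: exI[of _ 1])
      then show "h \<in> gs ?T 0" by (simp add: jgen_def)
    qed
    show "gs ?T 0 \<subseteq> H"
    proof
      fix v assume v: "v \<in> gs ?T 0"
      then have v\<rho>: "v \<in> gen (br \<rho>) 0" using \<rho>T by (simp add: jgen_def)
      have "prw H \<kappa> v \<in> H" if \<kappa>: "\<kappa> \<in> wt H" for \<kappa>
      proof (cases "\<kappa> = 0")
        case True
        then show ?thesis using pr_in[OF ds[OF nilp_H] \<kappa>, of v] gs_zero by simp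
      next
        case False
        have 1: "prw H \<kappa> v \<in> gen (br \<rho>) 0"
          by (rule gen_stable_comm[of "br \<rho>" "prw H \<kappa>", OF lin_br lin_pr[OF ds[OF nilp_H] \<kappa>]
                prw_br[OF nilp_H \<rho>H \<kappa>, symmetric] v\<rho>])
        have "prw H \<kappa> v \<in> gen (br \<rho>) (\<kappa> \<rho>)"
          using pr_in[OF ds[OF nilp_H] \<kappa>, of v] \<rho>H by (simp add: jgen_def)
        moreover obtain k where "(shift (br \<rho>) 0 ^^ k) (prw H \<kappa> v) = 0" using 1 by (auto simp: gen_def)
        ultimately have "prw H \<kappa> v = 0" using gen_inj[OF lin_br root\<rho>[OF \<kappa> False]] by blast
        then show ?thesis using subspace_0[OF subspace_H] by simp
      qed
      then have "(\<Sum>\<kappa>\<in>wt H. prw H \<kappa> v) \<in> H" by (intro subspace_sum[OF subspace_H])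
      then show "v \<in> H" by (simp add: pr_sum[OF ds[OF nilp_H]])
    qed
  qed
  have \<sigma>k: "(\<sigma> ^^ k) i \<in> {1..n}" if "i \<in> {1..n}" for k i using that \<sigma>(1) by (induction k) auto
  have inj\<sigma>: "i = j" if ij: "i \<in> {1..n}" "j \<in> {1..n}" "\<sigma> i = \<sigma> j" for i j
  proof -
    obtain x where x: "x \<in> H" "cw i = \<psi> x" using \<psi> cw_H[OF ij(1)] unfolding cartan_automorphism_def by blast
    have "\<alpha> i (cw i) = \<alpha> j (cw i)" unfolding x(2) \<alpha>\<psi>[OF that(1)] \<alpha>\<psi>[OF that(2)] that(3) ..
    then show ?thesis using alpha_cw[OF that(1,1)] alpha_cw[OF that(2,1)] by (auto split: if_splits)
  qed
  \<comment> \<open>Powers of \<sigma> on a finite set repeat, and injectivity cancels the common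
    part: q is the difference of two exponents.\<close>
  have "\<exists>q>0. \<forall>i\<in>{1..n}. (\<sigma> ^^ q) i = i"
  proof -
    let ?f = "\<lambda>k::nat. restrict (\<sigma> ^^ k) {1..n}"
    have "range ?f \<subseteq> {1..n} \<rightarrow>\<^sub>E {1..n}" using \<sigma>k by auto
    moreover have "finite ({1..n} \<rightarrow>\<^sub>E {1..n})" by (intro finite_PiE) auto
    ultimately have "finite (range ?f)" by (rule finite_subset)
    then have "\<not> inj ?f" using finite_imageD infinite_UNIV_nat by blast
    then obtain a b where ab: "?f a = ?f b" "a \<noteq> b" unfolding inj_def by blast
    define k l where "k = min a b" and "l = max a b"
    have kl: "?f k = ?f l" "k < l" using ab by (auto simp: k_def l_def min_def max_def)
    have inj_k: "x = y" if "(\<sigma> ^^ k) x = (\<sigma> ^^ k) y" "x \<in> {1..n}" "y \<in> {1..n}" for x y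
      using that
    proof (induction k)
      case (Suc k)
      then show ?case using inj\<sigma>[OF \<sigma>k \<sigma>k] by (metis funpow.simps(2) o_apply)
    qed simp
    have "(\<sigma> ^^ (l - k)) i = i" if i: "i \<in> {1..n}" for i
    proof (rule inj_k)
      have "(\<sigma> ^^ k) ((\<sigma> ^^ (l - k)) i) = (\<sigma> ^^ (k + (l - k))) i" by (simp only: funpow_add o_apply)
      also have "\<dots> = (\<sigma> ^^ l) i" using kl(2) by simp
      also have "\<dots> = (\<sigma> ^^ k) i" using fun_cong[OF kl(1), of i] i by simp
      finally show "(\<sigma> ^^ k) ((\<sigma> ^^ (l - k)) i) = (\<sigma> ^^ k) i" .
    qed (use i \<sigma>k in auto)
    then show ?thesis using kl(2) by (intro exI[of _ "l - k"]) auto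
  qed
  then obtain q where q: "q > 0" "\<And>i. i \<in> {1..n} \<Longrightarrow> (\<sigma> ^^ q) i = i" by blast
  have \<psi>k: "(\<psi> ^^ k) h \<in> H" if "h \<in> H" for k h using that \<psi>H by (induction k) auto
  have \<alpha>k: "\<alpha> i ((\<psi> ^^ k) h) = \<alpha> ((\<sigma> ^^ k) i) h" if "i \<in> {1..n}" for k i h
    using that
  proof (induction k arbitrary: i)
    case (Suc k)
    have "\<alpha> i ((\<psi> ^^ Suc k) h) = \<alpha> (\<sigma> i) ((\<psi> ^^ k) h)" using \<alpha>\<psi>[OF Suc.prems] by simp
    also have "\<dots> = \<alpha> ((\<sigma> ^^ k) (\<sigma> i)) h" by (rule Suc.IH[OF \<sigma>(1)[OF Suc.prems]])
    finally show ?case by (simp add: funpow_swap1)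
  qed simp
  have \<psi>q: "(\<psi> ^^ q) h = h" if h: "h \<in> H" for h
  proof -
    have "(\<psi> ^^ q) h - h = 0"
    proof (rule H_separated)
      show "(\<psi> ^^ q) h - h \<in> H" by (rule subspace_diff[OF subspace_H \<psi>k[OF h] h])
      show "\<alpha> i ((\<psi> ^^ q) h - h) = 0" if "i \<in> {1..n}" for i
        using dual_diff[OF alpha_dual[OF that] \<psi>k[OF h] h] \<alpha>k[OF that] q(2)[OF that] by simp
    qed
    then show ?thesis by simp
  qed
  have "\<exists>t\<in>?T. \<exists>w\<in>gs ?T 0. v = t + (\<psi> w - w)" if v: "v \<in> gs ?T 0" for v
  proof -
    have vH: "v \<in> H" using v gs0 by simp
    define t where "t = (1 / of_nat q) *s (\<Sum>k<q. (\<psi> ^^ k) v)"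
    have tH: "t \<in> H"
      unfolding t_def by (intro subspace_scale[OF subspace_H] subspace_sum[OF subspace_H] \<psi>k[OF vH])
    have "\<psi> (\<Sum>k<q. (\<psi> ^^ k) v) = (\<Sum>k<q. (\<psi> ^^ Suc k) v)" by (simp add: lin_sum[OF lin\<psi>])
    also have "\<dots> = (\<Sum>k<Suc q. (\<psi> ^^ k) v) - v" by (subst sum.lessThan_Suc_shift) simp
    also have "\<dots> = (\<Sum>k<q. (\<psi> ^^ k) v)" using \<psi>q[OF vH] by simp
    finally have "\<psi> t = t" by (simp add: t_def lin_scale[OF lin\<psi>])
    then have tT: "t \<in> ?T" using tH by simp
    \<comment> \<open>Partial sums telescope: \<psi> (u k) - u k is the k-th iterate minus v.
      Averaging them over k and changing the sign gives \<open>w\<close> with \<psi> w - w = v -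
      t.\<close>
    define u where "u k = (\<Sum>l<k. (\<psi> ^^ l) v)" for k
    have uH: "u k \<in> H" for k unfolding u_def by (intro subspace_sum[OF subspace_H] \<psi>k[OF vH])
    have u: "\<psi> (u k) - u k = (\<psi> ^^ k) v - v" for k
    proof -
      have "\<psi> (u k) = (\<Sum>l<k. (\<psi> ^^ Suc l) v)" by (simp add: u_def lin_sum[OF lin\<psi>])
      also have "\<dots> = (\<Sum>l<Suc k. (\<psi> ^^ l) v) - v" by (subst sum.lessThan_Suc_shift) simp
      also have "\<dots> = u k + (\<psi> ^^ k) v - v" by (simp add: u_def)
      finally show ?thesis by simp
    qed
    define w where "w = - ((1 / of_nat q) *s (\<Sum>k<q. u k))"
    have wH: "w \<in> H"
      unfolding w_def by (intro subspace_neg[OF subspace_H] subspace_scale[OF subspace_H] subspace_sum[OF subspace_H] uH)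
    have "\<psi> w - w = - ((1 / of_nat q) *s (\<Sum>k<q. \<psi> (u k) - u k))"
      by (simp add: w_def lin_minus[OF lin\<psi>] lin_scale[OF lin\<psi>] lin_sum[OF lin\<psi>] sum_subtractf scale_right_diff_distrib)
    also have "(\<Sum>k<q. \<psi> (u k) - u k) = (\<Sum>k<q. (\<psi> ^^ k) v) - of_nat q *s v"
      by (simp add: u sum_subtractf sum_constant_scale)
    also have "- ((1 / of_nat q) *s ((\<Sum>k<q. (\<psi> ^^ k) v) - of_nat q *s v)) = v - t"
      using q(1) by (simp add: t_def scale_right_diff_distrib)
    finally have "v = t + (\<psi> w - w)" by simp
    then show ?thesis using tT wH gs0 by blast
  qed
  moreover have "v \<in> ?T" if "v \<in> gs ?T 0" "\<psi> v = v" for v using that gs0 by simp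
  ultimately show ?thesis unfolding fixed_torus_def using a nT by blast
qed

text \<open>Both sides amount to functions constant on the orbits of \<sigma>: an element of
  \<open>H\<close> through the values of the simple roots, a weight through its values at the
  coroots. Orbit sums \<open>t\<close> of coweights and \<omega> of fundamental weights are the
  respective bases.\<close>

lemma diagram_invariant_weights:
  assumes \<psi>: "cartan_automorphism \<psi>" and \<sigma>: "\<And>i. i \<in> {1..n} \<Longrightarrow> \<sigma> i \<in> {1..n}"
    "\<And>i. i \<in> {1..n} \<Longrightarrow> \<alpha> i \<circ> \<psi> = \<alpha> (\<sigma> i)"
  shows "\<exists>\<omega>. freely_generates (dim {h \<in> H. \<psi> h = h}) \<omega> {\<mu> \<in> dominant_weights. \<forall>h\<in>H. \<mu> (\<psi> h) = \<mu> h}"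
proof -
  let ?P = "{\<mu> \<in> dominant_weights. \<forall>h\<in>H. \<mu> (\<psi> h) = \<mu> h}" and ?T = "{h \<in> H. \<psi> h = h}"
  have a: "lie_automorphism \<psi>" using \<psi> by (simp add: cartan_automorphism_def)
  have \<psi>H: "\<psi> h \<in> H" if "h \<in> H" for h using cartan_automorphism_mem[OF \<psi> that] .
  have \<alpha>\<psi>: "\<alpha> i (\<psi> h) = \<alpha> (\<sigma> i) h" if "i \<in> {1..n}" for i h
    using fun_cong[OF \<sigma>(2)[OF that], of h] by simp
  have \<psi>c: "\<psi> (coroot (\<sigma> i)) = coroot i" if i: "i \<in> {1..n}" for i
    using cartan_automorphism_coroot[OF \<psi> i \<sigma>(1)[OF i], of 1] \<alpha>\<psi>[OF i] by simp
  have "\<sigma> ` {1..n} \<subseteq> {1..n}" using \<sigma>(1) by blast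
  from orbit_index[OF this] obtain r orb where orb: "orb ` {1..n} = {1..r::nat}"
    "\<And>(x :: nat \<Rightarrow> nat). (\<forall>i\<in>{1..n}. x (\<sigma> i) = x i) \<longleftrightarrow> (\<forall>i\<in>{1..n}. \<forall>j\<in>{1..n}. orb i = orb j \<longrightarrow> x i = x j)"
    "\<And>(x :: nat \<Rightarrow> complex). (\<forall>i\<in>{1..n}. x (\<sigma> i) = x i) \<longleftrightarrow> (\<forall>i\<in>{1..n}. \<forall>j\<in>{1..n}. orb i = orb j \<longrightarrow> x i = x j)"
    by (elim exE conjE) blast
  have orb_r: "orb i \<in> {1..r}" if "i \<in> {1..n}" for i using orb(1) that by blast
  have "\<forall>k\<in>{1..r}. \<exists>i\<in>{1..n}. orb i = k" using orb(1) by (metis imageE)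
  then obtain rep where rep: "\<And>k. k \<in> {1..r} \<Longrightarrow> rep k \<in> {1..n}" "\<And>k. k \<in> {1..r} \<Longrightarrow> orb (rep k) = k" by metis
  define t where "t k = (\<Sum>i=1..n. (if orb i = k then 1 else 0) *s cw i)" for k
  have tH: "t k \<in> H" for k unfolding t_def by (intro subspace_sum[OF subspace_H] subspace_scale[OF subspace_H] cw_H)
  have \<alpha>t: "\<alpha> i (t k) = (if orb i = k then 1 else 0)" if i: "i \<in> {1..n}" for i k
  proof -
    have "\<alpha> i (t k) = (\<Sum>j=1..n. (if orb j = k then 1 else 0) * \<alpha> i (cw j))"
      unfolding t_def by (rule dual_sum[OF alpha_dual[OF i] cw_H])
    also have "\<dots> = (\<Sum>j=1..n. if j = i then (if orb j = k then 1 else 0) else 0)"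
      using i by (intro sum.cong refl) (auto simp: alpha_cw)
    finally show ?thesis using i by simp
  qed
  have T_iff: "h \<in> ?T \<longleftrightarrow> (\<forall>i\<in>{1..n}. \<forall>j\<in>{1..n}. orb i = orb j \<longrightarrow> \<alpha> i h = \<alpha> j h)" if h: "h \<in> H" for h
  proof -
    have "\<psi> h = h \<longleftrightarrow> (\<forall>i\<in>{1..n}. \<alpha> (\<sigma> i) h = \<alpha> i h)"
    proof
      assume r: "\<forall>i\<in>{1..n}. \<alpha> (\<sigma> i) h = \<alpha> i h"
      have "\<psi> h - h = 0"
      proof (rule H_separated)
        show "\<psi> h - h \<in> H" by (rule subspace_diff[OF subspace_H \<psi>H[OF h] h])
        show "\<alpha> i (\<psi> h - h) = 0" if "i \<in> {1..n}" for i
          using dual_diff[OF alpha_dual[OF that] \<psi>H[OF h] h] \<alpha>\<psi>[OF that] r that by simp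
      qed
      then show "\<psi> h = h" by simp
    qed (use \<alpha>\<psi> in metis)
    then show ?thesis using orb(3)[of "\<lambda>i. \<alpha> i h"] h by simp
  qed
  have inj_t: "inj_on t {1..r}"
  proof (rule inj_onI)
    fix k l assume kl: "k \<in> {1..r}" "l \<in> {1..r}" "t k = t l"
    then show "k = l" using \<alpha>t[OF rep(1)[OF kl(1)], of k] \<alpha>t[OF rep(1)[OF kl(1)], of l] rep(2)[OF kl(1)]
      by (simp split: if_splits)
  qed
  have dimT: "dim ?T = r"
  proof (rule dim_unique[of "t ` {1..r}"])
    show "t ` {1..r} \<subseteq> ?T"
    proof
      fix h assume "h \<in> t ` {1..r}"
      then obtain k where "h = t k" by blast
      then show "h \<in> ?T" using T_iff[OF tH] \<alpha>t by simp
    qed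
    show "?T \<subseteq> span (t ` {1..r})"
    proof
      fix h assume hT: "h \<in> ?T"
      then have h: "h \<in> H" by simp
      have const: "\<alpha> i h = \<alpha> j h" if "i \<in> {1..n}" "j \<in> {1..n}" "orb i = orb j" for i j
        using T_iff[OF h] hT that by blast
      let ?s = "\<Sum>k\<in>{1..r}. \<alpha> (rep k) h *s t k"
      have sH: "?s \<in> H" by (intro subspace_sum[OF subspace_H] subspace_scale[OF subspace_H] tH)
      have "h - ?s = 0"
      proof (rule H_separated)
        show "h - ?s \<in> H" by (rule subspace_diff[OF subspace_H h sH])
        fix i assume i: "i \<in> {1..n}"
        have "\<alpha> i ?s = (\<Sum>k\<in>{1..r}. \<alpha> (rep k) h * \<alpha> i (t k))" by (rule dual_sum[OF alpha_dual[OF i] tH])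
        also have "\<dots> = (\<Sum>k\<in>{1..r}. if k = orb i then \<alpha> (rep k) h else 0)"
          by (intro sum.cong refl) (simp add: \<alpha>t[OF i])
        also have "\<dots> = \<alpha> (rep (orb i)) h" using orb_r[OF i] by simp
        also have "\<dots> = \<alpha> i h" by (rule const) (use i orb_r rep in auto)
        finally show "\<alpha> i (h - ?s) = 0" using dual_diff[OF alpha_dual[OF i] h sH] by simp
      qed
      then have "h = ?s" by simp
      moreover have "?s \<in> span (t ` {1..r})" by (intro span_sum span_scale span_base) blast
      ultimately show "h \<in> span (t ` {1..r})" by metis
    qed
    show "independent (t ` {1..r})"
      unfolding independent_explicit_finite_subsets
    proof (intro allI impI ballI)
      fix A u w assume A: "A \<subseteq> t ` {1..r}" "finite A" and s: "(\<Sum>w\<in>A. u w *s w) = 0" and w: "w \<in> A"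
      obtain K where K: "K \<subseteq> {1..r}" "finite K" "A = t ` K" using finite_subset_image[OF A(2,1)] by blast
      obtain k where k: "k \<in> K" "w = t k" using w K(3) by blast
      have kr: "k \<in> {1..r}" using k K by blast
      have "(\<Sum>l\<in>K. u (t l) *s t l) = 0"
        using s unfolding K(3) by (subst (asm) sum.reindex) (use inj_on_subset[OF inj_t K(1)] in auto)
      then have "\<alpha> (rep k) (\<Sum>l\<in>K. u (t l) *s t l) = 0" using dual_0[OF alpha_dual[OF rep(1)[OF kr]]] by simp
      moreover have "\<alpha> (rep k) (\<Sum>l\<in>K. u (t l) *s t l) = (\<Sum>l\<in>K. u (t l) * \<alpha> (rep k) (t l))"
        by (rule dual_sum[OF alpha_dual[OF rep(1)[OF kr]] tH])
      moreover have "\<dots> = (\<Sum>l\<in>K. if l = k then u (t l) else 0)"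
        by (intro sum.cong refl) (simp add: \<alpha>t[OF rep(1)[OF kr]] rep(2)[OF kr])
      ultimately show "u w = 0" using k K(2) by simp
    qed
    show "card (t ` {1..r}) = r" using card_image[OF inj_t] by simp
  qed
  define \<omega> where "\<omega> k = (\<lambda>x. \<Sum>i=1..n. (if orb i = k then 1 else 0) * fw i x)" for k
  define S where "S c = (\<lambda>x. \<Sum>k=1..r. of_nat (c k) * \<omega> k x)" for c :: "nat \<Rightarrow> nat"
  have S_dual: "S c \<in> dual_space H" for c
    using dual_add[OF fw_dual] dual_scale[OF fw_dual] dual_outside[OF fw_dual]
    by (simp add: S_def \<omega>_def dual_space_def sum.distrib distrib_left sum_distrib_left mult.left_commute)
  have S_coroot: "S c (coroot i) = of_nat (c (orb i))" if i: "i \<in> {1..n}" for c i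
  proof -
    have "\<omega> k (coroot i) = (if orb i = k then 1 else 0)" for k
    proof -
      have "\<omega> k (coroot i) = (\<Sum>j=1..n. if j = i then (if orb j = k then 1 else 0) else 0)"
        unfolding \<omega>_def using i by (intro sum.cong refl) (auto simp: fw_coroot)
      then show ?thesis using i by simp
    qed
    then have "S c (coroot i) = (\<Sum>k=1..r. if k = orb i then of_nat (c k) else 0)"
      unfolding S_def by (intro sum.cong refl) simp
    then show ?thesis using orb_r[OF i] by simp
  qed
  have P_iff: "\<mu> \<in> ?P \<longleftrightarrow> \<mu> \<in> dual_space H \<and> (\<forall>i\<in>{1..n}. \<mu> (coroot i) \<in> \<nat>) \<and>
      (\<forall>i\<in>{1..n}. \<mu> (coroot (\<sigma> i)) = \<mu> (coroot i))" for \<mu>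
  proof (cases "\<mu> \<in> dual_space H")
    case True
    have "(\<forall>h\<in>H. \<mu> (\<psi> h) = \<mu> h) \<longleftrightarrow> (\<forall>i\<in>{1..n}. \<mu> (coroot (\<sigma> i)) = \<mu> (coroot i))"
    proof
      assume "\<forall>h\<in>H. \<mu> (\<psi> h) = \<mu> h"
      then show "\<forall>i\<in>{1..n}. \<mu> (coroot (\<sigma> i)) = \<mu> (coroot i)" using \<psi>c coroot_H \<sigma>(1) by metis
    next
      assume eq: "\<forall>i\<in>{1..n}. \<mu> (coroot (\<sigma> i)) = \<mu> (coroot i)"
      \<comment> \<open>If \<sigma> missed an index, \<psi> would kill the coweight of that
        index.\<close>
      have surj: "\<exists>i\<in>{1..n}. \<sigma> i = j" if j: "j \<in> {1..n}" for j
      proof (rule ccontr)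
        assume n: "\<not> ?thesis"
        have "\<psi> (cw j) = 0"
        proof (rule H_separated[OF \<psi>H[OF cw_H[OF j]]])
          show "\<alpha> i (\<psi> (cw j)) = 0" if "i \<in> {1..n}" for i
            using \<alpha>\<psi>[OF that] alpha_cw[OF \<sigma>(1)[OF that] j] n that by auto
        qed
        then have "cw j = 0"
          using automorphism_bij[OF a] lin_0[OF automorphism_lin[OF a]] by (metis bij_is_inj injD)
        then show False using alpha_cw[OF j j] dual_0[OF alpha_dual[OF j]] by simp
      qed
      have d: "\<mu> \<circ> \<psi> \<in> dual_space H" by (rule cartan_automorphism_dual[OF \<psi> True])
      have "(\<mu> \<circ> \<psi>) (coroot j) = \<mu> (coroot j)" if j: "j \<in> {1..n}" for j
      proof -
        obtain i where "i \<in> {1..n}" "\<sigma> i = j" using surj[OF j] by blast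
        then show ?thesis using \<psi>c[of i] eq by auto
      qed
      then have "(\<mu> \<circ> \<psi>) h = \<mu> h" if "h \<in> H" for h
        unfolding dual_coroot_expand[OF d that] dual_coroot_expand[OF True that] by (intro sum.cong) auto
      then show "\<forall>h\<in>H. \<mu> (\<psi> h) = \<mu> h" by simp
    qed
    then show ?thesis using True by (auto simp: dominant_weights_def)
  qed (auto simp: dominant_weights_def)
  have "bij_betw S ({1..r} \<rightarrow>\<^sub>E UNIV) ?P"
    unfolding bij_betw_def
  proof
    show "inj_on S ({1..r} \<rightarrow>\<^sub>E UNIV)"
    proof (rule inj_onI)
      fix c d assume cd: "c \<in> {1..r} \<rightarrow>\<^sub>E UNIV" "d \<in> {1..r} \<rightarrow>\<^sub>E UNIV" "S c = S d"
      show "c = d"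
      proof (rule PiE_ext[OF cd(1,2)])
        fix k assume k: "k \<in> {1..r}"
        show "c k = d k"
          using S_coroot[OF rep(1)[OF k], of c] S_coroot[OF rep(1)[OF k], of d] cd(3) rep(2)[OF k] by simp
      qed
    qed
    show "S ` ({1..r} \<rightarrow>\<^sub>E UNIV) = ?P"
    proof
      show "S ` ({1..r} \<rightarrow>\<^sub>E UNIV) \<subseteq> ?P"
      proof
        fix \<mu> assume "\<mu> \<in> S ` ({1..r} \<rightarrow>\<^sub>E UNIV)"
        then obtain c where c: "\<mu> = S c" by blast
        have "\<forall>i\<in>{1..n}. c (orb (\<sigma> i)) = c (orb i)" using orb(2)[of "\<lambda>i. c (orb i)"] by simp
        then show "\<mu> \<in> ?P" unfolding P_iff c using S_dual S_coroot \<sigma>(1) by simp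
      qed
      show "?P \<subseteq> S ` ({1..r} \<rightarrow>\<^sub>E UNIV)"
      proof
        fix \<mu> assume "\<mu> \<in> ?P"
        then have \<mu>: "\<mu> \<in> dual_space H" "\<And>i. i \<in> {1..n} \<Longrightarrow> \<mu> (coroot i) \<in> \<nat>"
          "\<forall>i\<in>{1..n}. \<mu> (coroot (\<sigma> i)) = \<mu> (coroot i)" unfolding P_iff by blast+
        have "\<forall>i\<in>{1..n}. \<exists>x. \<mu> (coroot i) = of_nat x" using \<mu>(2) by (blast elim: Nats_cases)
        then obtain x where x: "\<And>i. i \<in> {1..n} \<Longrightarrow> \<mu> (coroot i) = of_nat (x i)" by metis
        have const: "\<mu> (coroot i) = \<mu> (coroot j)" if "i \<in> {1..n}" "j \<in> {1..n}" "orb i = orb j" for i j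
          using orb(3)[of "\<lambda>i. \<mu> (coroot i)"] \<mu>(3) that by blast
        define c where "c = restrict (\<lambda>k. x (rep k)) {1..r}"
        have "S c (coroot i) = \<mu> (coroot i)" if i: "i \<in> {1..n}" for i
        proof -
          have "S c (coroot i) = of_nat (x (rep (orb i)))" using S_coroot[OF i] orb_r[OF i] by (simp add: c_def)
          also have "\<dots> = \<mu> (coroot (rep (orb i)))" using x[OF rep(1)[OF orb_r[OF i]]] by simp
          also have "\<dots> = \<mu> (coroot i)" by (rule const) (use i orb_r rep in auto)
          finally show ?thesis .
        qed
        then have "S c h = \<mu> h" if "h \<in> H" for h
          unfolding dual_coroot_expand[OF S_dual that] dual_coroot_expand[OF \<mu>(1) that] by (intro sum.cong) auto
        then have "\<mu> = S c" using dual_ext[OF S_dual \<mu>(1)] by metis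
        moreover have "c \<in> {1..r} \<rightarrow>\<^sub>E UNIV" by (simp add: c_def)
        ultimately show "\<mu> \<in> S ` ({1..r} \<rightarrow>\<^sub>E UNIV)" by blast
      qed
    qed
  qed
  then have "freely_generates r \<omega> ?P" by (simp add: freely_generates_def S_def[abs_def])
  then show ?thesis using dimT by blast
qed

end

section \<open>The maximally split pair and the rank\<close>

context maximally_split_pair
begin

lemma \<theta>_\<theta>: "\<theta> (\<theta> v) = v"
  using involutive by (metis comp_apply id_apply)

lemma \<theta>_cartan: "cartan_automorphism \<theta>"
  using automorphism preserves_cartan by (simp add: cartan_automorphism_def)

definition fixed_simple :: "nat set" where
  "fixed_simple = {i \<in> {1..n}. dual_involution \<theta> (\<alpha> i) = \<alpha> i}"

lemma dual_involution_dual: "\<mu> \<in> dual_space H \<Longrightarrow> dual_involution \<theta> \<mu> \<in> dual_space H"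
  unfolding dual_involution_def by (rule cartan_automorphism_dual[OF \<theta>_cartan])

lemma dual_involution_root: "\<beta> \<in> roots H \<Longrightarrow> dual_involution \<theta> \<beta> \<in> roots H"
  unfolding dual_involution_def by (rule cartan_automorphism_root_comp[OF \<theta>_cartan])

text \<open>The negative root granted by the hypothesis is \<Theta>(\<alpha> i), since the nonzero
  vector \<open>\<theta> (e i)\<close> has both weights.\<close>

lemma moved_root_negative:
  assumes i: "i \<in> {1..n}" "i \<notin> fixed_simple" shows "dual_involution \<theta> (\<alpha> i) \<in> negr"
proof -
  have "dual_involution \<theta> (\<alpha> i) \<noteq> \<alpha> i" using i by (simp add: fixed_simple_def)
  then obtain \<beta> where \<beta>: "\<beta> \<in> negative_roots" "\<theta> (e i) \<in> root_space H \<beta>" "\<theta> (e i) \<noteq> 0"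
    using moved_simple_root_e[OF i(1)] by blast
  have eq: "\<alpha> i (\<theta> h) = \<beta> h" if h: "h \<in> H" for h
  proof -
    have "\<theta> h \<in> H" by (rule cartan_automorphism_mem[OF \<theta>_cartan h])
    then have "\<theta> (br (\<theta> h) (e i)) = \<alpha> i (\<theta> h) *s \<theta> (e i)"
      using br_H_e[OF i(1)] lin_scale[OF automorphism_lin[OF automorphism]] by simp
    moreover have "\<theta> (br (\<theta> h) (e i)) = \<beta> h *s \<theta> (e i)"
      using \<beta>(2) h by (simp add: automorphism_br[OF automorphism] \<theta>_\<theta> root_space_def)
    ultimately have "\<alpha> i (\<theta> h) *s \<theta> (e i) = \<beta> h *s \<theta> (e i)" by (simp only:)
    then show ?thesis using \<beta>(3) by simp
  qed
  obtain c :: "nat \<Rightarrow> nat" where c: "- \<beta> = (\<lambda>x. \<Sum>i=1..n. of_nat (c i) * \<alpha> i x)"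
    using \<beta>(1) unfolding negative_roots_def positive_roots_def by auto
  have "- dual_involution \<theta> (\<alpha> i) (cw j) \<in> \<nat>" if j: "j \<in> {1..n}" for j
    using combination_cw[OF c j] eq[OF cw_H[OF j]] by (simp add: dual_involution_def)
  then show ?thesis using dual_involution_root[OF alpha_root[OF i(1)]] by (simp add: negr_def)
qed

lemma \<theta>_coroot: assumes "i \<in> fixed_simple" shows "\<theta> (coroot i) = coroot i"
  using assms fixed_simple_root automorphism_br[OF automorphism] by (simp add: fixed_simple_def coroot_def)

text \<open>The simple roots and coroots of the letters are fixed by the involution, which gives the
  first claim. The difference of \<mu> and its image is a combination of these roots, which gives
  the second.\<close>

lemma dual_involution_reflection:
  assumes "is \<in> lists fixed_simple"
  shows "dual_involution \<theta> (reflection_product is \<mu>) = reflection_product is (dual_involution \<theta> \<mu>)"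
    and "dual_involution \<theta> (\<mu> - reflection_product is \<mu>) = \<mu> - reflection_product is \<mu>"
proof -
  have fixed: "\<alpha> i (\<theta> x) = \<alpha> i x" if "i \<in> fixed_simple" for i x
    using that by (auto simp: fixed_simple_def dual_involution_def fun_eq_iff)
  show "dual_involution \<theta> (reflection_product is \<mu>) = reflection_product is (dual_involution \<theta> \<mu>)"
    using assms
  proof (induction "is" rule: list.induct)
    case (Cons i "is")
    then have i: "i \<in> fixed_simple" and IH: "dual_involution \<theta> (reflection_product is \<mu>) = reflection_product is (dual_involution \<theta> \<mu>)"
      by auto
    have "dual_involution \<theta> (simple_reflection i \<nu>) = simple_reflection i (dual_involution \<theta> \<nu>)" for \<nu>
      by (simp add: dual_involution_def simple_reflection_def fun_eq_iff fixed[OF i] \<theta>_coroot[OF i])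
    then show ?case by (simp add: IH[symmetric])
  qed simp
  show "dual_involution \<theta> (\<mu> - reflection_product is \<mu>) = \<mu> - reflection_product is \<mu>"
    using assms
  proof (induction "is" rule: list.induct)
    case (Cons i "is")
    then have i: "i \<in> fixed_simple" and IH: "dual_involution \<theta> (\<mu> - reflection_product is \<mu>) = \<mu> - reflection_product is \<mu>"
      unfolding Cons_in_lists_iff by blast+
    have IH': "\<mu> (\<theta> x) - reflection_product is \<mu> (\<theta> x) = \<mu> x - reflection_product is \<mu> x" for x
      using fun_cong[OF IH, of x] by (simp add: dual_involution_def)
    show ?case
    proof
      fix x
      show "dual_involution \<theta> (\<mu> - reflection_product (i # is) \<mu>) x = (\<mu> - reflection_product (i # is) \<mu>) x"
        using IH'[of x] by (simp add: dual_involution_def simple_reflection_def fixed[OF i] algebra_simps)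
    qed
  qed (simp add: dual_involution_def fun_eq_iff)
qed

lemma reflection_product_rev: "is \<in> lists {1..n} \<Longrightarrow> reflection_product (rev is) (reflection_product is \<mu>) = \<mu>"
  by (induction "is" arbitrary: \<mu>) (simp_all add: reflection_product_append simple_reflection_simple_reflection)

text \<open>\<open>\<psi>\<close> acts on the dual of \<open>H\<close> as \<open>w\<^sub>0\<^sup>-\<^sup>1 w\<^sub>0' \<Theta>\<close>, which is a diagram automorphism.\<close>

lemma exists_diagram_automorphism:
  "\<exists>ws\<in>lists {1..n}. \<exists>\<sigma>. (\<forall>i\<in>{1..n}. \<sigma> i \<in> {1..n} \<and> \<alpha> i \<circ> (\<theta> \<circ> word ws 1) = \<alpha> (\<sigma> i)) \<and>
    P_Z = {\<mu> \<in> dominant_weights. \<forall>h\<in>H. \<mu> ((\<theta> \<circ> word ws 1) h) = \<mu> h}"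
proof -
  let ?\<Theta> = "dual_involution \<theta>" and ?X = fixed_simple
  have X: "?X \<subseteq> {1..n}" by (auto simp: fixed_simple_def)
  have w0'_eq: "w0' = longest_element ?X" by (simp add: w0'_def fixed_simple_def)
  obtain us where us: "us \<in> lists ?X" "w0' = reflection_product us"
    using longest_element(1)[OF X] unfolding w0'_eq weyl_group_def by blast
  obtain vs where vs: "vs \<in> lists {1..n}" "w0 = reflection_product vs"
    using longest_element(1)[OF order_refl] unfolding w0_def weyl_group_def by blast
  have usn: "us \<in> lists {1..n}" using us(1) lists_mono[OF X] by blast
  \<comment> \<open>\<open>word\<close> acts contragrediently, so the word spells w0'^(-1) w0, the
    inverse of the factor wanted in front of \<Theta>.\<close>
  define ws where "ws = rev us @ vs"
  have ws: "ws \<in> lists {1..n}" using usn vs(1) by (auto simp: ws_def)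
  have ws_eq: "reflection_product ws \<mu> = reflection_product (rev us) (w0 \<mu>)" for \<mu>
    by (simp add: ws_def reflection_product_append vs(2))
  define \<psi> where "\<psi> = \<theta> \<circ> word ws 1"
  have \<psi>: "cartan_automorphism \<psi>" unfolding \<psi>_def by (rule cartan_automorphism_comp[OF \<theta>_cartan word_cartan[OF ws]])
  have \<psi>_iff: "w0 \<nu> = w0' (?\<Theta> \<mu>) \<longleftrightarrow> (\<forall>h\<in>H. \<nu> h = \<mu> (\<psi> h))" if \<mu>: "\<mu> \<in> dual_space H" and \<nu>: "\<nu> \<in> dual_space H" for \<mu> \<nu>
  proof -
    have "w0 \<nu> = w0' (?\<Theta> \<mu>) \<longleftrightarrow> reflection_product ws \<nu> = ?\<Theta> \<mu>"
    proof
      assume "w0 \<nu> = w0' (?\<Theta> \<mu>)"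
      then show "reflection_product ws \<nu> = ?\<Theta> \<mu>"
        unfolding ws_eq us(2) by (simp add: reflection_product_rev[OF usn])
    next
      assume "reflection_product ws \<nu> = ?\<Theta> \<mu>"
      then have "w0' (reflection_product (rev us) (w0 \<nu>)) = w0' (?\<Theta> \<mu>)" unfolding ws_eq by simp
      moreover have "w0' (reflection_product (rev us) \<mu>) = \<mu>" for \<mu>
        using reflection_product_rev[of "rev us" \<mu>] usn unfolding us(2) by (simp add: in_lists_conv_set)
      ultimately show "w0 \<nu> = w0' (?\<Theta> \<mu>)" by simp
    qed
    also have "\<dots> \<longleftrightarrow> (\<forall>h\<in>H. \<nu> h = \<mu> (\<psi> h))"
    proof
      assume eq: "reflection_product ws \<nu> = ?\<Theta> \<mu>"
      show "\<forall>h\<in>H. \<nu> h = \<mu> (\<psi> h)"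
      proof
        fix h assume "h \<in> H"
        from reflection_product_word[OF ws \<nu> this] show "\<nu> h = \<mu> (\<psi> h)"
          unfolding eq by (simp add: dual_involution_def \<psi>_def)
      qed
    next
      assume eq: "\<forall>h\<in>H. \<nu> h = \<mu> (\<psi> h)"
      show "reflection_product ws \<nu> = ?\<Theta> \<mu>"
      proof (rule dual_ext[OF reflection_product_dual[OF ws \<nu>] dual_involution_dual[OF \<mu>]])
        fix h assume "h \<in> H"
        then obtain k where k: "k \<in> H" "h = word ws 1 k"
          using word_cartan[OF ws] unfolding cartan_automorphism_def by blast
        then show "reflection_product ws \<nu> h = ?\<Theta> \<mu> h"
          using reflection_product_word[OF ws \<nu> k(1)] eq by (simp add: dual_involution_def \<psi>_def)
      qed
    qed
    finally show ?thesis .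
  qed
  have P: "P_Z = {\<mu> \<in> dominant_weights. \<forall>h\<in>H. \<mu> (\<psi> h) = \<mu> h}"
  proof -
    \<comment> \<open>\<Theta> fixes \<mu> - w0' \<mu> and commutes with w0', so \<Theta> \<mu> =
      \<mu> - w0' \<mu> + w0' (\<Theta> \<mu>), and the equation defining \<open>P_Z\<close> becomes
      w0 \<mu> = w0' (\<Theta> \<mu>).\<close>
    have "?\<Theta> \<mu> = \<mu> + w0 \<mu> - w0' \<mu> \<longleftrightarrow> (\<forall>h\<in>H. \<mu> (\<psi> h) = \<mu> h)" if "\<mu> \<in> dominant_weights" for \<mu>
    proof -
      have d: "\<mu> \<in> dual_space H" using that by (simp add: dominant_weights_def)
      have "?\<Theta> (\<mu> - w0' \<mu>) = \<mu> - w0' \<mu>" unfolding us(2) by (rule dual_involution_reflection(2)[OF us(1)])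
      moreover have "?\<Theta> (\<mu> - w0' \<mu>) = ?\<Theta> \<mu> - ?\<Theta> (w0' \<mu>)" by (simp add: dual_involution_def fun_eq_iff)
      moreover have "?\<Theta> (w0' \<mu>) = w0' (?\<Theta> \<mu>)" unfolding us(2) by (rule dual_involution_reflection(1)[OF us(1)])
      ultimately have "?\<Theta> \<mu> - w0' (?\<Theta> \<mu>) = \<mu> - w0' \<mu>" by simp
      then have \<Theta>\<mu>: "?\<Theta> \<mu> = \<mu> - w0' \<mu> + w0' (?\<Theta> \<mu>)" by (simp add: diff_eq_eq)
      have "?\<Theta> \<mu> = \<mu> + w0 \<mu> - w0' \<mu> \<longleftrightarrow> w0 \<mu> = w0' (?\<Theta> \<mu>)"
        by (subst \<Theta>\<mu>) (auto simp: algebra_simps)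
      also have "\<dots> \<longleftrightarrow> (\<forall>h\<in>H. \<mu> h = \<mu> (\<psi> h))" by (rule \<psi>_iff[OF d d])
      finally show ?thesis by (simp add: eq_commute)
    qed
    then show ?thesis unfolding P_Z_def by blast
  qed
  have w0_expand: "w0 \<beta> (cw j) = (\<Sum>i=1..n. \<beta> (cw i) * w0 (\<alpha> i) (cw j))" if "\<beta> \<in> roots H" for \<beta> j
    unfolding vs(2) using fun_cong[OF reflection_product_expand[OF root_dual[OF that]], of vs "cw j"] .
  have w0_neg: "w0 (\<alpha> i) \<in> negr" if "i \<in> {1..n}" for i
    unfolding w0_def by (rule longest_element(2)[OF order_refl that])
  have w0_root: "w0 \<beta> \<in> roots H" if "\<beta> \<in> roots H" for \<beta>
    unfolding vs(2) by (rule reflection_product_root[OF vs(1) that])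
  have w0'\<Theta>: "w0' (?\<Theta> (\<alpha> i)) \<in> negr" if i: "i \<in> {1..n}" for i
  proof (cases "i \<in> ?X")
    case True
    then show ?thesis using longest_element(2)[OF X True] by (simp add: w0'_eq fixed_simple_def)
  next
    case False
    let ?g = "?\<Theta> (\<alpha> i)"
    have neg: "?g \<in> negr" by (rule moved_root_negative[OF i False])
    have r: "?g \<in> roots H" using neg by (simp add: negr_def)
    \<comment> \<open>If only fixed simple roots occurred in \<Theta>(\<alpha> i), then \<Theta>
      would fix it, and it would equal \<alpha> i.\<close>
    have "\<exists>j\<in>{1..n}. j \<notin> ?X \<and> ?g (cw j) \<noteq> 0"
    proof (rule ccontr)
      assume n: "\<not> ?thesis"
      have "?g (\<theta> x) = ?g x" for x
      proof -
        have "?g (\<theta> x) = (\<Sum>j=1..n. ?g (cw j) * \<alpha> j (\<theta> x))" using root_expand(1)[OF r] by metis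
        also have "\<dots> = (\<Sum>j=1..n. ?g (cw j) * \<alpha> j x)"
        proof (rule sum.cong[OF refl])
          fix j assume j: "j \<in> {1..n}"
          show "?g (cw j) * \<alpha> j (\<theta> x) = ?g (cw j) * \<alpha> j x"
          proof (cases "j \<in> ?X")
            case True
            then have "?\<Theta> (\<alpha> j) = \<alpha> j" by (simp add: fixed_simple_def)
            then have "\<alpha> j (\<theta> x) = \<alpha> j x" unfolding dual_involution_def by (metis comp_apply)
            then show ?thesis by simp
          next
            case False
            then have "?g (cw j) = 0" using n j by blast
            then show ?thesis by simp
          qed
        qed
        also have "\<dots> = ?g x" using root_expand(1)[OF r] by metis
        finally show ?thesis .
      qed
      then have "\<alpha> i x = ?g x" for x by (simp add: dual_involution_def \<theta>_\<theta>)
      then have "?\<Theta> (\<alpha> i) = \<alpha> i" by (simp add: fun_eq_iff)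
      then show False using False i by (simp add: fixed_simple_def)
    qed
    then obtain j where j: "j \<in> {1..n}" "j \<notin> ?X" "?g (cw j) \<noteq> 0" by blast
    \<comment> \<open>Reflections in the fixed simple roots leave the other coefficients alone, so
      the negative j-th coefficient survives w0'.\<close>
    have keep: "reflection_product is \<mu> (cw j) = \<mu> (cw j)" if "is \<in> lists ?X" for "is" and \<mu>
      using that
    proof (induction "is" rule: list.induct)
      case (Cons k "is")
      then have k: "k \<in> ?X" and IH: "reflection_product is \<mu> (cw j) = \<mu> (cw j)" by auto
      have "k \<in> {1..n}" "k \<noteq> j" using k X j(2) by auto
      then show ?case using IH simple_reflection_cw[OF \<open>k \<in> {1..n}\<close> j(1)] by simp
    qed simp
    have "w0' ?g \<in> posr \<union> negr"
      unfolding us(2) by (rule root_expand(2)[OF reflection_product_root[OF usn r]])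
    moreover have "w0' ?g \<notin> posr"
    proof
      assume "w0' ?g \<in> posr"
      then have "w0' ?g (cw j) \<in> \<nat>" using j(1) by (simp add: posr_def)
      then have "?g (cw j) \<in> \<nat>" unfolding us(2) keep[OF us(1)] .
      moreover have "- ?g (cw j) \<in> \<nat>" using neg j(1) by (simp add: negr_def)
      ultimately show False using nat_neg_zero j(3) by blast
    qed
    ultimately show ?thesis by blast
  qed
  \<comment> \<open>w0 sends this root to w0' (\<Theta> (\<alpha> i)), which is negative; but w0
    makes every simple root negative, so it would send a negative root to a positive one.\<close>
  have pos: "\<alpha> i \<circ> \<psi> \<in> posr" if i: "i \<in> {1..n}" for i
  proof (rule ccontr)
    let ?\<nu> = "\<alpha> i \<circ> \<psi>"
    have r: "?\<nu> \<in> roots H" by (rule cartan_automorphism_root_comp[OF \<psi> alpha_root[OF i]])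
    have "w0 ?\<nu> = w0' (?\<Theta> (\<alpha> i))" using \<psi>_iff[OF alpha_dual[OF i] root_dual[OF r]] by simp
    then have wneg: "w0 ?\<nu> \<in> negr" using w0'\<Theta>[OF i] by simp
    assume "?\<nu> \<notin> posr"
    then have neg: "?\<nu> \<in> negr" using root_expand(2)[OF r] by blast
    have "w0 ?\<nu> (cw j) \<in> \<nat>" if j: "j \<in> {1..n}" for j
    proof -
      have "w0 ?\<nu> (cw j) = (\<Sum>k=1..n. (- ?\<nu> (cw k)) * (- w0 (\<alpha> k) (cw j)))"
        unfolding w0_expand[OF r] by simp
      also have "\<dots> \<in> \<nat>"
      proof (rule nat_sum_prod)
        fix k assume k: "k \<in> {1..n}"
        show "- ?\<nu> (cw k) \<in> \<nat>" using neg k unfolding negr_def by blast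
        show "- w0 (\<alpha> k) (cw j) \<in> \<nat>" using w0_neg[OF k] j unfolding negr_def by blast
      qed simp
      finally show ?thesis .
    qed
    then have "w0 ?\<nu> \<in> posr" using w0_root[OF r] by (simp add: posr_def)
    then show False using wneg pos_neg_disjoint by blast
  qed
  obtain \<sigma> where "\<And>i. i \<in> {1..n} \<Longrightarrow> \<sigma> i \<in> {1..n}" "\<And>i. i \<in> {1..n} \<Longrightarrow> \<alpha> i \<circ> \<psi> = \<alpha> (\<sigma> i)"
    using positive_automorphism_permutes[OF \<psi> pos] by blast
  then have "\<forall>i\<in>{1..n}. \<sigma> i \<in> {1..n} \<and> \<alpha> i \<circ> \<psi> = \<alpha> (\<sigma> i)" by blast
  then show ?thesis using P ws unfolding \<psi>_def by blast
qed

theorem rank_P_Z: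
  assumes "freely_generates m \<nu> P_Z" shows "m = lie_rank (fixed_points \<theta>)"
proof -
  obtain ws \<sigma> where ws: "ws \<in> lists {1..n}"
    and \<sigma>: "\<And>i. i \<in> {1..n} \<Longrightarrow> \<sigma> i \<in> {1..n}" "\<And>i. i \<in> {1..n} \<Longrightarrow> \<alpha> i \<circ> (\<theta> \<circ> word ws 1) = \<alpha> (\<sigma> i)"
    and P: "P_Z = {\<mu> \<in> dominant_weights. \<forall>h\<in>H. \<mu> ((\<theta> \<circ> word ws 1) h) = \<mu> h}"
    using exists_diagram_automorphism by blast
  let ?\<psi> = "\<theta> \<circ> word ws 1"
  let ?T = "{h \<in> H. ?\<psi> h = h}"
  have \<psi>: "cartan_automorphism ?\<psi>" by (rule cartan_automorphism_comp[OF \<theta>_cartan word_cartan[OF ws]])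
  obtain \<omega> where "freely_generates (dim ?T) \<omega> P_Z"
    using diagram_invariant_weights[OF \<psi> \<sigma>] unfolding P by blast
  \<comment> \<open>The given generators and the orbit sums both count the atoms of the
    monoid.\<close>
  then have m: "m = dim ?T" using free_rank_atoms[OF assms] free_rank_atoms by metis
  \<comment> \<open>\<open>lie_rank\<close> picks its Cartan subalgebra by \<open>SOME\<close>, so
    existence has to be established before the choice can be used.\<close>
  from someI_ex[OF exists_cartan_subalgebra[OF fixed_points_subalgebra[OF automorphism]]] have C: "cartan_subalgebra (fixed_points \<theta>) (SOME C. cartan_subalgebra (fixed_points \<theta>) C)" .
  define \<Psi> where "\<Psi> s = (\<lambda>v. \<theta> (word ws s v))" for s
  have "dim (SOME C. cartan_subalgebra (fixed_points \<theta>) C) = dim ?T"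
  proof (rule fixed_torus_dim_eq[of \<Psi>])
    show "x = 0" if "\<And>y. kf x y = 0" for x by (rule killing_nondegenerate[OF that])
    have "\<Psi> 0 = \<theta>" by (simp add: \<Psi>_def word_0[OF ws])
    then show "fixed_torus (\<Psi> 0) (SOME C. cartan_subalgebra (fixed_points \<theta>) C)"
      using fixed_torus_cartan[OF automorphism \<theta>_\<theta> C] by simp
    have "\<Psi> 1 = ?\<psi>" by (simp add: \<Psi>_def fun_eq_iff)
    then show "fixed_torus (\<Psi> 1) ?T" using diagram_fixed_torus[OF \<psi> \<sigma>] by simp
    show "entop \<Psi>"
      using entop_comp[OF entop_lin[OF automorphism_lin[OF automorphism]] entop_word] by (simp only: \<Psi>_def[abs_def])
    show "lie_automorphism (\<Psi> s)" for s
      using automorphism_comp[OF automorphism word_automorphism[OF ws]] by (simp add: \<Psi>_def comp_def)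
  qed
  then show ?thesis using m by (simp add: lie_rank_def)
qed

end

theorem proposition9p2:
  fixes scale :: "complex \<Rightarrow> 'g::ab_group_add \<Rightarrow> 'g"
    and br :: "'g \<Rightarrow> 'g \<Rightarrow> 'g"
    and H :: "'g set"
    and n m :: nat
    and \<alpha> \<nu> :: "nat \<Rightarrow> 'g \<Rightarrow> complex"
    and e f :: "nat \<Rightarrow> 'g"
    and \<theta> :: "'g \<Rightarrow> 'g"
  assumes "maximally_split_pair scale br H n \<alpha> e f \<theta>"
    and "\<And>i. i \<in> {1..m} \<Longrightarrow>
      \<nu> i \<in> semisimple_with_chevalley_generators.dominant_weights scale br H n e f"
    and "freely_generates m \<nu> (maximally_split_pair.P_Z scale br H n \<alpha> e f \<theta>)"
  shows "m = lie_algebra.lie_rank scale br (fixed_points \<theta>)"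
  by (rule maximally_split_pair.rank_P_Z[OF assms(1,3)])

end
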